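(* Let $L>0$, $\mathbb{T}^2=\mathbb{R}^2/(L\mathbb{Z})^2$, $\epsilon>0$, and suppose $\boldsymbol{\eta}^\epsilon:\mathbb{R}^2\to\mathbb{R}^2$ is bounded and Lipschitz continuous with Lipschitz constant $1$. Let $m\in\{1,2\}$, and suppose that $\mathbf{u}$ is a weak solution on $[0,T]$, for some $T>0$, of the calmed Kuramoto-Sivashinsky equation $$\partial_t\mathbf{u}+(\boldsymbol{\eta}^\epsilon(\mathbf{u})\cdot\nabla)\mathbf{u}+\triangle\mathbf{u}+\triangle^2\mathbf{u}=\mathbf{0},\qquad \mathbf{u}(\mathbf{x},0)=\mathbf{u}_0(\mathbf{x}),$$ with periodic boundary conditions on $\mathbb{T}^2$. If $\mathbf{u}_0\in H^m(\mathbb{T}^2)$, then $\mathbf{u}\in L^\infty(0,T;H^m(\mathbb{T}^2))\cap L^2(0,T;H^{m+2}(\mathbb{T}^2))$.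
   Context: $L^2(\mathbb{T}^2)$ and $H^s(\mathbb{T}^2)$ denote the spaces of periodic real $\mathbb{R}^2$-valued functions. Given $\mathbf{u}_0\in L^2(\mathbb{T}^2)$ and $T>0$, a weak solution of the calmed equation on $[0,T]$ is a function $\mathbf{u}\in L^2([0,T];H^2(\mathbb{T}^2))\cap C([0,T];L^2(\mathbb{T}^2))$ with $\partial_t\mathbf{u}\in L^2(0,T;H^{-2}(\mathbb{T}^2))$ such that the equation holds in the sense of $L^2(0,T;H^{-2}(\mathbb{T}^2))$ and the initial condition holds in the sense of $C([0,T];L^2(\mathbb{T}^2))$. Here $(\boldsymbol{\eta}^\epsilon(\mathbf{u})\cdot\nabla)\mathbf{u}=\sum_{j=1}^2\eta^\epsilon_j(\mathbf{u})\,\partial_j\mathbf{u}$. *)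

theory Defs
  imports "HOL-Analysis.Analysis"
begin

text \<open>
  Functions on the torus \<open>\<real>\<^sup>2/(L\<int>)\<^sup>2\<close> are \<open>L\<close>-periodic functions on \<open>real^2\<close>, integrated over one
  period cell. Elements of \<open>L\<^sup>2\<close> and \<open>H\<^sup>k\<close> are represented by Borel functions; norms and
  pairings do not depend on the representative within an almost-everywhere class.
\<close>

definition torus_periodic :: "real \<Rightarrow> (real^2 \<Rightarrow> 'b) \<Rightarrow> bool" where
  "torus_periodic L f \<longleftrightarrow> (\<forall>x j. f (x + axis j L) = f x)"

definition cell :: "real \<Rightarrow> (real^2) set" where
  "cell L = cbox 0 (\<chi> i. L)"

definition L2 :: "real \<Rightarrow> (real^2 \<Rightarrow> real^2) set" where
  "L2 L = {f \<in> borel_measurable borel. torus_periodic L f \<and>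
     set_integrable lborel (cell L) (\<lambda>x. (norm (f x))\<^sup>2)}"

definition L2_inner :: "real \<Rightarrow> (real^2 \<Rightarrow> real^2) \<Rightarrow> (real^2 \<Rightarrow> real^2) \<Rightarrow> real" where
  "L2_inner L f g = (LINT x:cell L|lborel. f x \<bullet> g x)"

definition L2_norm :: "real \<Rightarrow> (real^2 \<Rightarrow> real^2) \<Rightarrow> real" where
  "L2_norm L f = sqrt (L2_inner L f f)"


definition pderivative :: "2 \<Rightarrow> (real^2 \<Rightarrow> real) \<Rightarrow> real^2 \<Rightarrow> real" where
  "pderivative j \<phi> = (\<lambda>x. frechet_derivative \<phi> (at x) (axis j 1))"

fun Ck :: "nat \<Rightarrow> (real^2 \<Rightarrow> real) \<Rightarrow> bool" where
  "Ck 0 \<phi> \<longleftrightarrow> continuous_on UNIV \<phi>"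
| "Ck (Suc k) \<phi> \<longleftrightarrow> \<phi> differentiable_on UNIV \<and> (\<forall>j. Ck k (pderivative j \<phi>))"

definition torus_test :: "real \<Rightarrow> (real^2 \<Rightarrow> real) set" where
  "torus_test L = {\<phi>. torus_periodic L \<phi> \<and> (\<forall>k. Ck k \<phi>)}"

type_synonym multi_index = "2 \<Rightarrow> nat"

definition order_of :: "multi_index \<Rightarrow> nat" where
  "order_of \<alpha> = (\<Sum>j\<in>UNIV. \<alpha> j)"

definition iter_pderivative :: "multi_index \<Rightarrow> (real^2 \<Rightarrow> real) \<Rightarrow> real^2 \<Rightarrow> real" where
  "iter_pderivative \<alpha> \<phi> = (pderivative 1 ^^ \<alpha> 1) ((pderivative 2 ^^ \<alpha> 2) \<phi>)"

definition is_weak_deriv ::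
    "real \<Rightarrow> multi_index \<Rightarrow> (real^2 \<Rightarrow> real^2) \<Rightarrow> (real^2 \<Rightarrow> real^2) \<Rightarrow> bool" where
  "is_weak_deriv L \<alpha> f g \<longleftrightarrow> (\<forall>\<phi>\<in>torus_test L.
     (LINT x:cell L|lborel. iter_pderivative \<alpha> \<phi> x *\<^sub>R f x) =
     (-1) ^ order_of \<alpha> *\<^sub>R (LINT x:cell L|lborel. \<phi> x *\<^sub>R g x))"

text \<open>A representative of the weak derivative, which is unique almost everywhere when it exists.\<close>

definition weak_deriv :: "real \<Rightarrow> multi_index \<Rightarrow> (real^2 \<Rightarrow> real^2) \<Rightarrow> real^2 \<Rightarrow> real^2" where
  "weak_deriv L \<alpha> f = (SOME g. g \<in> L2 L \<and> is_weak_deriv L \<alpha> f g)"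

definition sobolev :: "real \<Rightarrow> nat \<Rightarrow> (real^2 \<Rightarrow> real^2) set" where
  "sobolev L k = {f \<in> L2 L. \<forall>\<alpha>. order_of \<alpha> \<le> k \<longrightarrow> (\<exists>g\<in>L2 L. is_weak_deriv L \<alpha> f g)}"

definition sobolev_norm :: "real \<Rightarrow> nat \<Rightarrow> (real^2 \<Rightarrow> real^2) \<Rightarrow> real" where
  "sobolev_norm L k f = sqrt (\<Sum>\<alpha> | order_of \<alpha> \<le> k. (L2_norm L (weak_deriv L \<alpha> f))\<^sup>2)"

definition weak_partial :: "real \<Rightarrow> 2 \<Rightarrow> (real^2 \<Rightarrow> real^2) \<Rightarrow> real^2 \<Rightarrow> real^2" where
  "weak_partial L j = weak_deriv L ((\<lambda>_. 0)(j := 1))"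

definition weak_laplacian :: "real \<Rightarrow> (real^2 \<Rightarrow> real^2) \<Rightarrow> real^2 \<Rightarrow> real^2" where
  "weak_laplacian L f = (\<lambda>x. \<Sum>j\<in>UNIV. weak_deriv L ((\<lambda>_. 0)(j := 2)) f x)"


text \<open>
  Elements of \<open>H\<^sup>-\<^sup>2\<close> are bounded linear functionals on \<open>H\<^sup>2\<close>; only their values on \<open>H\<^sup>2\<close> matter.
\<close>

type_synonym functional = "(real^2 \<Rightarrow> real^2) \<Rightarrow> real"

definition H_minus2 :: "real \<Rightarrow> functional set" where
  "H_minus2 L = {l.
     (\<forall>v\<in>sobolev L 2. \<forall>w\<in>sobolev L 2. l (\<lambda>x. v x + w x) = l v + l w) \<and>
     (\<forall>c. \<forall>w\<in>sobolev L 2. l (\<lambda>x. c *\<^sub>R w x) = c * l w) \<and>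
     (\<exists>C. \<forall>w\<in>sobolev L 2. \<bar>l w\<bar> \<le> C * sobolev_norm L 2 w)}"

definition H_minus2_norm :: "real \<Rightarrow> functional \<Rightarrow> real" where
  "H_minus2_norm L l = (SUP w\<in>{w \<in> sobolev L 2. sobolev_norm L 2 w \<le> 1}. \<bar>l w\<bar>)"

text \<open>
  The embedding of \<open>L\<^sup>2\<close> into \<open>H\<^sup>-\<^sup>2\<close> and the distributional Laplacian of an \<open>L\<^sup>2\<close> function, an
  element of \<open>H\<^sup>-\<^sup>2\<close> by duality. For \<open>f \<in> H\<^sup>2\<close>, the bi-Laplacian of \<open>f\<close> is the latter applied to
  the function \<open>weak_laplacian L f\<close>.
\<close>

definition embed_dual :: "real \<Rightarrow> (real^2 \<Rightarrow> real^2) \<Rightarrow> functional" where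
  "embed_dual L f = (\<lambda>w. L2_inner L f w)"

definition laplacian_dual :: "real \<Rightarrow> (real^2 \<Rightarrow> real^2) \<Rightarrow> functional" where
  "laplacian_dual L f = (\<lambda>w. L2_inner L f (weak_laplacian L w))"

definition bilaplacian_dual :: "real \<Rightarrow> (real^2 \<Rightarrow> real^2) \<Rightarrow> functional" where
  "bilaplacian_dual L f = laplacian_dual L (weak_laplacian L f)"


text \<open>
  A space of functions \<open>'x \<Rightarrow> 'b\<close> is given by a carrier \<open>V\<close> and a seminorm \<open>N\<close> on it (vanishing
  exactly on the representatives of zero). Strong measurability is in the sense of Bochner: \<open>u\<close> is almost
  everywhere the limit in \<open>N\<close> of simple functions with values in \<open>V\<close>.
\<close>

definition simple_in :: "real \<Rightarrow> 'v set \<Rightarrow> (real \<Rightarrow> 'v) \<Rightarrow> bool" where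
  "simple_in T V s \<longleftrightarrow> finite (s ` {0..T}) \<and> s ` {0..T} \<subseteq> V \<and>
     (\<forall>y. {t\<in>{0..T}. s t = y} \<in> sets lebesgue)"

definition strongly_measurable ::
    "real \<Rightarrow> ('x \<Rightarrow> 'b::real_vector) set \<Rightarrow> (('x \<Rightarrow> 'b) \<Rightarrow> real) \<Rightarrow> (real \<Rightarrow> 'x \<Rightarrow> 'b) \<Rightarrow> bool" where
  "strongly_measurable T V N u \<longleftrightarrow> (\<exists>s. (\<forall>n::nat. simple_in T V (s n)) \<and>
     (AE t in lebesgue. t \<in> {0..T} \<longrightarrow>
        u t \<in> V \<and> (\<lambda>n. N (\<lambda>x. s n t x - u t x)) \<longlonglongrightarrow> 0))"

definition L2_time ::
    "real \<Rightarrow> ('x \<Rightarrow> 'b::real_vector) set \<Rightarrow> (('x \<Rightarrow> 'b) \<Rightarrow> real) \<Rightarrow> (real \<Rightarrow> 'x \<Rightarrow> 'b) set" where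
  "L2_time T V N = {u. strongly_measurable T V N u \<and>
     set_integrable lebesgue {0..T} (\<lambda>t. (N (u t))\<^sup>2)}"

definition Linf_time ::
    "real \<Rightarrow> ('x \<Rightarrow> 'b::real_vector) set \<Rightarrow> (('x \<Rightarrow> 'b) \<Rightarrow> real) \<Rightarrow> (real \<Rightarrow> 'x \<Rightarrow> 'b) set" where
  "Linf_time T V N = {u. strongly_measurable T V N u \<and>
     (\<exists>C. AE t in lebesgue. t \<in> {0..T} \<longrightarrow> N (u t) \<le> C)}"

definition C_time ::
    "real \<Rightarrow> ('x \<Rightarrow> 'b::real_vector) set \<Rightarrow> (('x \<Rightarrow> 'b) \<Rightarrow> real) \<Rightarrow> (real \<Rightarrow> 'x \<Rightarrow> 'b) set" where
  "C_time T V N = {u. \<forall>t\<in>{0..T}. u t \<in> V \<and>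
     ((\<lambda>s. N (\<lambda>x. u s x - u t x)) \<longlongrightarrow> 0) (at t within {0..T})}"

definition time_test :: "real \<Rightarrow> (real \<Rightarrow> real) set" where
  "time_test T = {\<theta>. (\<forall>n. ((deriv ^^ n) \<theta>) differentiable_on UNIV) \<and>
     (\<exists>a b. 0 < a \<and> b < T \<and> (\<forall>t. t \<notin> {a..b} \<longrightarrow> \<theta> t = 0))}"

text \<open>
  \<open>g = \<partial>\<^sub>t u\<close> in the sense of distributions on \<open>(0,T)\<close> with values in \<open>H\<^sup>-\<^sup>2\<close>. The identity between
  \<open>H\<^sup>-\<^sup>2\<close>-valued integrals is an identity of functionals, and evaluation at \<open>w\<close> may be taken under
  the integral.
\<close>

definition is_time_deriv ::
    "real \<Rightarrow> real \<Rightarrow> (real \<Rightarrow> real^2 \<Rightarrow> real^2) \<Rightarrow> (real \<Rightarrow> functional) \<Rightarrow> bool" where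
  "is_time_deriv L T u g \<longleftrightarrow> (\<forall>\<theta>\<in>time_test T. \<forall>w\<in>sobolev L 2.
     (LINT t:{0..T}|lebesgue. deriv \<theta> t * embed_dual L (u t) w) =
     - (LINT t:{0..T}|lebesgue. \<theta> t * g t w))"


definition calmed_advection ::
    "real \<Rightarrow> (real^2 \<Rightarrow> real^2) \<Rightarrow> (real^2 \<Rightarrow> real^2) \<Rightarrow> real^2 \<Rightarrow> real^2" where
  "calmed_advection L \<eta> v = (\<lambda>x. \<Sum>j\<in>UNIV. (\<eta> (v x) $ j) *\<^sub>R weak_partial L j v x)"

definition calmed_KS_weak_solution ::
    "real \<Rightarrow> (real^2 \<Rightarrow> real^2) \<Rightarrow> real \<Rightarrow> (real^2 \<Rightarrow> real^2) \<Rightarrow> (real \<Rightarrow> real^2 \<Rightarrow> real^2) \<Rightarrow> bool" where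
  "calmed_KS_weak_solution L \<eta> T u0 u \<longleftrightarrow>
     u0 \<in> L2 L \<and>
     u \<in> L2_time T (sobolev L 2) (sobolev_norm L 2) \<inter> C_time T (L2 L) (L2_norm L) \<and>
     (\<exists>g \<in> L2_time T (H_minus2 L) (H_minus2_norm L).
        is_time_deriv L T u g \<and>
        (AE t in lebesgue. t \<in> {0..T} \<longrightarrow> (\<forall>w\<in>sobolev L 2.
           g t w + embed_dual L (calmed_advection L \<eta> (u t)) w
             + embed_dual L (weak_laplacian L (u t)) w + bilaplacian_dual L (u t) w = 0))) \<and>
     (AE x in lborel. u 0 x = u0 x)"

end

(*
  In the real Fourier basis cos + sin, the coefficient a of an eigenmode of - Laplacian with
  eigenvalue l satisfies a' = - (l^2 - l) a - f, where f is the coefficient of the nonlinear term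
  (eta(u) . grad) u. Since eta is bounded, this term is controlled in L^2(0,T;L^2) by the norm of u
  in L^2(0,T;H^2), so it can be treated as a given forcing. Multiplying the equation by l^m a and
  using Young's inequality gives, for m = 1, 2,

    l^m a(t)^2 + 1/2 int_0^t l^(m+2) a^2 <= l^m a(0)^2 + int_0^t (3 l^2 a^2 + f^2),

  and by Parseval the sum over all modes bounds u in L^infinity(0,T;H^m) and L^2(0,T;H^(m+2)).
*)
theory Submission imports Defs begin

section \<open>Weak derivatives in time\<close>

text \<open>Two gaps lie between the overview and the definitions. The time derivative exists only
  as a functional on H^2, so multiplying the equation by l^m a is not a pairing of functions;
  evaluation at a single basis field turns it into an integrable scalar derivative of a continuous
  coefficient, for which the square rule is proved directly. And Sobolev membership is stated
  through weak derivatives picked by a choice operator, so Parseval, which needs completeness of the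
  basis, and Riesz-Fischer must first identify H^s with weighted square-summable coefficients. The
  range m = 1, 2 reflects the forcing: f is controlled in L^2 only, so l^m a f has to be absorbed by
  f^2, l^(m+2) a^2 and l^2 a^2, which works up to m = 2, where l^2 a is exactly what the dissipation
  controls. The weight actually used is 1 + l^m, since the mean has eigenvalue 0 and l^m does not
  see it. All estimates concern finite sets of modes, with a bound independent of the set, so
  infinite sums and integrals meet only in the final monotone limit.\<close>

definition flat_exp :: "real poly \<Rightarrow> real \<Rightarrow> real" where
  "flat_exp p x = (if x > 0 then poly p (inverse x) * exp (- inverse x) else 0)"

lemma poly_times_exp_minus_tendsto_0: "((\<lambda>y. poly p y * exp (- y)) \<longlongrightarrow> (0::real)) at_top"
proof -
  have "((\<lambda>y. \<Sum>i\<le>degree p. coeff p i * (y ^ i / exp y)) \<longlongrightarrow> (\<Sum>i\<le>degree p. coeff p i * 0)) at_top"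
    by (intro tendsto_sum tendsto_mult tendsto_const tendsto_power_div_exp_0)
  then show ?thesis
    by (simp add: poly_altdef sum_distrib_right exp_minus divide_inverse mult.assoc)
qed

lemma flat_exp_tendsto_0: "(flat_exp p \<longlongrightarrow> 0) (at 0)"
proof -
  have "(flat_exp p \<longlongrightarrow> 0) (at_left 0)"
    by (rule tendsto_eventually) (auto simp: eventually_at_filter flat_exp_def)
  moreover have "(flat_exp p \<longlongrightarrow> 0) (at_right 0)"
  proof (rule Lim_transform_eventually)
    show "((\<lambda>x. poly p (inverse x) * exp (- inverse x)) \<longlongrightarrow> 0) (at_right 0)"
      using filterlim_compose[OF poly_times_exp_minus_tendsto_0 filterlim_inverse_at_top_right] .
    show "\<forall>\<^sub>F x in at_right 0. poly p (inverse x) * exp (- inverse x) = flat_exp p x"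
      by (auto simp: eventually_at_filter flat_exp_def)
  qed
  ultimately show ?thesis by (simp add: filterlim_split_at)
qed

text \<open>With y = 1/x one has d/dx = -y^2 d/dy, which sends p(y) exp(-y) to y^2 (p - p')(y)
  exp(-y); \<open>[:0, 0, 1:]\<close> is y^2. Carrying the polynomial along makes the family of flat
  functions closed under differentiation.\<close>

lemma flat_exp_has_derivative:
  "(flat_exp p has_real_derivative flat_exp ([:0, 0, 1:] * (p - pderiv p)) x) (at x)"
proof -
  consider "x < 0" | "x = 0" | "x > 0" by linarith
  then show ?thesis
  proof cases
    case 1
    have "((\<lambda>_. 0) has_real_derivative 0) (at x)" by simp
    then have "(flat_exp p has_real_derivative 0) (at x)"
      by (rule has_field_derivative_transform_within_open[where S = "{..<0}"])
        (use 1 in \<open>auto simp: flat_exp_def\<close>)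
    then show ?thesis using 1 by (simp add: flat_exp_def)
  next
    case 2
    have "(flat_exp p has_real_derivative 0) (at 0)"
      unfolding has_field_derivative_iff
    proof (rule Lim_transform_eventually)
      \<comment> \<open>Dividing by h multiplies the polynomial by its variable 1/h, so the
        difference quotient at 0 is itself a flat function.\<close>
      show "(flat_exp (pCons 0 p) \<longlongrightarrow> 0) (at 0)" by (rule flat_exp_tendsto_0)
      show "\<forall>\<^sub>F h in at 0. flat_exp (pCons 0 p) h = (flat_exp p h - flat_exp p 0) / (h - 0)"
        by (auto simp: eventually_at_filter flat_exp_def field_simps)
    qed
    then show ?thesis using 2 by (simp add: flat_exp_def)
  next
    case 3
    have "((\<lambda>x. poly p (inverse x) * exp (- inverse x)) has_real_derivative
        flat_exp ([:0, 0, 1:] * (p - pderiv p)) x) (at x)"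
      using 3 by (auto intro!: derivative_eq_intros DERIV_chain2[OF poly_DERIV]
          simp: flat_exp_def algebra_simps power2_eq_square)
    then show ?thesis
      by (rule has_field_derivative_transform_within_open[where S = "{0<..}"])
        (use 3 in \<open>auto simp: flat_exp_def\<close>)
  qed
qed

text \<open>Membership in \<open>time_test\<close> asks that every iterate of \<open>deriv\<close>
  be differentiable. A class closed under \<open>deriv\<close> reduces this to induction; affine
  arguments, constants and products are built in because bumps get rescaled, shifted and
  normalised.\<close>

inductive smooth_comb :: "(real \<Rightarrow> real) \<Rightarrow> bool" where
  flat: "smooth_comb (\<lambda>x. flat_exp p (c * x + d))"
| const: "smooth_comb (\<lambda>_. c)"
| add: "smooth_comb f \<Longrightarrow> smooth_comb g \<Longrightarrow> smooth_comb (\<lambda>x. f x + g x)"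
| mult: "smooth_comb f \<Longrightarrow> smooth_comb g \<Longrightarrow> smooth_comb (\<lambda>x. f x * g x)"

lemma smooth_comb_has_derivative:
  assumes "smooth_comb f"
  shows "\<exists>f'. smooth_comb f' \<and> (\<forall>x. (f has_real_derivative f' x) (at x))"
  using assms
proof induction
  case (flat p c d)
  let ?q = "[:0, 0, 1:] * (p - pderiv p)"
  have "smooth_comb (\<lambda>x. flat_exp ?q (c * x + d) * c)"
    by (intro smooth_comb.intros)
  moreover have "((\<lambda>x. flat_exp p (c * x + d)) has_real_derivative flat_exp ?q (c * x + d) * c) (at x)" for x
    by (rule DERIV_chain2[OF flat_exp_has_derivative]) (auto intro!: derivative_eq_intros)
  ultimately show ?case by blast
next
  case (const c)
  show ?case by (rule exI[of _ "\<lambda>_. 0"]) (auto intro: smooth_comb.const)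
next
  case (add f g)
  then obtain f' g' where "smooth_comb f'" "\<forall>x. (f has_real_derivative f' x) (at x)"
    "smooth_comb g'" "\<forall>x. (g has_real_derivative g' x) (at x)" by blast
  then show ?case
    by (intro exI[of _ "\<lambda>x. f' x + g' x"]) (auto intro: smooth_comb.add DERIV_add)
next
  case (mult f g)
  then obtain f' g' where "smooth_comb f'" "\<forall>x. (f has_real_derivative f' x) (at x)"
    "smooth_comb g'" "\<forall>x. (g has_real_derivative g' x) (at x)" by blast
  with mult show ?case
    by (intro exI[of _ "\<lambda>x. f' x * g x + g' x * f x"])
      (auto intro!: smooth_comb.add smooth_comb.mult DERIV_mult)
qed

lemma smooth_comb_deriv:
  assumes "smooth_comb f"
  shows "smooth_comb (deriv f)" "(f has_real_derivative deriv f x) (at x)"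
proof -
  obtain f' where f': "smooth_comb f'" "\<And>x. (f has_real_derivative f' x) (at x)"
    using smooth_comb_has_derivative[OF assms] by blast
  then have "deriv f = f'" by (auto simp: DERIV_imp_deriv)
  with f' show "smooth_comb (deriv f)" "(f has_real_derivative deriv f x) (at x)" by auto
qed

lemma smooth_comb_iterated_deriv:
  assumes "smooth_comb f"
  shows "((deriv ^^ n) f) differentiable_on UNIV"
proof -
  have "smooth_comb ((deriv ^^ n) f)" for n
    by (induction n) (auto simp: assms smooth_comb_deriv(1))
  then show ?thesis
    using smooth_comb_deriv(2) unfolding differentiable_on_def
    by (meson field_differentiable_def field_differentiable_imp_differentiable)
qed

text \<open>The product exp(-1/x) exp(-1/(1-x)) is a smooth bump on (0,1), and B is its normalised
  antiderivative. The density is required to be smooth under every affine substitution because the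
  test functions are built from steep copies of B.\<close>

lemma smooth_step_exists:
  obtains B \<rho> :: "real \<Rightarrow> real" where
    "\<And>c d. smooth_comb (\<lambda>x. \<rho> (c * x + d))" "\<And>x. (B has_real_derivative \<rho> x) (at x)"
    "\<And>x. 0 \<le> \<rho> x" "\<And>x. x \<notin> {0..1} \<Longrightarrow> \<rho> x = 0"
    "\<And>x. x \<le> 0 \<Longrightarrow> B x = 0" "\<And>x. x \<ge> 1 \<Longrightarrow> B x = 1" "\<And>x. 0 \<le> B x \<and> B x \<le> 1"
proof -
  define r where "r x = flat_exp 1 x * flat_exp 1 (1 - x)" for x
  have r0: "0 \<le> r x" and r1: "x \<notin> {0<..<1} \<Longrightarrow> r x = 0" and r2: "x \<in> {0<..<1} \<Longrightarrow> 0 < r x" for x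
    by (auto simp: r_def flat_exp_def)
  have r_smooth: "smooth_comb (\<lambda>x. r (c * x + d))" for c d
  proof -
    have "smooth_comb (\<lambda>x. flat_exp 1 (c * x + d) * flat_exp 1 ((- c) * x + (1 - d)))"
      by (intro smooth_comb.intros)
    then show ?thesis by (simp add: r_def algebra_simps)
  qed
  have "isCont r x" for x
    using smooth_comb_deriv(2)[OF r_smooth[of 1 0]] by (auto intro: DERIV_isCont)
  then obtain F where F: "\<And>x. (F has_real_derivative r x) (at x)"
    using einterval_antiderivative[of "-\<infinity>" \<infinity> r]
    by (auto simp: has_real_derivative_iff_has_vector_derivative)
  have mono: "F x \<le> F y" if "x \<le> y" for x y
    using DERIV_nonneg_imp_nondecreasing[OF that] F r0 by blast
  \<comment> \<open>The normalising constant is nonzero: by the mean value theorem it is a value of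
    the bump inside (0,1).\<close>
  have "F 0 < F 1"
  proof -
    obtain z where "z > 0" "z < 1" "F 1 - F 0 = (1 - 0) * r z"
      using MVT2[of 0 1 F r] F by auto
    then show ?thesis using r2[of z] by auto
  qed
  define c where "c = F 1 - F 0"
  have c: "c > 0" using \<open>F 0 < F 1\<close> by (simp add: c_def)
  have left: "F x = F 0" if "x \<le> 0" for x
  proof (cases "x = 0")
    case False
    with that have "x < 0" by simp
    then obtain z where "z > x" "z < 0" "F 0 - F x = (0 - x) * r z"
      using MVT2[of x 0 F r] F by auto
    then show ?thesis using r1[of z] by auto
  qed simp
  have right: "F x = F 1" if "x \<ge> 1" for x
  proof (cases "x = 1")
    case False
    with that have "x > 1" by simp
    then obtain z where "z > 1" "z < x" "F x - F 1 = (x - 1) * r z"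
      using MVT2[of 1 x F r] F by auto
    then show ?thesis using r1[of z] by auto
  qed simp
  show ?thesis
  proof (rule that[of "\<lambda>x. r x / c" "\<lambda>x. (F x - F 0) / c"])
    show "smooth_comb (\<lambda>x. r (a * x + d) / c)" for a d
      using smooth_comb.mult[OF r_smooth smooth_comb.const, of a d "inverse c"]
      by (simp add: divide_inverse)
    show "((\<lambda>x. (F x - F 0) / c) has_real_derivative r x / c) (at x)" for x
      using c by (auto intro!: derivative_eq_intros F simp: field_simps)
    show "0 \<le> r x / c" for x using r0 c by simp
    show "x \<notin> {0..1} \<Longrightarrow> r x / c = 0" for x using r1 by auto
    show "(F x - F 0) / c = 0" if "x \<le> 0" for x using left[OF that] by simp
    show "(F x - F 0) / c = 1" if "x \<ge> 1" for x using right[OF that] c by (simp add: c_def)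
    show "0 \<le> (F x - F 0) / c \<and> (F x - F 0) / c \<le> 1" for x
    proof -
      have "F 0 \<le> F x" using mono[of 0 x] left[of x] by (cases "x \<le> 0") auto
      moreover have "F x \<le> F 1" using mono[of x 1] right[of x] by (cases "x \<ge> 1") auto
      ultimately show ?thesis using c by (auto simp: c_def)
    qed
  qed
qed

text \<open>Testing against smoothed indicators of \<open>(s,t]\<close> recovers the fundamental theorem.\<close>

lemma weak_time_derivative_increment:
  fixes a g :: "real \<Rightarrow> real"
  assumes a: "continuous_on {0..T} a" and g: "g absolutely_integrable_on {0..T}"
    and weak: "\<And>\<theta>. \<theta> \<in> time_test T \<Longrightarrow>
      (LINT t:{0..T}|lebesgue. deriv \<theta> t * a t) = - (LINT t:{0..T}|lebesgue. \<theta> t * g t)"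
    and st: "0 < s" "s \<le> t" "t < T"
  shows "a t - a s = integral {s..t} g"
proof -
  obtain B \<rho> :: "real \<Rightarrow> real" where
    \<rho>: "\<And>c d. smooth_comb (\<lambda>x. \<rho> (c * x + d))" and B: "\<And>x. (B has_real_derivative \<rho> x) (at x)"
    and \<rho>0: "\<And>x. 0 \<le> \<rho> x" and \<rho>1: "\<And>x. x \<notin> {0..1} \<Longrightarrow> \<rho> x = 0"
    and B0: "\<And>x. x \<le> 0 \<Longrightarrow> B x = 0" and B1: "\<And>x. x \<ge> 1 \<Longrightarrow> B x = 1"
    and B01: "\<And>x. 0 \<le> B x \<and> B x \<le> 1"
    by (rule smooth_step_exists, rule that)
  have \<rho>cont: "continuous_on S (\<lambda>x. \<rho> (c * x + d))" for S c d
    using smooth_comb_deriv(2)[OF \<rho>] by (auto intro!: continuous_at_imp_continuous_on DERIV_isCont)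
  have \<rho>cont': "continuous_on S (\<lambda>x. \<rho> (c * x - d))" for S c d
    using \<rho>cont[of S c "- d"] by simp
  have Bc: "((\<lambda>x. B (c * x + d)) has_real_derivative \<rho> (c * x + d) * c) (at x)" for c d x
    by (rule DERIV_chain2[OF B]) (auto intro!: derivative_eq_intros)
  have a_int: "(\<lambda>x. h x * a x) absolutely_integrable_on {0..T}" if "continuous_on {0..T} h" for h
    using that a by (intro absolutely_integrable_continuous_real continuous_intros)
  \<comment> \<open>The kernels n rho(n(x-r)) live on [r, r+1/n], to the right of r. Once 1/n < T -
    r their whole mass 1 lies in [0,T], and continuity of a at r gives the limit.\<close>
  have delta: "(\<lambda>n. integral {0..T} (\<lambda>x. \<rho> (real n * x + - (real n * r)) * real n * a x)) \<longlonglongrightarrow> a r"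
    if r: "0 < r" "r < T" for r
  proof (rule LIMSEQ_I)
    fix e :: real assume e: "0 < e"
    obtain d where d: "d > 0" "\<And>x. x \<in> {0..T} \<Longrightarrow> dist x r < d \<Longrightarrow> dist (a x) (a r) < e / 2"
      using a r e unfolding continuous_on_iff by (metis atLeastAtMost_iff half_gt_zero less_eq_real_def)
    obtain N :: nat where N: "N > 0" "1 / N < min d (T - r)"
      using reals_Archimedean[of "min d (T - r)"] d(1) r(2)
      by (metis One_nat_def Suc_pred diff_gt_0_iff_gt inverse_eq_divide min_less_iff_conj zero_less_Suc)
    have "norm (integral {0..T} (\<lambda>x. \<rho> (real n * x + - (real n * r)) * real n * a x) - a r) < e"
      if n: "n \<ge> N" for n
    proof -
      define k where "k x = \<rho> (real n * x + - (real n * r)) * real n" for x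
      have n0: "0 < n" and n1: "1 / n < d" "1 / n < T - r"
        using n N by (auto simp: frac_le intro: le_less_trans[OF frac_le[of 1 1 "real N"]])
      have kint: "(k has_integral (B (real n * T + - (real n * r)) - B (real n * 0 + - (real n * r)))) {0..T}"
        unfolding k_def
        by (rule fundamental_theorem_of_calculus)
          (use r in simp, unfold has_real_derivative_iff_has_vector_derivative[symmetric],
            rule has_field_derivative_at_within, rule Bc)
      have "1 \<le> real n * (T - r)" using n1 n0 by (simp add: field_simps)
      then have kint: "(k has_integral 1) {0..T}"
        using kint B0[of "- (real n * r)"] B1[of "real n * T + - (real n * r)"] r
        by (simp add: algebra_simps)
      have kcont: "continuous_on {0..T} k"
        unfolding k_def by (intro continuous_intros \<rho>cont)
      have "integral {0..T} (\<lambda>x. k x * a x) - a r = integral {0..T} (\<lambda>x. k x * a x) - integral {0..T} (\<lambda>x. k x * a r)"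
        using kint by (simp add: integral_unique)
      also have "\<dots> = integral {0..T} (\<lambda>x. k x * (a x - a r))"
        by (subst integral_diff[symmetric])
          (auto intro!: integrable_continuous_real continuous_intros kcont a simp: algebra_simps)
      finally have eq: "integral {0..T} (\<lambda>x. k x * a x) - a r = integral {0..T} (\<lambda>x. k x * (a x - a r))" .
      have "norm (integral {0..T} (\<lambda>x. k x * (a x - a r))) \<le> integral {0..T} (\<lambda>x. k x * (e / 2))"
      proof (rule integral_norm_bound_integral)
        fix x assume x: "x \<in> {0..T}"
        have k0: "0 \<le> k x" by (simp add: k_def \<rho>0)
        show "norm (k x * (a x - a r)) \<le> k x * (e / 2)"
        proof (cases "real n * x + - (real n * r) \<in> {0..1}")
          case True
          then have "0 \<le> real n * (x - r)" "real n * (x - r) \<le> 1" by (auto simp: algebra_simps)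
          then have "0 \<le> x - r" "x - r \<le> 1 / n" using n0
            by (auto simp: field_simps zero_le_mult_iff)
          then have "dist x r < d" using n1 by (auto simp: dist_real_def)
          then have "\<bar>a x - a r\<bar> \<le> e / 2" using d(2) x by (force simp: dist_real_def)
          then have "k x * \<bar>a x - a r\<bar> \<le> k x * (e / 2)" using k0 by (rule mult_left_mono)
          then show ?thesis using k0 by (simp add: abs_mult)
        next
          case False
          then show ?thesis by (simp add: k_def \<rho>1)
        qed
      qed (auto intro!: integrable_continuous_real continuous_intros kcont a)
      also have "\<dots> = e / 2" using kint by (simp add: integral_unique)
      finally show ?thesis using eq e unfolding k_def by (simp add: mult.assoc)
    qed
    then show "\<exists>no. \<forall>n\<ge>no. norm (integral {0..T} (\<lambda>x. \<rho> (real n * x + - (real n * r)) * real n * a x) - a r) < e"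
      by blast
  qed
  \<comment> \<open>A ramp on [s, s+1/n] minus a ramp on [t, t+1/n]. Both start at the endpoint and
    go right, so the pointwise limit is the indicator of the half-open interval, and the support
    stays inside (0,T) once t + 1/n < T.\<close>
  define \<theta> where "\<theta> n x = B (real n * x + - (real n * s)) - B (real n * x + - (real n * t))" for n x
  have \<theta>': "(\<theta> n has_real_derivative \<rho> (real n * x + - (real n * s)) * real n - \<rho> (real n * x + - (real n * t)) * real n) (at x)" for n x
    unfolding \<theta>_def by (intro DERIV_diff Bc)
  have d\<theta>: "deriv (\<theta> n) = (\<lambda>x. \<rho> (real n * x + - (real n * s)) * real n - \<rho> (real n * x + - (real n * t)) * real n)" for n
    using \<theta>' by (auto intro: DERIV_imp_deriv)
  obtain N :: nat where N: "N > 0" "1 / N < T - t"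
    using reals_Archimedean[of "T - t"] st
    by (metis One_nat_def Suc_pred diff_gt_0_iff_gt inverse_eq_divide zero_less_Suc)
  have test: "\<theta> n \<in> time_test T" if n: "n \<ge> N" for n
  proof -
    have "smooth_comb (\<lambda>x. \<rho> (real n * x + - (real n * s)) * real n + \<rho> (real n * x + - (real n * t)) * (- real n))"
      by (intro smooth_comb.intros \<rho>)
    then have sd: "smooth_comb (deriv (\<theta> n))" by (simp add: d\<theta>)
    have "((deriv ^^ j) (\<theta> n)) differentiable_on UNIV" for j
    proof (cases j)
      case 0
      then show ?thesis using \<theta>' unfolding differentiable_on_def
        by simp (meson field_differentiable_def field_differentiable_imp_differentiable)
    next
      case (Suc i)
      then show ?thesis using smooth_comb_iterated_deriv[OF sd, of i] by (simp add: funpow_swap1)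
    qed
    moreover have "\<theta> n x = 0" if out: "x \<notin> {s..t + 1 / n}" for x
    proof -
      have n0: "real n > 0" using n N by simp
      consider "x < s" | "x > t + 1 / n" using out by fastforce
      then show ?thesis
      proof cases
        case 1
        then have "real n * x \<le> real n * s" "real n * x \<le> real n * t"
          using st by (auto intro!: mult_left_mono)
        then show ?thesis by (simp add: \<theta>_def B0)
      next
        case 2
        then have "real n * x \<ge> real n * t + 1" using n0 by (simp add: field_simps)
        moreover have "real n * t \<ge> real n * s" using st by (auto intro!: mult_left_mono)
        ultimately show ?thesis by (simp add: \<theta>_def B1)
      qed
    qed
    moreover have "t + 1 / n < T"
      using n N by (smt (verit) frac_le of_nat_0_less_iff of_nat_le_iff)
    ultimately show ?thesis unfolding time_test_def using st(1)
      by (intro CollectI conjI allI exI[of _ s] exI[of _ "t + 1 / n"]) auto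
  qed
  have lim1: "(\<lambda>n. integral {0..T} (\<lambda>x. deriv (\<theta> n) x * a x)) \<longlonglongrightarrow> a s - a t"
  proof (rule Lim_transform_eventually)
    show "(\<lambda>n. integral {0..T} (\<lambda>x. \<rho> (real n * x + - (real n * s)) * real n * a x)
        - integral {0..T} (\<lambda>x. \<rho> (real n * x + - (real n * t)) * real n * a x)) \<longlonglongrightarrow> a s - a t"
      using st by (intro tendsto_diff delta) auto
    show "\<forall>\<^sub>F n in sequentially. integral {0..T} (\<lambda>x. \<rho> (real n * x + - (real n * s)) * real n * a x)
        - integral {0..T} (\<lambda>x. \<rho> (real n * x + - (real n * t)) * real n * a x)
        = integral {0..T} (\<lambda>x. deriv (\<theta> n) x * a x)"
    proof (intro always_eventually allI)
      fix n
      show "integral {0..T} (\<lambda>x. \<rho> (real n * x + - (real n * s)) * real n * a x)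
        - integral {0..T} (\<lambda>x. \<rho> (real n * x + - (real n * t)) * real n * a x)
        = integral {0..T} (\<lambda>x. deriv (\<theta> n) x * a x)"
        unfolding d\<theta> left_diff_distrib
        by (rule integral_diff[symmetric])
          (auto intro!: integrable_continuous_real continuous_intros \<rho>cont \<rho>cont' a)
    qed
  qed
  have gi: "g absolutely_integrable_on {s..t}"
    using absolutely_integrable_on_subinterval[OF g] st by auto
  have lim2: "(\<lambda>n. integral {0..T} (\<lambda>x. \<theta> n x * g x)) \<longlonglongrightarrow> integral {0..T} (\<lambda>x. indicator {s<..t} x * g x)"
  proof (rule dominated_convergence(2))
    show "(\<lambda>x. \<bar>g x\<bar>) integrable_on {0..T}"
      using g by (simp add: absolutely_integrable_on_def)
    show "(\<lambda>x. \<theta> n x * g x) integrable_on {0..T}" for n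
    proof -
      have "continuous_on {0..T} (\<theta> n)"
        using \<theta>' by (meson DERIV_isCont continuous_at_imp_continuous_on)
      then have "(\<lambda>x. \<theta> n x * g x) absolutely_integrable_on {0..T}"
        by (intro absolutely_integrable_bounded_measurable_product_real[OF _ _ _ g])
          (auto intro!: continuous_imp_measurable_on_sets_lebesgue compact_imp_bounded compact_continuous_image)
      then show ?thesis by (rule set_lebesgue_integral_eq_integral(1))
    qed
    show "norm (\<theta> n x * g x) \<le> \<bar>g x\<bar>" for n x
    proof -
      have "\<bar>\<theta> n x\<bar> \<le> 1" unfolding \<theta>_def
        using B01[of "real n * x + - (real n * s)"] B01[of "real n * x + - (real n * t)"] by (auto simp: abs_le_iff)
      then show ?thesis by (simp add: abs_mult mult_left_le_one_le)
    qed
    have step: "(\<lambda>n. B (real n * x + - (real n * r))) \<longlonglongrightarrow> (if r < x then 1 else 0)" for x r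
    proof (cases "r < x")
      case True
      obtain M :: nat where M: "M > 0" "1 / M < x - r"
        using reals_Archimedean[of "x - r"] True
        by (metis One_nat_def Suc_pred diff_gt_0_iff_gt inverse_eq_divide zero_less_Suc)
      have "B (real n * x + - (real n * r)) = 1" if "n \<ge> M" for n
      proof (rule B1)
        have "1 < real M * (x - r)" using M by (simp add: field_simps)
        also have "\<dots> \<le> real n * (x - r)" using that True by (intro mult_right_mono) auto
        finally show "1 \<le> real n * x + - (real n * r)" by (simp add: algebra_simps)
      qed
      then show ?thesis using True
        by (intro tendsto_eventually) (auto simp: eventually_at_top_linorder intro!: exI[of _ M])
    next
      case False
      then have "B (real n * x + - (real n * r)) = 0" for n
        by (intro B0) (auto simp: mult_left_mono)
      then show ?thesis using False by simp
    qed
    show "(\<lambda>n. \<theta> n x * g x) \<longlonglongrightarrow> indicator {s<..t} x * g x" for x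
    proof -
      have "(\<lambda>n. \<theta> n x) \<longlonglongrightarrow> (if s < x then 1 else 0) - (if t < x then 1 else 0)"
        unfolding \<theta>_def by (intro tendsto_diff step)
      then have "(\<lambda>n. \<theta> n x) \<longlonglongrightarrow> indicator {s<..t} x"
        using st by (auto simp: indicator_def split: if_splits)
      then show ?thesis by (intro tendsto_mult tendsto_const)
    qed
  qed
  have "integral {0..T} (\<lambda>x. indicator {s<..t} x * g x) = integral {0..T} (\<lambda>x. if x \<in> {s..t} then g x else 0)"
    by (rule integral_spike[of "{s}"]) (auto simp: indicator_def)
  also have "\<dots> = integral {s..t} g"
    using st by (subst integral_restrict_Int) (simp add: Int_absorb1)
  finally have eqi: "integral {0..T} (\<lambda>x. indicator {s<..t} x * g x) = integral {s..t} g" .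
  have "\<forall>\<^sub>F n in sequentially. integral {0..T} (\<lambda>x. deriv (\<theta> n) x * a x) = - integral {0..T} (\<lambda>x. \<theta> n x * g x)"
    unfolding eventually_at_top_linorder
  proof (intro exI allI impI)
    fix n assume "N \<le> n"
    have "continuous_on {0..T} (\<theta> n)"
      using \<theta>' by (meson DERIV_isCont continuous_at_imp_continuous_on)
    then have "(\<lambda>x. \<theta> n x * g x) absolutely_integrable_on {0..T}"
      by (intro absolutely_integrable_bounded_measurable_product_real[OF _ _ _ g])
        (auto intro!: continuous_imp_measurable_on_sets_lebesgue compact_imp_bounded compact_continuous_image)
    moreover have "(\<lambda>x. deriv (\<theta> n) x * a x) absolutely_integrable_on {0..T}"
      unfolding d\<theta> by (intro a_int continuous_intros \<rho>cont \<rho>cont')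
    ultimately show "integral {0..T} (\<lambda>x. deriv (\<theta> n) x * a x) = - integral {0..T} (\<lambda>x. \<theta> n x * g x)"
      using weak[OF test[OF \<open>N \<le> n\<close>]] by (simp add: set_lebesgue_integral_eq_integral(2))
  qed
  then have "(\<lambda>n. - integral {0..T} (\<lambda>x. \<theta> n x * g x)) \<longlonglongrightarrow> a s - a t"
    by (rule Lim_transform_eventually[OF lim1])
  with tendsto_minus[OF lim2] have "- integral {0..T} (\<lambda>x. indicator {s<..t} x * g x) = a s - a t"
    by (rule LIMSEQ_unique)
  then show ?thesis using eqi by simp
qed

text \<open>Test functions vanish near 0 and T, so they only show that a minus the indefinite
  integral of g is constant on the open interval. Continuity of a carries this to the endpoints, in
  particular to the initial value.\<close>

lemma weak_time_derivative_integral: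
  fixes a g :: "real \<Rightarrow> real"
  assumes a: "continuous_on {0..T} a" and g: "g absolutely_integrable_on {0..T}"
    and weak: "\<And>\<theta>. \<theta> \<in> time_test T \<Longrightarrow>
      (LINT t:{0..T}|lebesgue. deriv \<theta> t * a t) = - (LINT t:{0..T}|lebesgue. \<theta> t * g t)"
    and T: "0 < T" and t: "t \<in> {0..T}"
  shows "a t = a 0 + integral {0..t} g"
proof -
  define H where "H t = a t - integral {0..t} g" for t
  have gi: "g integrable_on {0..T}" using g by (rule set_lebesgue_integral_eq_integral(1))
  have H: "continuous_on {0..T} H"
    unfolding H_def by (intro continuous_intros a indefinite_integral_continuous_1 gi)
  have const: "H t = H (T / 2)" if "t \<in> {0<..<T}" for t
  proof -
    have *: "H t = H s" if "0 < s" "s \<le> t" "t < T" for s t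
      using weak_time_derivative_increment[OF a g weak, of s t] that
        Henstock_Kurzweil_Integration.integral_combine[of 0 s t g]
        integrable_subinterval_real[OF gi, of 0 t]
      by (auto simp: H_def)
    show ?thesis using *[of t "T / 2"] *[of "T / 2" t] that T by fastforce
  qed
  have "H t = H (T / 2)" if "t \<in> {0..T}" for t
  proof (rule continuous_constant_on_closure[of "{0<..<T}" H])
    show "continuous_on (closure {0<..<T}) H" using T H by simp
    show "t \<in> closure {0<..<T}" using T that by simp
  qed (rule const)
  from this[of t] this[of 0] t T show ?thesis by (auto simp: H_def)
qed

text \<open>The increments of \<open>a\<^sup>2 - 2 \<integral> a g\<close> are of smaller order than those of \<open>\<integral> \<bar>g\<bar>\<close>, so this function
  is constant.\<close>

lemma square_of_indefinite_integral:
  fixes a g :: "real \<Rightarrow> real"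
  assumes a: "continuous_on {0..T} a" and g: "g absolutely_integrable_on {0..T}"
    and ag: "\<And>t. t \<in> {0..T} \<Longrightarrow> a t = a 0 + integral {0..t} g"
    and t: "t \<in> {0..T}"
  shows "(\<lambda>r. a r * g r) absolutely_integrable_on {0..T}"
    and "(a t)\<^sup>2 = (a 0)\<^sup>2 + 2 * integral {0..t} (\<lambda>r. a r * g r)"
proof -
  show agi: "(\<lambda>r. a r * g r) absolutely_integrable_on {0..T}"
    using a by (intro absolutely_integrable_bounded_measurable_product_real[OF _ _ _ g])
      (auto intro!: continuous_imp_measurable_on_sets_lebesgue compact_imp_bounded compact_continuous_image)
  have gi: "g integrable_on {x..y}" "(\<lambda>x. \<bar>g x\<bar>) integrable_on {x..y}" "(\<lambda>r. a r * g r) integrable_on {x..y}"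
    if "0 \<le> x" "y \<le> T" for x y
    using absolutely_integrable_on_subinterval[OF g, of x y] absolutely_integrable_on_subinterval[OF agi, of x y] that
    by (auto simp: absolutely_integrable_on_def)
  define H where "H t = (a t)\<^sup>2 - 2 * integral {0..t} (\<lambda>r. a r * g r)" for t
  have "\<bar>H t - H 0\<bar> \<le> e * (2 * integral {0..t} (\<lambda>x. \<bar>g x\<bar>))" if e: "0 < e" for e
  proof -
    obtain d where d: "d > 0" "\<And>x y. x \<in> {0..T} \<Longrightarrow> y \<in> {0..T} \<Longrightarrow> \<bar>x - y\<bar> < d \<Longrightarrow> \<bar>a x - a y\<bar> < e"
      using compact_uniformly_continuous[OF a] e unfolding uniformly_continuous_on_def dist_real_def
      by (metis compact_Icc)
    \<comment> \<open>Since a(y)^2 - a(x)^2 is a(y) + a(x) times the integral of g, the increment of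
      H is the integral of (a(y) + a(x) - 2 a(r)) g(r). Uniform continuity bounds the first factor
      by 2e.\<close>
    have step: "\<bar>H y - H x\<bar> \<le> 2 * e * integral {x..y} (\<lambda>x. \<bar>g x\<bar>)"
      if xy: "0 \<le> x" "x \<le> y" "y \<le> T" "y - x < d" for x y
    proof -
      have i: "integral {x..y} g = a y - a x"
        using ag[of x] ag[of y] Henstock_Kurzweil_Integration.integral_combine[of 0 x y g] gi(1)[of 0 y] xy by auto
      have "H y - H x = (a y + a x) * integral {x..y} g - 2 * integral {x..y} (\<lambda>r. a r * g r)"
        using Henstock_Kurzweil_Integration.integral_combine[of 0 x y "\<lambda>r. a r * g r"] gi(3)[of 0 y] xy
        unfolding i by (simp add: H_def power2_eq_square algebra_simps)
      also have "\<dots> = integral {x..y} (\<lambda>r. (a y + a x) * g r) - integral {x..y} (\<lambda>r. 2 * (a r * g r))"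
        by simp
      also have "\<dots> = integral {x..y} (\<lambda>r. (a y + a x) * g r - 2 * (a r * g r))"
        by (intro integral_diff[symmetric] integrable_on_mult_right gi(1) gi(3)) (use xy in auto)
      finally have "norm (H y - H x) = norm (integral {x..y} (\<lambda>r. (a y + a x) * g r - 2 * (a r * g r)))" by simp
      also have "\<dots> \<le> integral {x..y} (\<lambda>r. 2 * e * \<bar>g r\<bar>)"
      proof (rule integral_norm_bound_integral)
        show "(\<lambda>r. (a y + a x) * g r - 2 * (a r * g r)) integrable_on {x..y}"
          by (intro integrable_diff integrable_on_mult_right gi(1) gi(3)) (use xy in auto)
        show "(\<lambda>r. 2 * e * \<bar>g r\<bar>) integrable_on {x..y}"
          by (intro integrable_on_mult_right gi(2)) (use xy in auto)
        fix r assume r: "r \<in> {x..y}"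
        have "\<bar>a y - a r\<bar> < e" "\<bar>a x - a r\<bar> < e"
          using d(2)[of y r] d(2)[of x r] xy r by auto
        then have "\<bar>a y + a x - 2 * a r\<bar> \<le> 2 * e" by linarith
        then have "\<bar>a y + a x - 2 * a r\<bar> * \<bar>g r\<bar> \<le> 2 * e * \<bar>g r\<bar>" by (intro mult_right_mono) auto
        moreover have "(a y + a x) * g r - 2 * (a r * g r) = (a y + a x - 2 * a r) * g r" by (simp add: algebra_simps)
        ultimately show "norm ((a y + a x) * g r - 2 * (a r * g r)) \<le> 2 * e * \<bar>g r\<bar>"
          by (simp add: abs_mult)
      qed
      finally show ?thesis by simp
    qed
    obtain N :: nat where N: "N > 0" "t / N < d"
    proof -
      obtain n where "t / d < real n" using reals_Archimedean2 by blast
      then have "t / Suc n < d" using d(1) t by (auto simp: field_simps)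
      then show ?thesis using that[of "Suc n"] by simp
    qed
    \<comment> \<open>Induction along the grid t i / N adds up the increments; the total is e times
      a quantity that does not depend on the grid.\<close>
    have "i \<le> N \<Longrightarrow> \<bar>H (t * i / N) - H 0\<bar> \<le> 2 * e * integral {0..t * i / N} (\<lambda>x. \<bar>g x\<bar>)" for i :: nat
    proof (induction i)
      case (Suc i)
      let ?x = "t * i / N" and ?y = "t * Suc i / N"
      have xy: "0 \<le> ?x" "?x \<le> ?y" "?y - ?x < d"
        using t N by (auto simp: field_simps intro!: divide_right_mono mult_left_mono)
      have "t * real (Suc i) \<le> t * real N" using t Suc.prems by (intro mult_left_mono) auto
      then have "?y \<le> t" using N by (simp only: pos_divide_le_eq of_nat_0_less_iff)
      then have yT: "?y \<le> T" using t by simp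
      have "integral {0..?x} (\<lambda>x. \<bar>g x\<bar>) + integral {?x..?y} (\<lambda>x. \<bar>g x\<bar>) = integral {0..?y} (\<lambda>x. \<bar>g x\<bar>)"
        by (rule Henstock_Kurzweil_Integration.integral_combine) (use xy yT gi(2) in auto)
      then have "2 * e * integral {0..?x} (\<lambda>x. \<bar>g x\<bar>) + 2 * e * integral {?x..?y} (\<lambda>x. \<bar>g x\<bar>) = 2 * e * integral {0..?y} (\<lambda>x. \<bar>g x\<bar>)"
        by (metis distrib_left)
      then show ?case using Suc step[OF xy(1,2) yT xy(3)] by (auto simp: abs_le_iff)
    qed simp
    from this[of N] show ?thesis using N by (simp add: mult_ac)
  qed
  then have "\<bar>H t - H 0\<bar> \<le> 0 + e" if "e > 0" for e
  proof -
    define G where "G = 2 * integral {0..t} (\<lambda>x. \<bar>g x\<bar>)"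
    have "0 \<le> G" unfolding G_def using t by (auto intro!: integral_nonneg gi)
    \<comment> \<open>Dividing by G + 1 rather than G covers the case G = 0.\<close>
    then have "e / (G + 1) * G \<le> e" using that by (simp add: field_simps)
    moreover have "\<bar>H t - H 0\<bar> \<le> e / (G + 1) * G"
      unfolding G_def using \<open>0 \<le> G\<close> \<open>e > 0\<close>
      by (intro \<open>\<And>e. 0 < e \<Longrightarrow> \<bar>H t - H 0\<bar> \<le> e * (2 * integral {0..t} (\<lambda>x. \<bar>g x\<bar>))\<close>) (auto simp: G_def)
    ultimately show ?thesis by simp
  qed
  then have "\<bar>H t - H 0\<bar> \<le> 0" by (rule field_le_epsilon)
  then show "(a t)\<^sup>2 = (a 0)\<^sup>2 + 2 * integral {0..t} (\<lambda>r. a r * g r)" by (simp add: H_def)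
qed

section \<open>Trigonometric modes on the torus\<close>

definition freq :: "real \<Rightarrow> int \<times> int \<Rightarrow> 2 \<Rightarrow> real" where
  "freq L k j = 2 * pi / L * of_int (if j = 1 then fst k else snd k)"

definition phase :: "real \<Rightarrow> int \<times> int \<Rightarrow> real^2 \<Rightarrow> real" where
  "phase L k x = (\<Sum>j\<in>UNIV. freq L k j * x $ j)"

text \<open>The functions \<open>cos + sin\<close> replace complex exponentials: they form a real orthonormal basis,
  and differentiation maps the mode of \<open>k\<close> to a multiple of the mode of \<open>-k\<close>.\<close>

definition mode :: "real \<Rightarrow> int \<times> int \<Rightarrow> real^2 \<Rightarrow> real" where
  "mode L k x = (cos (phase L k x) + sin (phase L k x)) / L"

lemma freq_minus [simp]: "freq L (- k) j = - freq L k j"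
  by (simp add: freq_def)

lemma phase_minus [simp]: "phase L (- k) x = - phase L k x"
  by (simp add: phase_def sum_negf)

lemma phase_add: "phase L (k + l) x = phase L k x + phase L l x"
  by (simp add: phase_def freq_def sum_2 algebra_simps add_divide_distrib)

lemma phase_diff: "phase L (k - l) x = phase L k x - phase L l x"
  by (simp add: phase_def freq_def sum_2 algebra_simps diff_divide_distrib)

lemma phase_zero [simp]: "phase L 0 x = 0"
  by (simp add: phase_def freq_def sum_2)

lemma phase_axis: "phase L k (axis j c) = freq L k j * c"
  by (simp add: phase_def axis_def if_distrib[of "\<lambda>x. _ * x"] cong: if_cong)

lemma bounded_linear_phase: "bounded_linear (phase L k)"
  unfolding phase_def
  by (intro bounded_linear_sum bounded_linear_const_mult bounded_linear_vec_nth)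

lemma phase_has_derivative: "(phase L k has_derivative phase L k) (at x)"
  by (rule bounded_linear_imp_has_derivative[OF bounded_linear_phase])

lemma continuous_on_phase [continuous_intros]: "continuous_on S (phase L k)"
  by (rule linear_continuous_on[OF bounded_linear_phase])

lemma continuous_on_mode [continuous_intros]: "continuous_on S (mode L k)"
  unfolding mode_def divide_inverse by (intro continuous_intros)

lemma torus_periodic_trig:
  assumes "0 < L"
  shows "torus_periodic L (\<lambda>x. h (cos (phase L k x)) (sin (phase L k x)))"
proof -
  have "h (cos (phase L k (x + axis j L))) (sin (phase L k (x + axis j L))) =
      h (cos (phase L k x)) (sin (phase L k x))" for x j
  proof -
    have "phase L k (x + axis j L) = phase L k x + freq L k j * L"
      by (simp add: linear_add[OF bounded_linear.linear[OF bounded_linear_phase]] phase_axis)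
    moreover have "freq L k j * L = 2 * pi * of_int (if j = 1 then fst k else snd k)"
      using assms by (simp add: freq_def)
    ultimately have "sin (phase L k (x + axis j L)) = sin (phase L k x) \<and> cos (phase L k (x + axis j L)) = cos (phase L k x)"
      by (metis sin_cos_eq_iff)
    then show ?thesis by simp
  qed
  then show ?thesis by (simp add: torus_periodic_def)
qed

lemma torus_periodic_mode: "0 < L \<Longrightarrow> torus_periodic L (mode L k)"
  unfolding mode_def using torus_periodic_trig[of L "\<lambda>c s. (c + s) / L" k] by simp

lemma mode_has_derivative: "(mode L k has_derivative (\<lambda>h. phase L k h * mode L (- k) x)) (at x)"
  unfolding mode_def divide_inverse
  by (auto intro!: derivative_eq_intros phase_has_derivative simp: fun_eq_iff algebra_simps add_divide_distrib diff_divide_distrib)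

lemma pderivative_eqI:
  assumes "\<And>x. (\<phi> has_derivative \<phi>' x) (at x)"
  shows "pderivative j \<phi> = (\<lambda>x. \<phi>' x (axis j 1))"
  unfolding pderivative_def using frechet_derivative_at[OF assms] by (auto simp: fun_eq_iff)

lemma pderivative_mode:
  "pderivative j (\<lambda>x. c * mode L k x) = (\<lambda>x. (c * freq L k j) * mode L (- k) x)"
  by (subst pderivative_eqI[OF has_derivative_mult_right[OF mode_has_derivative]])
    (simp add: phase_axis mult.assoc)

lemma Ck_mode: "Ck n (\<lambda>x. c * mode L k x)"
proof (induction n arbitrary: c k)
  case (Suc n)
  have "(\<lambda>x. c * mode L k x) differentiable_on UNIV"
    unfolding differentiable_on_def using has_derivative_mult_right[OF mode_has_derivative]
    by (blast intro: differentiableI)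
  moreover have "Ck n (pderivative j (\<lambda>x. c * mode L k x))" for j
    unfolding pderivative_mode by (rule Suc)
  ultimately show ?case by simp
qed (auto intro!: continuous_intros)

lemma mode_torus_test: "0 < L \<Longrightarrow> mode L k \<in> torus_test L"
  using Ck_mode[where c = 1 and k = k and L = L] torus_periodic_mode[of L k] by (simp add: torus_test_def)

lemma torus_test_has_derivative:
  assumes "\<phi> \<in> torus_test L"
  shows "(\<phi> has_derivative frechet_derivative \<phi> (at x)) (at x)"
proof -
  have "Ck (Suc 0) \<phi>" using assms unfolding torus_test_def by blast
  then show ?thesis by (simp add: differentiable_on_def frechet_derivative_works)
qed

lemma torus_test_continuous: "\<phi> \<in> torus_test L \<Longrightarrow> continuous_on S \<phi>"
  unfolding torus_test_def by (metis (mono_tags, lifting) Ck.simps(1) continuous_on_subset mem_Collect_eq subset_UNIV)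

lemma pderivative_torus_test:
  assumes "\<phi> \<in> torus_test L"
  shows "pderivative j \<phi> \<in> torus_test L"
proof -
  have per: "torus_periodic L \<phi>" and ck: "\<And>k. Ck (Suc k) \<phi>" using assms unfolding torus_test_def by blast+
  have "frechet_derivative \<phi> (at (x + axis i L)) = frechet_derivative \<phi> (at x)" for x i
  proof (rule frechet_derivative_at)
    have "((\<lambda>y. \<phi> (y + axis i L)) has_derivative frechet_derivative \<phi> (at (x + axis i L))) (at x)"
      by (rule has_derivative_compose[where f="\<lambda>y. y + axis i L" and f'="\<lambda>h. h", simplified])
        (auto intro!: derivative_eq_intros torus_test_has_derivative[OF assms])
    then show "(\<phi> has_derivative frechet_derivative \<phi> (at (x + axis i L))) (at x)"
      using per by (simp add: torus_periodic_def)
  qed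
  then have "torus_periodic L (pderivative j \<phi>)"
    by (simp add: torus_periodic_def pderivative_def)
  with ck show ?thesis by (simp add: torus_test_def)
qed

lemma iterated_pderivative_torus_test: "\<phi> \<in> torus_test L \<Longrightarrow> (pderivative j ^^ n) \<phi> \<in> torus_test L"
  by (induction n) (auto intro: pderivative_torus_test)

lemma iter_pderivative_torus_test: "\<phi> \<in> torus_test L \<Longrightarrow> iter_pderivative \<alpha> \<phi> \<in> torus_test L"
  unfolding iter_pderivative_def by (intro iterated_pderivative_torus_test)

section \<open>Integration of periodic functions over one period cell\<close>

lemma mem_cell: "x \<in> cell L \<longleftrightarrow> (\<forall>i. 0 \<le> x $ i \<and> x $ i \<le> L)"
  by (simp add: cell_def mem_box_cart)

text \<open>The cell and its translate both sit in the box that is longer by h in direction j.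
  Cutting this box at height L or at height h leaves one of them plus a slab of thickness h, and the
  two slabs are translates by a full period.\<close>

lemma integral_cell_shift:
  fixes \<phi> :: "real^2 \<Rightarrow> real"
  assumes \<phi>: "continuous_on UNIV \<phi>" and per: "torus_periodic L \<phi>" and h: "0 \<le> h" "h \<le> L"
  shows "integral (cell L) (\<lambda>x. \<phi> (x + axis j h)) = integral (cell L) \<phi>"
proof -
  define v :: "real^2" where "v = (\<chi> i. L)"
  have shift: "integral (cbox a b) (\<lambda>x. \<phi> (x + c)) = integral (cbox (a + c) (b + c)) \<phi>" for a b c
    using integral_unique[OF has_integral_affinity'[of \<phi> "integral (cbox (a + c) (b + c)) \<phi>" "a + c" "b + c" 1 c]]
      integrable_continuous[of "a + c" "b + c" \<phi>] \<phi>
    by (simp add: integrable_integral continuous_on_subset)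
  have int: "\<phi> integrable_on cbox a b" for a b
    using \<phi> by (intro integrable_continuous) (auto intro: continuous_on_subset)
  let ?e = "axis j 1 :: real^2"
  have split: "integral (cbox 0 (v + axis j h)) \<phi> =
      integral (cbox 0 (v + axis j h) \<inter> {x. x $ j \<le> c}) \<phi> + integral (cbox 0 (v + axis j h) \<inter> {x. x $ j \<ge> c}) \<phi>" for c
    using integral_split[OF int, of ?e 0 "v + axis j h" c] by (simp add: inner_axis)
  have box_j: "x \<in> cbox a b \<longleftrightarrow> (a $ j \<le> x $ j \<and> x $ j \<le> b $ j) \<and> (\<forall>i. i \<noteq> j \<longrightarrow> a $ i \<le> x $ i \<and> x $ i \<le> b $ i)"
    for a b x :: "real^2"
    unfolding mem_box_cart by metis
  have "cbox 0 (v + axis j h) \<inter> {x. x $ j \<le> L} = cbox 0 v"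
    using h by (auto simp: box_j v_def axis_def)
  moreover have "cbox 0 (v + axis j h) \<inter> {x. x $ j \<ge> L} = cbox (0 + axis j L) ((v - axis j (L - h)) + axis j L)"
    using h by (auto simp: box_j v_def axis_def)
  moreover have "cbox 0 (v + axis j h) \<inter> {x. x $ j \<le> h} = cbox 0 (v - axis j (L - h))"
    using h by (auto simp: box_j v_def axis_def)
  moreover have "cbox 0 (v + axis j h) \<inter> {x. x $ j \<ge> h} = cbox (0 + axis j h) (v + axis j h)"
    using h by (auto simp: box_j v_def axis_def)
  moreover have "integral (cbox (0 + axis j L) ((v - axis j (L - h)) + axis j L)) \<phi> = integral (cbox 0 (v - axis j (L - h))) \<phi>"
    unfolding shift[symmetric] using per by (simp add: torus_periodic_def)
  ultimately have "integral (cbox 0 v) \<phi> = integral (cbox (0 + axis j h) (v + axis j h)) \<phi>"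
    using split[of L] split[of h] by simp
  then show ?thesis unfolding cell_def v_def[symmetric] shift by simp
qed

text \<open>By shift invariance, L times the integral equals the double integral of the derivative
  at x + h e_j over the cell and over h in [0,L]. Integrating in h first gives an increment of
  \<phi> over one period, which is zero.\<close>

lemma integral_cell_pderivative:
  fixes \<phi> :: "real^2 \<Rightarrow> real"
  assumes \<phi>: "\<And>x. (\<phi> has_derivative \<phi>' x) (at x)" and cont: "continuous_on UNIV (\<lambda>x. \<phi>' x (axis j 1))"
    and per: "torus_periodic L \<phi>" and L: "0 < L"
  shows "integral (cell L) (\<lambda>x. \<phi>' x (axis j 1)) = 0"
proof -
  let ?D = "\<lambda>x. \<phi>' x (axis j 1)"
  have D: "((\<lambda>h. \<phi> (x + axis j h)) has_vector_derivative ?D (x + axis j h)) (at h)" for x h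
  proof -
    have ax: "axis j r = r *\<^sub>R (axis j 1 :: real^2)" for r :: real by (simp add: vec_eq_iff axis_def)
    have "((\<lambda>h. x + h *\<^sub>R axis j 1) has_derivative (\<lambda>r. r *\<^sub>R axis j 1)) (at h)"
      by (auto intro!: derivative_eq_intros)
    moreover have "(\<lambda>h. x + h *\<^sub>R axis j 1) = (\<lambda>h. x + axis j h)" "(\<lambda>r::real. r *\<^sub>R axis j 1) = (\<lambda>r. axis j r :: real^2)"
      by (simp_all add: fun_eq_iff vec_eq_iff axis_def)
    ultimately have "((\<lambda>h. x + axis j h) has_derivative (\<lambda>r. axis j r)) (at h)" by simp
    from has_derivative_compose[OF this \<phi>]
    have "((\<lambda>h. \<phi> (x + axis j h)) has_derivative (\<lambda>r. \<phi>' (x + axis j h) (axis j r))) (at h)" .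
    moreover have "(\<lambda>r. \<phi>' (x + axis j h) (axis j r)) = (\<lambda>r. r *\<^sub>R ?D (x + axis j h))"
    proof
      show "\<phi>' (x + axis j h) (axis j r) = r *\<^sub>R ?D (x + axis j h)" for r
        unfolding ax[of r] by (rule linear_cmul[OF has_derivative_linear[OF \<phi>]])
    qed
    ultimately show ?thesis by (simp only: has_vector_derivative_def)
  qed
  \<comment> \<open>Shift invariance is applied to the derivative, so it must be periodic too; this
    follows from uniqueness of the derivative.\<close>
  have perD: "torus_periodic L ?D"
    unfolding torus_periodic_def
  proof (intro allI)
    fix x i
    have "((\<lambda>y. \<phi> (y + axis i L)) has_derivative \<phi>' (x + axis i L)) (at x)"
      by (rule has_derivative_compose[where f="\<lambda>y. y + axis i L" and f'="\<lambda>h. h", simplified])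
        (auto intro!: derivative_eq_intros \<phi>)
    then have "(\<phi> has_derivative \<phi>' (x + axis i L)) (at x)"
      using per by (simp add: torus_periodic_def)
    then have "\<phi>' (x + axis i L) = \<phi>' x" using \<phi> has_derivative_unique by blast
    then show "\<phi>' (x + axis i L) (axis j 1) = \<phi>' x (axis j 1)" by simp
  qed
  have "integral {0..L} (\<lambda>h. ?D (x + axis j h)) = 0" for x
  proof -
    have "((\<lambda>h. ?D (x + axis j h)) has_integral (\<phi> (x + axis j L) - \<phi> (x + axis j 0))) {0..L}"
      by (rule fundamental_theorem_of_calculus)
        (use L in \<open>auto intro: has_vector_derivative_at_within[OF D]\<close>)
    moreover have "axis j 0 = (0 :: real^2)" by simp
    ultimately have "((\<lambda>h. ?D (x + axis j h)) has_integral 0) {0..L}"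
      using per by (simp add: torus_periodic_def)
    then show ?thesis by (rule integral_unique)
  qed
  then have "0 = integral (cell L) (\<lambda>x. integral (cbox 0 L) (\<lambda>h. ?D (x + axis j h)))" by simp
  also have "\<dots> = integral (cbox 0 L) (\<lambda>h. integral (cell L) (\<lambda>x. ?D (x + axis j h)))"
    unfolding cell_def
  proof (rule integral_swap_continuous)
    have "continuous_on UNIV (\<lambda>z :: (real^2) \<times> real. fst z + snd z *\<^sub>R axis j 1)"
      by (intro continuous_intros)
    moreover have "(\<lambda>z :: (real^2) \<times> real. fst z + snd z *\<^sub>R axis j 1) = (\<lambda>z. fst z + axis j (snd z))"
      by (auto simp: fun_eq_iff vec_eq_iff axis_def)
    ultimately have "continuous_on UNIV (\<lambda>z :: (real^2) \<times> real. fst z + axis j (snd z))" by (simp only:)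
    then have "continuous_on UNIV (\<lambda>z :: (real^2) \<times> real. ?D (fst z + axis j (snd z)))"
      by (rule continuous_on_compose2[OF cont]) auto
    then show "continuous_on (cbox (0, 0) (\<chi> i. L, L)) (\<lambda>(x, h). ?D (x + axis j h))"
      by (auto simp: case_prod_beta' intro: continuous_on_subset)
  qed
  also have "\<dots> = integral (cbox 0 L) (\<lambda>h. integral (cell L) ?D)"
    by (intro integral_cong integral_cell_shift[OF cont perD]) auto
  also have "\<dots> = L * integral (cell L) ?D" using L by simp
  finally show ?thesis using L by simp
qed

lemma integral_by_parts_torus:
  assumes L: "0 < L" and \<phi>: "\<phi> \<in> torus_test L" and \<psi>: "\<psi> \<in> torus_test L"
  shows "integral (cell L) (\<lambda>x. pderivative j \<phi> x * \<psi> x) = - integral (cell L) (\<lambda>x. \<phi> x * pderivative j \<psi> x)"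
proof -
  note [continuous_intros] = torus_test_continuous[OF \<phi>] torus_test_continuous[OF \<psi>]
    torus_test_continuous[OF pderivative_torus_test[OF \<phi>]] torus_test_continuous[OF pderivative_torus_test[OF \<psi>]]
  let ?D = "\<lambda>x h. \<phi> x * frechet_derivative \<psi> (at x) h + frechet_derivative \<phi> (at x) h * \<psi> x"
  have "integral (cell L) (\<lambda>x. ?D x (axis j 1)) = 0"
  proof (rule integral_cell_pderivative[OF _ _ _ L])
    show "((\<lambda>x. \<phi> x * \<psi> x) has_derivative ?D x) (at x)" for x
      by (intro has_derivative_mult torus_test_has_derivative[OF \<phi>] torus_test_has_derivative[OF \<psi>])
    have "continuous_on UNIV (\<lambda>x. \<phi> x * pderivative j \<psi> x + pderivative j \<phi> x * \<psi> x)"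
      by (intro continuous_intros)
    then show "continuous_on UNIV (\<lambda>x. ?D x (axis j 1))" by (simp add: pderivative_def)
    show "torus_periodic L (\<lambda>x. \<phi> x * \<psi> x)"
      using \<phi> \<psi> by (simp add: torus_test_def torus_periodic_def)
  qed
  then have "integral (cell L) (\<lambda>x. \<phi> x * pderivative j \<psi> x + pderivative j \<phi> x * \<psi> x) = 0"
    by (simp add: pderivative_def)
  moreover have "integral (cell L) (\<lambda>x. \<phi> x * pderivative j \<psi> x + pderivative j \<phi> x * \<psi> x) =
      integral (cell L) (\<lambda>x. \<phi> x * pderivative j \<psi> x) + integral (cell L) (\<lambda>x. pderivative j \<phi> x * \<psi> x)"
    unfolding cell_def by (intro integral_add integrable_continuous continuous_intros)
  ultimately show ?thesis by simp
qed

text \<open>A nonzero k has a nonzero frequency in some direction, and along it cosine and sine are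
  multiples of derivatives of periodic functions.\<close>

lemma integral_cell_trig:
  assumes L: "0 < L" and k: "k \<noteq> 0"
  shows "integral (cell L) (\<lambda>x. cos (phase L k x)) = 0" "integral (cell L) (\<lambda>x. sin (phase L k x)) = 0"
proof -
  obtain j where j: "freq L k j \<noteq> 0"
  proof (cases "fst k = 0")
    case True
    then have "snd k \<noteq> 0" using k by (auto simp: prod_eq_iff)
    then show ?thesis using L that[of 2] by (simp add: freq_def)
  next
    case False
    then show ?thesis using L that[of 1] by (simp add: freq_def)
  qed
  have "integral (cell L) (\<lambda>x. phase L k (axis j 1) * cos (phase L k x)) = 0"
    by (rule integral_cell_pderivative[where \<phi> = "\<lambda>x. sin (phase L k x)", OF _ _ _ L])
      (use torus_periodic_trig[OF L, of "\<lambda>c s. s"] in \<open>auto intro!: derivative_eq_intros phase_has_derivative continuous_intros\<close>)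
  then show "integral (cell L) (\<lambda>x. cos (phase L k x)) = 0" using j by (simp add: phase_axis)
  have "integral (cell L) (\<lambda>x. phase L k (axis j 1) * sin (phase L k x)) = 0"
    by (rule integral_cell_pderivative[where \<phi> = "\<lambda>x. - cos (phase L k x)", OF _ _ _ L])
      (use torus_periodic_trig[OF L, of "\<lambda>c s. - c"] in \<open>auto intro!: derivative_eq_intros phase_has_derivative continuous_intros\<close>)
  then show "integral (cell L) (\<lambda>x. sin (phase L k x)) = 0" using j by (simp add: phase_axis)
qed

lemma mode_mult:
  "mode L k x * mode L l x = (cos (phase L (k - l) x) + sin (phase L (k + l) x)) / L\<^sup>2"
  by (simp add: mode_def phase_add phase_diff cos_diff sin_add power2_eq_square algebra_simps add_divide_distrib)

lemma content_cell: "0 < L \<Longrightarrow> measure lborel (cell L) = L\<^sup>2"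
  unfolding cell_def by (subst content_cbox_cart) (auto simp: interval_eq_empty_cart power2_eq_square prod.neutral_const UNIV_2)

text \<open>In the product formula the sine term always has mean zero (for k = -l it vanishes
  identically), and the cosine term has nonzero mean only for k = l. The mode 0 therefore needs no
  separate normalisation.\<close>

lemma integral_mode_mult:
  assumes L: "0 < L"
  shows "integral (cell L) (\<lambda>x. mode L k x * mode L l x) = (if k = l then 1 else 0)"
proof -
  have "integral (cell L) (\<lambda>x. mode L k x * mode L l x) =
     (integral (cell L) (\<lambda>x. cos (phase L (k - l) x)) + integral (cell L) (\<lambda>x. sin (phase L (k + l) x))) / L\<^sup>2"
    unfolding mode_mult cell_def
    by (subst integral_add[symmetric]) (auto intro!: integrable_continuous continuous_intros)
  also have "integral (cell L) (\<lambda>x. sin (phase L (k + l) x)) = 0"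
    by (cases "k + l = 0") (auto simp: integral_cell_trig L)
  also have "integral (cell L) (\<lambda>x. cos (phase L (k - l) x)) = (if k = l then L\<^sup>2 else 0)"
  proof (cases "k = l")
    case True
    have "integral (cell L) (\<lambda>x. 1::real) = L\<^sup>2"
      using content_cell[OF L] unfolding cell_def by simp
    with True show ?thesis by simp
  qed (auto simp: integral_cell_trig L)
  finally show ?thesis using L by simp
qed

section \<open>The Hilbert space of square integrable periodic functions\<close>

lemma cell_borel [measurable, simp]: "cell L \<in> sets borel"
  by (simp add: cell_def)

lemma compact_cell: "compact (cell L)"
  by (simp add: cell_def compact_cbox)

lemma L2_D:
  assumes "f \<in> L2 L"
  shows "f \<in> borel_measurable borel" "torus_periodic L f"
    "set_integrable lborel (cell L) (\<lambda>x. (norm (f x))\<^sup>2)"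
  using assms by (auto simp: L2_def)

lemma L2_bound_integrable:
  fixes h :: "real^2 \<Rightarrow> 'b :: {banach, second_countable_topology}"
  assumes "f \<in> L2 L" "g \<in> L2 L" and h: "h \<in> borel_measurable borel"
    and "\<And>x. norm (h x) \<le> c * ((norm (f x))\<^sup>2 + (norm (g x))\<^sup>2)"
  shows "set_integrable lborel (cell L) h"
proof (rule set_integrable_bound)
  show "set_integrable lborel (cell L) (\<lambda>x. c * ((norm (f x))\<^sup>2 + (norm (g x))\<^sup>2))"
    using assms(1,2) by (intro set_integrable_mult_right set_integral_add L2_D)
  show "set_borel_measurable lborel (cell L) h"
    using h unfolding set_borel_measurable_def by measurable
  show "AE x in lborel. x \<in> cell L \<longrightarrow> norm (h x) \<le> norm (c * ((norm (f x))\<^sup>2 + (norm (g x))\<^sup>2))"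
    using assms(4) by (auto intro: order_trans[OF _ abs_ge_self])
qed

lemma L2_inner_integrable:
  assumes f: "f \<in> L2 L" and g: "g \<in> L2 L"
  shows "set_integrable lborel (cell L) (\<lambda>x. f x \<bullet> g x)"
proof (rule L2_bound_integrable[OF f g])
  note [measurable] = L2_D(1)[OF f] L2_D(1)[OF g]
  show "(\<lambda>x. f x \<bullet> g x) \<in> borel_measurable borel" by measurable
  fix x
  have "\<bar>f x \<bullet> g x\<bar> \<le> norm (f x) * norm (g x)" by (rule Cauchy_Schwarz_ineq2)
  also have "\<dots> \<le> 1 * ((norm (f x))\<^sup>2 + (norm (g x))\<^sup>2)"
    using sum_squares_bound[of "norm (f x)" "norm (g x)", unfolded mult.assoc]
      mult_nonneg_nonneg[OF norm_ge_zero[of "f x"] norm_ge_zero[of "g x"]]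
    unfolding mult_1_left by linarith
  finally show "norm (f x \<bullet> g x) \<le> 1 * ((norm (f x))\<^sup>2 + (norm (g x))\<^sup>2)" by simp
qed

lemma L2_add:
  assumes f: "f \<in> L2 L" and g: "g \<in> L2 L"
  shows "(\<lambda>x. f x + g x) \<in> L2 L"
proof -
  note [measurable] = L2_D(1)[OF f] L2_D(1)[OF g]
  have "set_integrable lborel (cell L) (\<lambda>x. (norm (f x + g x))\<^sup>2)"
  proof (rule L2_bound_integrable[OF f g])
    fix x
    have "(norm (f x + g x))\<^sup>2 \<le> (norm (f x) + norm (g x))\<^sup>2"
      by (intro power_mono norm_triangle_ineq) auto
    also have "\<dots> \<le> 2 * ((norm (f x))\<^sup>2 + (norm (g x))\<^sup>2)"
      using sum_squares_bound[of "norm (f x)" "norm (g x)"] by (simp add: power2_sum)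
    finally show "norm ((norm (f x + g x))\<^sup>2) \<le> 2 * ((norm (f x))\<^sup>2 + (norm (g x))\<^sup>2)" by simp
  qed measurable
  then show ?thesis
    using L2_D(2)[OF f] L2_D(2)[OF g] by (simp add: L2_def torus_periodic_def)
qed

lemma L2_scale:
  assumes f: "f \<in> L2 L"
  shows "(\<lambda>x. c *\<^sub>R f x) \<in> L2 L"
  using L2_D[OF f] by (simp add: L2_def torus_periodic_def power_mult_distrib)

lemma L2_diff: "f \<in> L2 L \<Longrightarrow> g \<in> L2 L \<Longrightarrow> (\<lambda>x. f x - g x) \<in> L2 L"
  using L2_add[of f L "\<lambda>x. (-1) *\<^sub>R g x"] L2_scale[of g L "-1"] by simp

lemma L2_zero: "(\<lambda>x. 0) \<in> L2 L"
  by (simp add: L2_def torus_periodic_def set_integrable_def)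

lemma L2_sum: "(\<And>i. i \<in> F \<Longrightarrow> f i \<in> L2 L) \<Longrightarrow> (\<lambda>x. \<Sum>i\<in>F. f i x) \<in> L2 L"
proof (induction F rule: infinite_finite_induct)
  case (insert i F)
  then have "(\<lambda>x. f i x + (\<Sum>i\<in>F. f i x)) \<in> L2 L" by (intro L2_add) auto
  with insert show ?case by simp
qed (simp_all add: L2_zero)

lemma continuous_L2:
  assumes "continuous_on UNIV f" "torus_periodic L f"
  shows "f \<in> L2 L"
proof -
  have "set_integrable lborel (cell L) (\<lambda>x. (norm (f x))\<^sup>2)"
    unfolding set_integrable_def
    by (rule borel_integrable_compact[OF compact_cell])
      (use assms(1) in \<open>auto intro!: continuous_intros intro: continuous_on_subset\<close>)
  with assms show ?thesis by (simp add: L2_def borel_measurable_continuous_onI)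
qed

lemma L2_inner_commute: "L2_inner L f g = L2_inner L g f"
  by (simp add: L2_inner_def inner_commute)

lemma L2_inner_add_left:
  assumes "f \<in> L2 L" "g \<in> L2 L" "h \<in> L2 L"
  shows "L2_inner L (\<lambda>x. f x + g x) h = L2_inner L f h + L2_inner L g h"
  unfolding L2_inner_def inner_add_left using assms by (intro set_integral_add L2_inner_integrable)

lemma L2_inner_scale_left: "L2_inner L (\<lambda>x. c *\<^sub>R f x) g = c * L2_inner L f g"
  unfolding L2_inner_def by simp

lemma L2_inner_scale_right: "L2_inner L f (\<lambda>x. c *\<^sub>R g x) = c * L2_inner L f g"
  unfolding L2_inner_def by simp

lemma L2_inner_diff_left:
  assumes "f \<in> L2 L" "g \<in> L2 L" "h \<in> L2 L"
  shows "L2_inner L (\<lambda>x. f x - g x) h = L2_inner L f h - L2_inner L g h"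
  unfolding L2_inner_def inner_diff_left using assms by (intro set_integral_diff L2_inner_integrable)

lemma L2_inner_sum_left:
  assumes "\<And>i. i \<in> F \<Longrightarrow> f i \<in> L2 L" "h \<in> L2 L"
  shows "L2_inner L (\<lambda>x. \<Sum>i\<in>F. f i x) h = (\<Sum>i\<in>F. L2_inner L (f i) h)"
  using assms(1)
proof (induction F rule: infinite_finite_induct)
  case (insert i F)
  then show ?case using assms(2) by (simp add: L2_inner_add_left L2_sum)
qed (simp_all add: L2_inner_def)

lemma L2_inner_self: "L2_inner L f f = (LINT x:cell L|lborel. (norm (f x))\<^sup>2)"
  by (simp add: L2_inner_def power2_norm_eq_inner)

lemma L2_inner_nonneg: "0 \<le> L2_inner L f f"
  unfolding L2_inner_def set_lebesgue_integral_def by (rule Bochner_Integration.integral_nonneg) simp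

lemma L2_norm_power2: "(L2_norm L f)\<^sup>2 = L2_inner L f f"
  by (simp add: L2_norm_def L2_inner_nonneg)

lemma L2_inner_diff_self:
  assumes "f \<in> L2 L" "g \<in> L2 L"
  shows "L2_inner L (\<lambda>x. f x - g x) (\<lambda>x. f x - g x) = L2_inner L f f - 2 * L2_inner L f g + L2_inner L g g"
proof -
  have fg: "(\<lambda>x. f x - g x) \<in> L2 L" using assms by (rule L2_diff)
  have "L2_inner L (\<lambda>x. f x - g x) h = L2_inner L f h - L2_inner L g h" if "h \<in> L2 L" for h
    using assms that by (rule L2_inner_diff_left)
  from this[OF fg] show ?thesis
    using L2_inner_diff_left[OF assms assms(1)] L2_inner_diff_left[OF assms assms(2)]
      L2_inner_commute[of L "\<lambda>x. f x - g x" f] L2_inner_commute[of L "\<lambda>x. f x - g x" g] L2_inner_commute[of L g f]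
    by linarith
qed

lemma L2_inner_add_self:
  assumes "f \<in> L2 L" "g \<in> L2 L"
  shows "L2_inner L (\<lambda>x. f x + g x) (\<lambda>x. f x + g x) = L2_inner L f f + 2 * L2_inner L f g + L2_inner L g g"
  using L2_inner_diff_self[OF assms(1) L2_scale[OF assms(2), of "-1"]]
    L2_inner_scale_left[of L "-1" g] L2_inner_scale_right[of L _ "-1" g] by simp

lemma L2_nn_integral:
  assumes "f \<in> L2 L"
  shows "(\<integral>\<^sup>+x. ennreal (indicator (cell L) x * (norm (f x))\<^sup>2) \<partial>lborel) = ennreal (L2_inner L f f)"
  using nn_integral_eq_integral[OF L2_D(3)[OF assms, unfolded set_integrable_def]]
  by (simp add: L2_inner_self set_lebesgue_integral_def)

text \<open>Fatou's lemma on the cell gives both membership and norm bound for an almost everywhere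
  limit; applied to f - S n it also yields the rate of convergence in Riesz-Fischer.\<close>

lemma L2_fatou:
  assumes f: "f \<in> borel_measurable borel" "torus_periodic L f"
    and S: "\<And>n. S n \<in> L2 L" "\<And>n. L2_inner L (S n) (S n) \<le> B"
    and lim: "AE x in lborel. x \<in> cell L \<longrightarrow> (\<lambda>n. S n x) \<longlonglongrightarrow> f x"
  shows "f \<in> L2 L" "L2_inner L f f \<le> B"
proof -
  note [measurable] = f(1) L2_D(1)[OF S(1)]
  have "0 \<le> B" using order_trans[OF L2_inner_nonneg S(2)] .
  have "(\<integral>\<^sup>+x. ennreal (indicator (cell L) x * (norm (f x))\<^sup>2) \<partial>lborel)
     = (\<integral>\<^sup>+x. liminf (\<lambda>n. ennreal (indicator (cell L) x * (norm (S n x))\<^sup>2)) \<partial>lborel)"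
  proof (rule nn_integral_cong_AE)
    show "AE x in lborel. ennreal (indicator (cell L) x * (norm (f x))\<^sup>2) =
        liminf (\<lambda>n. ennreal (indicator (cell L) x * (norm (S n x))\<^sup>2))"
      using lim
    proof eventually_elim
      case (elim x)
      have "(\<lambda>n. ennreal (indicator (cell L) x * (norm (S n x))\<^sup>2)) \<longlonglongrightarrow> ennreal (indicator (cell L) x * (norm (f x))\<^sup>2)"
        by (cases "x \<in> cell L") (use elim in \<open>auto intro!: tendsto_intros tendsto_ennrealI\<close>)
      then show ?case by (rule lim_imp_Liminf[symmetric, rotated]) simp
    qed
  qed
  also have "\<dots> \<le> liminf (\<lambda>n. (\<integral>\<^sup>+x. ennreal (indicator (cell L) x * (norm (S n x))\<^sup>2) \<partial>lborel))"
    by (rule nn_integral_liminf) measurable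
  also have "\<dots> \<le> ennreal B"
    by (rule Liminf_le) (auto simp: L2_nn_integral[OF S(1)] intro!: ennreal_leI S(2) always_eventually)
  finally have le: "(\<integral>\<^sup>+x. ennreal (indicator (cell L) x * (norm (f x))\<^sup>2) \<partial>lborel) \<le> ennreal B" .
  have "integrable lborel (\<lambda>x. indicator (cell L) x * (norm (f x))\<^sup>2)"
    by (rule integrableI_nonneg) (auto intro: le_less_trans[OF le])
  then show fL: "f \<in> L2 L" using f by (simp add: L2_def set_integrable_def)
  show "L2_inner L f f \<le> B"
    using le \<open>0 \<le> B\<close> by (simp add: L2_nn_integral[OF fL])
qed

section \<open>Fourier coefficients, Bessel and Riesz-Fischer\<close>

definition trig_basis :: "real \<Rightarrow> (int \<times> int) \<times> 2 \<Rightarrow> real^2 \<Rightarrow> real^2" where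
  "trig_basis L i x = mode L (fst i) x *\<^sub>R axis (snd i) 1"

definition fcoeff :: "real \<Rightarrow> (real^2 \<Rightarrow> real^2) \<Rightarrow> (int \<times> int) \<times> 2 \<Rightarrow> real" where
  "fcoeff L f i = L2_inner L f (trig_basis L i)"

definition trig_sum :: "real \<Rightarrow> ((int \<times> int) \<times> 2) set \<Rightarrow> ((int \<times> int) \<times> 2 \<Rightarrow> real) \<Rightarrow> real^2 \<Rightarrow> real^2" where
  "trig_sum L F c x = (\<Sum>i\<in>F. c i *\<^sub>R trig_basis L i x)"

lemma trig_basis_L2: "0 < L \<Longrightarrow> trig_basis L i \<in> L2 L"
  unfolding trig_basis_def
  using torus_periodic_mode[of L "fst i"]
  by (intro continuous_L2 continuous_intros) (auto simp: torus_periodic_def)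

lemma trig_sum_L2: "0 < L \<Longrightarrow> trig_sum L F c \<in> L2 L"
  unfolding trig_sum_def by (intro L2_sum L2_scale trig_basis_L2)

lemma set_integral_cell_continuous:
  fixes f :: "real^2 \<Rightarrow> 'b::euclidean_space"
  assumes "continuous_on (cell L) f"
  shows "set_integrable lborel (cell L) f" "(LINT x:cell L|lborel. f x) = integral (cell L) f"
proof -
  show *: "set_integrable lborel (cell L) f"
    unfolding set_integrable_def by (rule borel_integrable_compact[OF compact_cell assms])
  show "(LINT x:cell L|lborel. f x) = integral (cell L) f"
    by (rule set_borel_integral_eq_integral(2)[OF *])
qed

lemma trig_basis_orthonormal:
  assumes "0 < L"
  shows "L2_inner L (trig_basis L i) (trig_basis L j) = (if i = j then 1 else 0)"
proof -
  have "L2_inner L (trig_basis L i) (trig_basis L j)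
     = (LINT x:cell L|lborel. (if snd i = snd j then 1 else 0) * (mode L (fst i) x * mode L (fst j) x))"
    unfolding L2_inner_def trig_basis_def by (simp add: inner_axis_axis mult_ac)
  also have "\<dots> = (if snd i = snd j then 1 else 0) * integral (cell L) (\<lambda>x. mode L (fst i) x * mode L (fst j) x)"
    by (subst set_integral_mult_right, subst set_integral_cell_continuous(2)) (auto intro!: continuous_intros)
  finally show ?thesis by (auto simp: integral_mode_mult[OF assms] prod_eq_iff)
qed

lemma L2_inner_trig_sum:
  assumes "0 < L" "f \<in> L2 L"
  shows "L2_inner L f (trig_sum L F c) = (\<Sum>i\<in>F. c i * fcoeff L f i)"
proof -
  have "L2_inner L (trig_sum L F c) f = (\<Sum>i\<in>F. L2_inner L (\<lambda>x. c i *\<^sub>R trig_basis L i x) f)"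
    unfolding trig_sum_def using assms by (intro L2_inner_sum_left L2_scale trig_basis_L2)
  also have "\<dots> = (\<Sum>i\<in>F. c i * fcoeff L f i)"
    by (simp add: L2_inner_scale_left fcoeff_def L2_inner_commute[of L f])
  finally show ?thesis by (simp only: L2_inner_commute[of L f])
qed

lemma fcoeff_trig_sum:
  assumes "0 < L" "finite F"
  shows "fcoeff L (trig_sum L F c) i = (if i \<in> F then c i else 0)"
proof -
  have "fcoeff L (trig_sum L F c) i = L2_inner L (trig_basis L i) (trig_sum L F c)"
    by (simp add: fcoeff_def L2_inner_commute)
  also have "\<dots> = (\<Sum>j\<in>F. if j = i then c i else 0)"
    unfolding L2_inner_trig_sum[OF assms(1) trig_basis_L2[OF assms(1)]]
    by (intro sum.cong) (auto simp: fcoeff_def trig_basis_orthonormal[OF assms(1)])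
  finally show ?thesis using assms(2) by simp
qed

lemma L2_inner_trig_sum_self:
  assumes "0 < L" "finite F"
  shows "L2_inner L (trig_sum L F c) (trig_sum L F c) = (\<Sum>i\<in>F. (c i)\<^sup>2)"
  by (simp add: L2_inner_trig_sum trig_sum_L2 fcoeff_trig_sum assms power2_eq_square)

lemma fcoeff_add: "0 < L \<Longrightarrow> f \<in> L2 L \<Longrightarrow> g \<in> L2 L \<Longrightarrow> fcoeff L (\<lambda>x. f x + g x) i = fcoeff L f i + fcoeff L g i"
  by (simp add: fcoeff_def L2_inner_add_left trig_basis_L2)

lemma fcoeff_diff: "0 < L \<Longrightarrow> f \<in> L2 L \<Longrightarrow> g \<in> L2 L \<Longrightarrow> fcoeff L (\<lambda>x. f x - g x) i = fcoeff L f i - fcoeff L g i"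
  by (simp add: fcoeff_def L2_inner_diff_left trig_basis_L2)

lemma fcoeff_scale: "fcoeff L (\<lambda>x. c *\<^sub>R f x) i = c * fcoeff L f i"
  by (simp add: fcoeff_def L2_inner_scale_left)

lemma bessel:
  assumes "0 < L" "f \<in> L2 L" "finite F"
  shows "(\<Sum>i\<in>F. (fcoeff L f i)\<^sup>2) \<le> L2_inner L f f"
proof -
  let ?S = "trig_sum L F (fcoeff L f)"
  have "0 \<le> L2_inner L (\<lambda>x. f x - ?S x) (\<lambda>x. f x - ?S x)" by (rule L2_inner_nonneg)
  also have "\<dots> = L2_inner L f f - 2 * L2_inner L f ?S + L2_inner L ?S ?S"
    using assms by (intro L2_inner_diff_self trig_sum_L2)
  finally show ?thesis
    using assms by (simp add: L2_inner_trig_sum_self L2_inner_trig_sum power2_eq_square)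
qed

lemma fcoeff_le: "0 < L \<Longrightarrow> f \<in> L2 L \<Longrightarrow> (fcoeff L f i)\<^sup>2 \<le> L2_inner L f f"
  using bessel[of L f "{i}"] by simp

lemma fcoeff_cong_AE:
  assumes "0 < L" "f \<in> L2 L" "g \<in> L2 L" "AE x in lborel. x \<in> cell L \<longrightarrow> f x = g x"
  shows "fcoeff L f i = fcoeff L g i"
proof -
  note [measurable] = L2_D(1)[OF assms(2)] L2_D(1)[OF assms(3)] L2_D(1)[OF trig_basis_L2[OF assms(1)]]
  show ?thesis unfolding fcoeff_def L2_inner_def
    by (rule set_lebesgue_integral_cong_AE) (use assms(4) in auto)
qed

text \<open>Since \<open>d \<le> 2\<^sup>n d\<^sup>2 + 2\<^sup>-\<^sup>n\<close>, the increments are summable in \<open>L\<^sup>1\<close> of the cell.\<close>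

lemma AE_convergent_of_fast_L2:
  assumes S: "\<And>n. S n \<in> L2 L"
    and fast: "\<And>n. L2_inner L (\<lambda>x. S (Suc n) x - S n x) (\<lambda>x. S (Suc n) x - S n x) \<le> (1/4) ^ n"
  shows "AE x in lborel. x \<in> cell L \<longrightarrow> convergent (\<lambda>n. S n x)"
proof -
  define d where "d n x = norm (S (Suc n) x - S n x)" for n x
  note [measurable] = L2_D(1)[OF S]
  have D: "(\<lambda>x. S (Suc n) x - S n x) \<in> L2 L" for n by (intro L2_diff S)
  define M where "M = measure lborel (cell L)"
  have cell_emeasure: "emeasure lborel (cell L) = ennreal M"
    unfolding M_def cell_def by (intro emeasure_eq_ennreal_measure) (auto simp: emeasure_lborel_cbox_eq)
  have "M \<ge> 0" by (simp add: M_def)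
  have bound: "(\<integral>\<^sup>+x. ennreal (indicator (cell L) x * d n x) \<partial>lborel) \<le> ennreal ((1 + M) * (1/2) ^ n)" for n
  proof -
    have "(\<integral>\<^sup>+x. ennreal (indicator (cell L) x * d n x) \<partial>lborel)
        \<le> (\<integral>\<^sup>+x. ennreal (2 ^ n) * ennreal (indicator (cell L) x * (d n x)\<^sup>2) + ennreal ((1/2) ^ n) * indicator (cell L) x \<partial>lborel)"
    proof (rule nn_integral_mono)
      fix x
      have "2 * (d n x * 1) \<le> 2 ^ n * (d n x)\<^sup>2 + (1/2) ^ n"
      proof -
        have "0 \<le> 2 ^ n * (d n x - (1/2) ^ n)\<^sup>2" by simp
        also have "\<dots> = 2 ^ n * (d n x)\<^sup>2 - 2 * d n x * (2 ^ n * (1/2) ^ n) + (2 ^ n * (1/2) ^ n) * (1/2) ^ n"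
          by (simp add: power2_eq_square algebra_simps)
        also have "(2::real) ^ n * (1/2) ^ n = 1" by (simp flip: power_mult_distrib)
        finally show ?thesis by simp
      qed
      moreover have "0 \<le> d n x" by (simp add: d_def)
      ultimately have "d n x \<le> 2 ^ n * (d n x)\<^sup>2 + (1/2) ^ n" by linarith
      then show "ennreal (indicator (cell L) x * d n x) \<le>
          ennreal (2 ^ n) * ennreal (indicator (cell L) x * (d n x)\<^sup>2) + ennreal ((1/2) ^ n) * indicator (cell L) x"
        by (auto simp: indicator_def simp flip: ennreal_mult ennreal_plus intro: ennreal_leI)
    qed
    also have "\<dots> = ennreal (2 ^ n) * (\<integral>\<^sup>+x. ennreal (indicator (cell L) x * (d n x)\<^sup>2) \<partial>lborel) + ennreal ((1/2) ^ n) * emeasure lborel (cell L)"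
      unfolding d_def by (subst nn_integral_add) (auto simp: nn_integral_cmult nn_integral_cmult_indicator)
    also have "\<dots> \<le> ennreal (2 ^ n) * ennreal ((1/4) ^ n) + ennreal ((1/2) ^ n) * ennreal M"
      unfolding cell_emeasure d_def L2_nn_integral[OF D]
      by (intro add_mono mult_mono ennreal_leI fast) auto
    also have "\<dots> = ennreal ((1 + M) * (1/2) ^ n)"
    proof -
      have "2 ^ n * (1/4) ^ n = ((1/2) ^ n :: real)" by (simp flip: power_mult_distrib)
      then show ?thesis using \<open>M \<ge> 0\<close> by (simp flip: ennreal_mult ennreal_plus add: algebra_simps)
    qed
    finally show ?thesis .
  qed
  have summ: "summable (\<lambda>n. (1 + M) * (1/2) ^ n :: real)" by (intro summable_mult summable_geometric) simp
  have "(\<integral>\<^sup>+x. (\<Sum>n. ennreal (indicator (cell L) x * d n x)) \<partial>lborel) = (\<Sum>n. \<integral>\<^sup>+x. ennreal (indicator (cell L) x * d n x) \<partial>lborel)"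
    unfolding d_def by (rule nn_integral_suminf) measurable
  also have "\<dots> \<le> (\<Sum>n. ennreal ((1 + M) * (1/2) ^ n))"
    by (rule suminf_le[OF bound]) auto
  also have "\<dots> < \<infinity>"
    using summ \<open>M \<ge> 0\<close> by (subst suminf_ennreal2) auto
  finally have "AE x in lborel. (\<Sum>n. ennreal (indicator (cell L) x * d n x)) \<noteq> \<infinity>"
    unfolding d_def by (intro nn_integral_PInf_AE) auto
  then show ?thesis
  proof eventually_elim
    case (elim x)
    show ?case
    proof
      assume x: "x \<in> cell L"
      have "summable (\<lambda>n. indicator (cell L) x * d n x)"
        by (rule summable_suminf_not_top) (use elim in \<open>auto simp: d_def\<close>)
      then have "summable (\<lambda>n. S (Suc n) x - S n x)"
        using x by (auto simp: d_def intro: summable_norm_cancel)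
      then have "convergent (\<lambda>n. \<Sum>i<n. S (Suc i) x - S i x)"
        by (simp add: summable_iff_convergent)
      then have "convergent (\<lambda>n. S n x - S 0 x)" by (simp add: sum_lessThan_telescope[of "\<lambda>n. S n x"])
      then show "convergent (\<lambda>n. S n x)"
        using convergent_add[OF _ convergent_const[of "S 0 x"]] by force
    qed
  qed
qed

text \<open>Finite sets of modes with remainder at most 4^-n give partial sums that converge fast
  enough to have a limit almost everywhere, so a pointwise defined representative exists and Fatou
  controls the error in L^2.\<close>

lemma riesz_fischer:
  assumes L: "0 < L" and c: "(\<lambda>i. (c i)\<^sup>2) summable_on UNIV"
  obtains f where "f \<in> L2 L" "\<And>i. fcoeff L f i = c i" "L2_inner L f f = infsum (\<lambda>i. (c i)\<^sup>2) UNIV"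
proof -
  define T where "T = infsum (\<lambda>i. (c i)\<^sup>2) UNIV"
  have hs: "((\<lambda>i. (c i)\<^sup>2) has_sum T) UNIV" unfolding T_def using c by (rule has_sum_infsum)
  have leT: "(\<Sum>i\<in>X. (c i)\<^sup>2) \<le> T" if "finite X" for X
    unfolding T_def using that c by (intro finite_sum_le_infsum) auto
  have "\<exists>X. finite X \<and> T - (\<Sum>i\<in>X. (c i)\<^sup>2) \<le> (1/4) ^ n" for n :: nat
  proof -
    have "\<forall>\<^sub>F X in finite_subsets_at_top UNIV. dist (\<Sum>i\<in>X. (c i)\<^sup>2) T < (1/4) ^ n"
      using hs unfolding has_sum_def by (rule tendstoD) simp
    then obtain X where "finite X" "dist (\<Sum>i\<in>X. (c i)\<^sup>2) T < (1/4) ^ n"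
      unfolding eventually_finite_subsets_at_top by blast
    then show ?thesis by (intro exI[of _ X]) (auto simp: dist_real_def)
  qed
  then obtain X where X: "\<And>n. finite (X n)" "\<And>n. T - (\<Sum>i\<in>X n. (c i)\<^sup>2) \<le> (1/4) ^ n" by metis
  \<comment> \<open>Unions make the finite sets increasing, so differences of partial sums are again
    trigonometric sums over differences of index sets.\<close>
  define G where "G n = (\<Union>m\<le>n. X m)" for n
  have finG: "finite (G n)" for n unfolding G_def using X(1) by auto
  have monoG: "G m \<subseteq> G n" if "m \<le> n" for m n
    unfolding G_def using that by (intro UN_mono) auto
  have tail: "T - (\<Sum>i\<in>G n. (c i)\<^sup>2) \<le> (1/4) ^ n" for n
  proof -
    have "(\<Sum>i\<in>X n. (c i)\<^sup>2) \<le> (\<Sum>i\<in>G n. (c i)\<^sup>2)"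
      by (intro sum_mono2 finG) (auto simp: G_def)
    then show ?thesis using X(2)[of n] by linarith
  qed
  define S where "S n = trig_sum L (G n) c" for n
  have SL2: "S n \<in> L2 L" for n unfolding S_def by (rule trig_sum_L2[OF L])
  have Sdiff: "L2_inner L (\<lambda>x. S m x - S n x) (\<lambda>x. S m x - S n x) \<le> (1/4) ^ n" if "n \<le> m" for m n
  proof -
    have "(\<lambda>x. S m x - S n x) = trig_sum L (G m - G n) c"
      unfolding S_def trig_sum_def using monoG[OF that] finG by (auto simp: sum_diff)
    then have "L2_inner L (\<lambda>x. S m x - S n x) (\<lambda>x. S m x - S n x) = (\<Sum>i\<in>G m - G n. (c i)\<^sup>2)"
      using finG by (simp add: L2_inner_trig_sum_self[OF L])
    also have "\<dots> = (\<Sum>i\<in>G m. (c i)\<^sup>2) - (\<Sum>i\<in>G n. (c i)\<^sup>2)"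
      using monoG[OF that] finG by (simp add: sum_diff)
    finally show ?thesis using leT[OF finG[of m]] tail[of n] by linarith
  qed
  have conv: "AE x in lborel. x \<in> cell L \<longrightarrow> convergent (\<lambda>n. S n x)"
    by (rule AE_convergent_of_fast_L2[OF SL2 Sdiff]) simp
  \<comment> \<open>Where the sequence diverges \<open>lim\<close> has an unspecified value, on a
    null set of the cell. Being computed from the values \<open>S n x\<close> alone, it is still
    Borel and exactly periodic.\<close>
  define f where "f x = lim (\<lambda>n. S n x)" for x
  note [measurable] = L2_D(1)[OF SL2]
  have fm: "f \<in> borel_measurable borel" unfolding f_def by measurable
  have fp: "torus_periodic L f"
    using L2_D(2)[OF SL2] by (simp add: torus_periodic_def f_def)
  have lim: "AE x in lborel. x \<in> cell L \<longrightarrow> (\<lambda>n. S n x) \<longlonglongrightarrow> f x"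
    using conv by eventually_elim (auto simp: f_def convergent_LIMSEQ_iff)
  have fd: "(\<lambda>x. f x - S n x) \<in> L2 L" "L2_inner L (\<lambda>x. f x - S n x) (\<lambda>x. f x - S n x) \<le> (1/4) ^ n" for n
  proof -
    have *: "(\<lambda>x. f x - S n x) \<in> borel_measurable borel" "torus_periodic L (\<lambda>x. f x - S n x)"
      using fm fp L2_D(2)[OF SL2] by (auto simp: torus_periodic_def)
    have "AE x in lborel. x \<in> cell L \<longrightarrow> (\<lambda>m. S (m + n) x - S n x) \<longlonglongrightarrow> f x - S n x"
      using lim by eventually_elim (auto intro!: tendsto_intros LIMSEQ_ignore_initial_segment)
    from L2_fatou[OF * _ _ this, of "(1/4) ^ n"]
    show "(\<lambda>x. f x - S n x) \<in> L2 L" "L2_inner L (\<lambda>x. f x - S n x) (\<lambda>x. f x - S n x) \<le> (1/4) ^ n"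
      using L2_diff[OF SL2 SL2] Sdiff[of n "_ + n"] by auto
  qed
  have fL2: "f \<in> L2 L" using L2_add[OF fd(1)[of 0] SL2[of 0]] by simp
  have to0: "(\<lambda>n. K * (1/4) ^ n) \<longlonglongrightarrow> 0" for K :: real
    by (intro tendsto_mult_right_zero LIMSEQ_power_zero) simp
  have coeff: "fcoeff L f i = c i" for i
  proof -
    \<comment> \<open>The factor 4 comes from (p + q)^2 <= 2 p^2 + 2 q^2: one error is the
      coefficient of f - S n, the other is either zero or a single term of the remainder.\<close>
    have "(fcoeff L f i - c i)\<^sup>2 \<le> 4 * (1/4) ^ n" for n
    proof -
      define s where "s = fcoeff L (S n) i"
      have "(fcoeff L f i - s)\<^sup>2 \<le> (1/4) ^ n"
        using fcoeff_le[OF L fd(1)[of n], of i] fd(2)[of n] by (simp add: s_def fcoeff_diff L fL2 SL2)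
      moreover have "(s - c i)\<^sup>2 \<le> (1/4) ^ n"
      proof (cases "i \<in> G n")
        case False
        then have "(\<Sum>i\<in>insert i (G n). (c i)\<^sup>2) = (c i)\<^sup>2 + (\<Sum>i\<in>G n. (c i)\<^sup>2)"
          using finG by simp
        then show ?thesis using leT[of "insert i (G n)"] finG[of n] tail[of n] False
          by (simp add: s_def S_def fcoeff_trig_sum[OF L finG])
      qed (simp add: s_def S_def fcoeff_trig_sum[OF L finG])
      moreover have "(fcoeff L f i - c i)\<^sup>2 \<le> 2 * (fcoeff L f i - s)\<^sup>2 + 2 * (s - c i)\<^sup>2"
        using sum_squares_bound[of "fcoeff L f i - s" "s - c i"]
        by (simp add: power2_eq_square algebra_simps)
      ultimately show ?thesis by linarith
    qed
    then have "(fcoeff L f i - c i)\<^sup>2 \<le> 0"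
      using LIMSEQ_le_const[OF to0[of 4]] by blast
    then show ?thesis by simp
  qed
  have "\<bar>L2_inner L f f - T\<bar> \<le> 2 * (1/4) ^ n" for n
  proof -
    have "L2_inner L (\<lambda>x. f x - S n x) (\<lambda>x. f x - S n x) = L2_inner L f f - (\<Sum>i\<in>G n. (c i)\<^sup>2)"
      unfolding L2_inner_diff_self[OF fL2 SL2] unfolding S_def
      by (simp add: L2_inner_trig_sum[OF L fL2] L2_inner_trig_sum_self[OF L finG] coeff power2_eq_square)
    then show ?thesis
      using fd(2)[of n] tail[of n] leT[OF finG[of n]] L2_inner_nonneg[of L "\<lambda>x. f x - S n x"] by linarith
  qed
  then have "\<bar>L2_inner L f f - T\<bar> \<le> 0"
    using LIMSEQ_le_const[OF to0[of 2]] by blast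
  then have "L2_inner L f f = T" by simp
  with that fL2 coeff show ?thesis by (auto simp: T_def)
qed

section \<open>Completeness of the trigonometric system\<close>

inductive trig_poly :: "real \<Rightarrow> (real^2 \<Rightarrow> real) \<Rightarrow> bool" for L where
  mode: "trig_poly L (\<lambda>x. c * mode L k x)"
| add: "trig_poly L f \<Longrightarrow> trig_poly L g \<Longrightarrow> trig_poly L (\<lambda>x. f x + g x)"

lemma trig_poly_scale: "trig_poly L f \<Longrightarrow> trig_poly L (\<lambda>x. c * f x)"
proof (induction rule: trig_poly.induct)
  case (mode d k)
  have "trig_poly L (\<lambda>x. (c * d) * mode L k x)" by (rule trig_poly.mode)
  then show ?case by (simp add: mult.assoc)
next
  case (add f g)
  then have "trig_poly L (\<lambda>x. c * f x + c * g x)" by (intro trig_poly.add)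
  then show ?case by (simp add: distrib_left)
qed

lemma trig_poly_trig:
  assumes "0 < L"
  shows "trig_poly L (\<lambda>x. cos (phase L k x))" "trig_poly L (\<lambda>x. sin (phase L k x))" "trig_poly L (\<lambda>_. c)"
proof -
  have "trig_poly L (\<lambda>x. (L / 2) * mode L k x + (L / 2) * mode L (- k) x)"
    by (intro trig_poly.intros)
  moreover have "(L / 2) * mode L k x + (L / 2) * mode L (- k) x = cos (phase L k x)" for x
    using assms by (simp add: mode_def field_simps)
  ultimately show "trig_poly L (\<lambda>x. cos (phase L k x))" by simp
  have "trig_poly L (\<lambda>x. (L / 2) * mode L k x + (- L / 2) * mode L (- k) x)"
    by (intro trig_poly.intros)
  moreover have "(L / 2) * mode L k x + (- L / 2) * mode L (- k) x = sin (phase L k x)" for x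
    using assms by (simp add: mode_def field_simps)
  ultimately show "trig_poly L (\<lambda>x. sin (phase L k x))" by simp
  have "trig_poly L (\<lambda>x. (c * L) * mode L 0 x)" by (rule trig_poly.mode)
  then show "trig_poly L (\<lambda>_. c)" using assms by (simp add: mode_def)
qed

text \<open>A product of modes is a cosine plus a sine, each of which is half a sum or difference of
  the modes k and -k. This is the algebra property needed for Stone-Weierstrass.\<close>

lemma trig_poly_mult:
  assumes L: "0 < L" and f: "trig_poly L f" and g: "trig_poly L g"
  shows "trig_poly L (\<lambda>x. f x * g x)"
  using f
proof (induction rule: trig_poly.induct)
  case (mode c k)
  from g have "trig_poly L (\<lambda>x. mode L k x * g x)"
  proof (induction rule: trig_poly.induct)
    case (mode d l)
    have "trig_poly L (\<lambda>x. d / L\<^sup>2 * (cos (phase L (k - l) x) + sin (phase L (k + l) x)))"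
      by (intro trig_poly_scale trig_poly.add trig_poly_trig L)
    moreover have "d / L\<^sup>2 * (cos (phase L (k - l) x) + sin (phase L (k + l) x)) = mode L k x * (d * mode L l x)" for x
      using mode_mult[of L k x l] by (simp add: field_simps)
    ultimately show ?case by simp
  next
    case (add f g)
    then show ?case using trig_poly.add by (simp add: distrib_left)
  qed
  then show ?case using trig_poly_scale by (simp add: mult.assoc)
next
  case (add f h)
  then show ?case using trig_poly.add by (simp add: distrib_right)
qed

lemma trig_poly_continuous: "trig_poly L f \<Longrightarrow> continuous_on S f"
  by (induction rule: trig_poly.induct) (auto intro!: continuous_intros)

lemma trig_poly_periodic: "0 < L \<Longrightarrow> trig_poly L f \<Longrightarrow> torus_periodic L f"
  by (rotate_tac, induction rule: trig_poly.induct)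
    (use torus_periodic_mode in \<open>auto simp: torus_periodic_def\<close>)

lemma trig_poly_axis_L2:
  assumes "0 < L" "trig_poly L f"
  shows "(\<lambda>x. f x *\<^sub>R axis c 1) \<in> L2 L"
  using trig_poly_periodic[OF assms] trig_poly_continuous[OF assms(2)]
  by (intro continuous_L2 continuous_intros) (auto simp: torus_periodic_def)

lemma L2_inner_trig_poly_eq_0:
  assumes L: "0 < L" and h: "h \<in> L2 L" and zero: "\<And>i. fcoeff L h i = 0" and q: "trig_poly L q"
  shows "L2_inner L (\<lambda>x. q x *\<^sub>R axis c 1) h = 0"
  using q
proof (induction rule: trig_poly.induct)
  case (mode d k)
  have "L2_inner L (\<lambda>x. d *\<^sub>R trig_basis L (k, c) x) h = 0"
    using zero[of "(k, c)"] by (simp add: L2_inner_scale_left fcoeff_def L2_inner_commute)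
  then show ?case by (simp add: trig_basis_def)
next
  case (add f g)
  have "L2_inner L (\<lambda>x. f x *\<^sub>R axis c 1 + g x *\<^sub>R axis c 1) h = 0"
    using L2_inner_add_left[OF trig_poly_axis_L2[OF L] trig_poly_axis_L2[OF L] h] add by simp
  then show ?case by (simp add: scaleR_add_left)
qed

text \<open>Trigonometric polynomials cannot separate opposite faces of the cell. Mapping the cell
  into C^2 performs the gluing, and on the image the four real coordinates separate points.\<close>

definition torus_map :: "real \<Rightarrow> real^2 \<Rightarrow> complex \<times> complex" where
  "torus_map L x = (cis (phase L (1, 0) x), cis (phase L (0, 1) x))"

lemma continuous_on_torus_map: "continuous_on S (torus_map L)"
  unfolding torus_map_def by (intro continuous_intros)

text \<open>Stone-Weierstrass on the image of the cell under \<open>torus_map\<close>; continuity descends because a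
  continuous map on a compact set is a quotient map onto its image.\<close>

lemma trig_poly_approx:
  fixes \<psi> :: "real^2 \<Rightarrow> real"
  assumes L: "0 < L" and cont: "continuous_on (cell L) \<psi>"
    and compat: "\<And>x y. x \<in> cell L \<Longrightarrow> y \<in> cell L \<Longrightarrow> torus_map L x = torus_map L y \<Longrightarrow> \<psi> x = \<psi> y"
    and e: "0 < e"
  obtains q where "trig_poly L q" "\<And>x. x \<in> cell L \<Longrightarrow> \<bar>\<psi> x - q x\<bar> < e"
proof -
  define K where "K = torus_map L ` cell L"
  define G where "G z = \<psi> (inv_into (cell L) (torus_map L) z)" for z
  have G: "G (torus_map L x) = \<psi> x" if "x \<in> cell L" for x
    unfolding G_def using that
    by (intro compat inv_into_into f_inv_into_f) auto
  have K: "compact K"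
    unfolding K_def by (intro compact_continuous_image continuous_on_torus_map compact_cell)
  have contG: "continuous_on K G"
    unfolding continuous_openin_preimage_eq
  proof (intro allI impI)
    fix U :: "real set" assume U: "open U"
    have "openin (top_of_set (cell L)) (cell L \<inter> \<psi> -` U)"
      using cont U by (auto simp: continuous_openin_preimage_eq)
    also have "cell L \<inter> \<psi> -` U = cell L \<inter> torus_map L -` (K \<inter> G -` U)"
    proof (rule set_eqI)
      show "x \<in> cell L \<inter> \<psi> -` U \<longleftrightarrow> x \<in> cell L \<inter> torus_map L -` (K \<inter> G -` U)" for x
        using G[of x] by (cases "x \<in> cell L") (simp_all add: K_def)
    qed
    finally show "openin (top_of_set K) (K \<inter> G -` U)"
      using Abstract_Topology_2.continuous_imp_quotient_map[OF continuous_on_torus_map, of L "cell L" K "K \<inter> G -` U"] compact_cell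
      by (simp add: K_def)
  qed
  \<comment> \<open>The approximating algebra: continuous functions on the image whose pullback to
    the plane is a trigonometric polynomial.\<close>
  define P where "P g \<longleftrightarrow> continuous_on K g \<and> trig_poly L (\<lambda>x. g (torus_map L x))" for g :: "complex \<times> complex \<Rightarrow> real"
  have coord: "P (\<lambda>z. Re (fst z))" "P (\<lambda>z. Im (fst z))" "P (\<lambda>z. Re (snd z))" "P (\<lambda>z. Im (snd z))"
    unfolding P_def by (auto intro!: continuous_intros simp: torus_map_def trig_poly_trig L)
  have "\<exists>g. P g \<and> (\<forall>x\<in>K. \<bar>G x - g x\<bar> < e)"
  proof (rule Stone_Weierstrass_HOL[OF K _ _ _ _ _ contG e])
    show "P (\<lambda>x. c)" for c by (simp add: P_def trig_poly_trig L)
    show "P f \<Longrightarrow> continuous_on K f" for f by (simp add: P_def)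
    show "P f \<and> P g \<Longrightarrow> P (\<lambda>x. f x + g x)" for f g by (auto simp: P_def intro: continuous_intros trig_poly.add)
    show "P f \<and> P g \<Longrightarrow> P (\<lambda>x. f x * g x)" for f g by (auto simp: P_def intro: continuous_intros trig_poly_mult L)
    fix x y assume "x \<in> K \<and> y \<in> K \<and> x \<noteq> y"
    then have "Re (fst x) \<noteq> Re (fst y) \<or> Im (fst x) \<noteq> Im (fst y) \<or> Re (snd x) \<noteq> Re (snd y) \<or> Im (snd x) \<noteq> Im (snd y)"
      by (auto simp: prod_eq_iff complex_eq_iff)
    then show "\<exists>f. P f \<and> f x \<noteq> f y" using coord by metis
  qed
  then obtain g where "P g" "\<forall>x\<in>K. \<bar>G x - g x\<bar> < e" by blast
  then show ?thesis
    by (intro that[of "\<lambda>x. g (torus_map L x)"]) (auto simp: P_def K_def simp flip: G)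
qed

text \<open>Gluing only affects faces, so a function vanishing on all faces is automatically
  compatible with \<open>torus_map\<close>. Coordinates with equal images differ by an integer
  multiple n L.\<close>

lemma torus_map_eq_boundary:
  assumes L: "0 < L" and x: "x \<in> cell L" and y: "y \<in> cell L" and eq: "torus_map L x = torus_map L y"
    and int: "\<And>j. x $ j \<noteq> 0" "\<And>j. x $ j \<noteq> L"
  shows "x = y"
proof -
  have "x $ j = y $ j" for j :: 2
  proof -
    have "phase L (1, 0) z = 2 * pi / L * z $ 1" "phase L (0, 1) z = 2 * pi / L * z $ 2" for z
      by (simp_all add: phase_def freq_def sum_2)
    then have "cis (2 * pi / L * x $ j) = cis (2 * pi / L * y $ j)"
      using eq exhaust_2[of j] by (auto simp: torus_map_def)
    then obtain n :: int where "2 * pi / L * x $ j = 2 * pi / L * y $ j + 2 * pi * n"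
      using sin_cos_eq_iff[of "2 * pi / L * x $ j" "2 * pi / L * y $ j"] by (auto simp: complex_eq_iff)
    then have "2 * pi * (x $ j) = 2 * pi * (y $ j + n * L)" using L by (simp add: field_simps)
    then have n: "x $ j = y $ j + n * L" by simp
    have "0 < x $ j" "x $ j < L" "0 \<le> y $ j" "y $ j \<le> L"
      using x y int by (auto simp: mem_cell less_le)
    \<comment> \<open>The coordinate of x is strictly inside (0,L) while that of y may be 0 or L;
      the difference is still strictly below L in modulus, which forces n = 0.\<close>
    then have "- 1 * L < real_of_int n * L" "real_of_int n * L < 1 * L" using n by linarith+
    then have "- 1 < real_of_int n" "real_of_int n < 1" using L by (simp_all only: mult_less_cancel_right_pos)
    then have "n = 0" by linarith
    then show ?thesis using n by simp
  qed
  then show ?thesis by (simp add: vec_eq_iff)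
qed

text \<open>Such a \<psi> is a uniform limit on the cell of trigonometric polynomials, to which h is
  orthogonal; the error is at most the uniform distance times the L^1 norm of the component of
  h.\<close>

lemma integral_test_eq_0:
  assumes L: "0 < L" and h: "h \<in> L2 L" and zero: "\<And>i. fcoeff L h i = 0"
    and \<psi>: "continuous_on UNIV \<psi>" "\<And>x. \<bar>\<psi> x\<bar> \<le> 1"
    and bd: "\<And>x j. x \<in> cell L \<Longrightarrow> x $ j = 0 \<or> x $ j = L \<Longrightarrow> \<psi> x = 0"
    and hint: "set_integrable lborel (cell L) (\<lambda>x. \<bar>h x $ c\<bar>)"
  shows "set_integrable lborel (cell L) (\<lambda>x. \<psi> x * h x $ c)" "(LINT x:cell L|lborel. \<psi> x * h x $ c) = 0"
proof -
  have m[measurable]: "\<psi> \<in> borel_measurable borel" "h \<in> borel_measurable borel"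
    using \<psi>(1) L2_D(1)[OF h] by (auto intro: borel_measurable_continuous_onI)
  have mc[measurable]: "(\<lambda>x. h x $ c) \<in> borel_measurable borel"
    unfolding cart_eq_inner_axis by measurable
  show int: "set_integrable lborel (cell L) (\<lambda>x. \<psi> x * h x $ c)"
  proof (rule set_integrable_bound[OF hint])
    show "set_borel_measurable lborel (cell L) (\<lambda>x. \<psi> x * h x $ c)"
      unfolding set_borel_measurable_def by measurable
    show "AE x in lborel. x \<in> cell L \<longrightarrow> norm (\<psi> x * h x $ c) \<le> norm \<bar>h x $ c\<bar>"
      using \<psi>(2) by (auto simp: abs_mult mult_left_le_one_le)
  qed
  define I where "I = (LINT x:cell L|lborel. \<bar>h x $ c\<bar>)"
  have "0 \<le> I" unfolding I_def set_lebesgue_integral_def by (rule Bochner_Integration.integral_nonneg) simp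
  have compat: "\<psi> x = \<psi> y" if "x \<in> cell L" "y \<in> cell L" "torus_map L x = torus_map L y" for x y
  proof (cases "\<exists>j. x $ j = 0 \<or> x $ j = L")
    case x: True
    show ?thesis
    proof (cases "\<exists>j. y $ j = 0 \<or> y $ j = L")
      case True
      then show ?thesis using x bd that by metis
    next
      case False
      then show ?thesis using torus_map_eq_boundary[OF L that(2,1) that(3)[symmetric]] by auto
    qed
  next
    case False
    then show ?thesis using torus_map_eq_boundary[OF L that] by auto
  qed
  have "\<bar>LINT x:cell L|lborel. \<psi> x * h x $ c\<bar> \<le> 0 + e" if "0 < e" for e
  proof -
    \<comment> \<open>I is the L^1 norm just mentioned; adding 1 avoids a division by zero.\<close>
    have "0 < e / (I + 1)" using that \<open>0 \<le> I\<close> by simp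
    then obtain q where q: "trig_poly L q" "\<And>x. x \<in> cell L \<Longrightarrow> \<bar>\<psi> x - q x\<bar> < e / (I + 1)"
      using trig_poly_approx[OF L continuous_on_subset[OF \<psi>(1)] compat] by blast
    have qint: "set_integrable lborel (cell L) (\<lambda>x. q x * h x $ c)"
      using L2_inner_integrable[OF trig_poly_axis_L2[OF L q(1), of c] h] by (simp add: inner_axis')
    have "(LINT x:cell L|lborel. q x * h x $ c) = 0"
      using L2_inner_trig_poly_eq_0[OF L h zero q(1), of c] by (simp add: L2_inner_def inner_axis')
    then have "(LINT x:cell L|lborel. \<psi> x * h x $ c) = (LINT x:cell L|lborel. \<psi> x * h x $ c - q x * h x $ c)"
      using int qint by (simp add: set_integral_diff(2))
    then have "\<bar>LINT x:cell L|lborel. \<psi> x * h x $ c\<bar> \<le> (LINT x:cell L|lborel. \<bar>\<psi> x * h x $ c - q x * h x $ c\<bar>)"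
      using set_integral_norm_bound[OF set_integral_diff(1)[OF int qint]] by simp
    also have "\<dots> \<le> (LINT x:cell L|lborel. e / (I + 1) * \<bar>h x $ c\<bar>)"
    proof (rule set_integral_mono)
      show "set_integrable lborel (cell L) (\<lambda>x. \<bar>\<psi> x * h x $ c - q x * h x $ c\<bar>)"
        by (rule set_integrable_abs[OF set_integral_diff(1)[OF int qint]])
      show "set_integrable lborel (cell L) (\<lambda>x. e / (I + 1) * \<bar>h x $ c\<bar>)"
        using hint by (rule set_integrable_mult_right)
      fix x assume "x \<in> cell L"
      then have "\<bar>\<psi> x - q x\<bar> \<le> e / (I + 1)" using q(2) less_imp_le by blast
      then have "\<bar>\<psi> x - q x\<bar> * \<bar>h x $ c\<bar> \<le> e / (I + 1) * \<bar>h x $ c\<bar>" by (rule mult_right_mono) simp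
      then show "\<bar>\<psi> x * h x $ c - q x * h x $ c\<bar> \<le> e / (I + 1) * \<bar>h x $ c\<bar>"
        by (simp add: abs_mult flip: left_diff_distrib)
    qed
    also have "\<dots> = e / (I + 1) * I" by (simp only: set_integral_mult_right I_def)
    also have "\<dots> \<le> e" using that \<open>0 \<le> I\<close> by (simp add: field_simps)
    finally show ?thesis by simp
  qed
  then have "\<bar>LINT x:cell L|lborel. \<psi> x * h x $ c\<bar> \<le> 0" by (rule field_le_epsilon)
  then show "(LINT x:cell L|lborel. \<psi> x * h x $ c) = 0" by simp
qed

text \<open>Completeness: \<open>h / (1 + \<bar>h\<bar>)\<close> is an almost everywhere limit of bounded continuous functions
  vanishing on the boundary of the cell, so \<open>h\<^sup>2 / (1 + \<bar>h\<bar>)\<close> has integral zero.\<close>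

lemma fcoeff_eq_0_imp_AE:
  assumes L: "0 < L" and h: "h \<in> L2 L" and zero: "\<And>i. fcoeff L h i = 0"
  shows "AE x in lborel. x \<in> cell L \<longrightarrow> h x = 0"
proof -
  have "AE x in lborel. x \<in> cell L \<longrightarrow> h x $ c = 0" for c
  proof -
    define u where "u x = h x $ c" for x
    have [measurable]: "h \<in> borel_measurable borel" by (rule L2_D(1)[OF h])
    have u[measurable]: "u \<in> borel_measurable borel"
      unfolding u_def cart_eq_inner_axis by measurable
    have "(\<lambda>x. axis 1 1) \<in> L2 L" by (intro continuous_L2) (auto simp: torus_periodic_def)
    then have uint: "set_integrable lborel (cell L) (\<lambda>x. \<bar>u x\<bar>)"
    proof (rule L2_bound_integrable[OF h])
      fix x
      have "\<bar>u x\<bar> \<le> norm (h x)" unfolding u_def by (rule component_le_norm_cart)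
      also have "\<dots> \<le> (norm (h x))\<^sup>2 + 1\<^sup>2"
        using sum_squares_bound[of "norm (h x)" 1] norm_ge_zero[of "h x"] by linarith
      finally show "norm \<bar>u x\<bar> \<le> 1 * ((norm (h x))\<^sup>2 + (norm (axis 1 1 :: real^2))\<^sup>2)"
        by (simp add: norm_axis_1)
    qed measurable
    define b where "b x = u x / (1 + \<bar>u x\<bar>)" for x
    have b[measurable]: "b \<in> borel_measurable borel" unfolding b_def by measurable
    have b1: "\<bar>b x\<bar> \<le> 1" for x by (simp add: b_def field_simps)
    have "b \<in> borel_measurable lebesgue" using b by (simp add: measurable_completion)
    \<comment> \<open>\<open>measurable_on\<close> supplies continuous functions converging to b off
      a negligible set.\<close>
    then have "b measurable_on UNIV" by (rule lebesgue_measurable_imp_measurable_on) simp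
    then obtain N g where N: "negligible N" and g: "\<And>n. continuous_on UNIV (g n)"
      and lim: "\<And>x. x \<notin> N \<Longrightarrow> (\<lambda>n. g n x) \<longlonglongrightarrow> b x"
      unfolding measurable_on_def by auto
    \<comment> \<open>\<open>w\<close> vanishes exactly when some coordinate is 0 or L. The factor
      min 1 (n w) forces the test functions to vanish on the faces and tends to 1 on the open cell;
      clamping to [-1,1] keeps them bounded without changing the limit, since |b| <= 1. The faces
      themselves are a null set.\<close>
    define w where "w x = \<bar>x $ 1 * (L - x $ 1) * (x $ 2 * (L - x $ 2))\<bar>" for x :: "real^2"
    define \<psi> where "\<psi> n x = max (-1) (min 1 (g n x)) * min 1 (real n * w x)" for n x
    have \<psi>c: "continuous_on UNIV (\<psi> n)" for n
      unfolding \<psi>_def w_def by (intro continuous_intros g)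
    have \<psi>1: "\<bar>\<psi> n x\<bar> \<le> 1" for n x
      unfolding \<psi>_def abs_mult by (intro mult_le_one) (auto simp: w_def)
    have \<psi>0: "\<psi> n x = 0" if "x $ j = 0 \<or> x $ j = L" for n x j
      using that exhaust_2[of j] by (auto simp: \<psi>_def w_def)
    have z: "(LINT x:cell L|lborel. \<psi> n x * u x) = 0" for n
      using integral_test_eq_0(2)[OF L h zero \<psi>c \<psi>1 \<psi>0 uint[unfolded u_def]] by (simp add: u_def)
    have [measurable]: "\<psi> n \<in> borel_measurable borel" for n
      using \<psi>c by (rule borel_measurable_continuous_onI)
    have "negligible (cell L - box 0 (\<chi> i. L))" unfolding cell_def by (rule negligible_frontier_interval)
    then have "AE x in lborel. x \<notin> N \<union> (cell L - box 0 (\<chi> i. L))"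
      using N by (metis AE_completion_iff AE_not_in negligible_Un negligible_iff_null_sets)
    then have lim\<psi>: "AE x in lborel. (\<lambda>n. indicator (cell L) x *\<^sub>R (\<psi> n x * u x)) \<longlonglongrightarrow> indicator (cell L) x *\<^sub>R (b x * u x)"
    proof eventually_elim
      case (elim x)
      show ?case
      proof (cases "x \<in> cell L")
        case True
        then have "x \<in> box 0 (\<chi> i. L)" using elim by auto
        then have "0 < x $ j" "0 < L - x $ j" for j by (auto simp: mem_box_cart)
        then have "0 < x $ 1 * (L - x $ 1) * (x $ 2 * (L - x $ 2))" by (intro mult_pos_pos)
        then have "0 < w x" by (simp add: w_def)
        obtain M :: nat where M: "1 / w x < M" using reals_Archimedean2 by blast
        have "min 1 (real n * w x) = 1" if "n \<ge> M" for n
        proof -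
          have "1 < M * w x" using M \<open>0 < w x\<close> by (simp add: field_simps)
          also have "\<dots> \<le> n * w x" using that \<open>0 < w x\<close> by (intro mult_right_mono) auto
          finally show ?thesis by simp
        qed
        then have "(\<lambda>n. min 1 (real n * w x)) \<longlonglongrightarrow> 1"
          by (intro tendsto_eventually) (auto simp: eventually_at_top_linorder intro!: exI[of _ M])
        moreover have "(\<lambda>n. max (-1) (min 1 (g n x))) \<longlonglongrightarrow> max (-1) (min 1 (b x))"
          using elim by (intro tendsto_intros lim) auto
        moreover have "max (-1) (min 1 (b x)) = b x" using b1[of x] by auto
        ultimately have "(\<lambda>n. \<psi> n x) \<longlonglongrightarrow> b x * 1" unfolding \<psi>_def by (metis tendsto_mult)
        then show ?thesis by (auto intro!: tendsto_intros)
      qed simp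
    qed
    have iu: "integrable lborel (\<lambda>x. indicator (cell L) x * \<bar>u x\<bar>)"
      using uint by (simp add: set_integrable_def)
    have dom: "AE x in lborel. norm (indicator (cell L) x *\<^sub>R (\<psi> n x * u x)) \<le> indicator (cell L) x * \<bar>u x\<bar>" for n
      using \<psi>1 by (auto simp: abs_mult indicator_def mult_left_le_one_le)
    have "(\<lambda>n. LINT x|lborel. indicator (cell L) x *\<^sub>R (\<psi> n x * u x)) \<longlonglongrightarrow> (LINT x|lborel. indicator (cell L) x *\<^sub>R (b x * u x))"
      by (rule integral_dominated_convergence[OF _ _ iu lim\<psi> dom]) measurable
    then have "(LINT x|lborel. indicator (cell L) x *\<^sub>R (b x * u x)) = 0"
      using z by (simp add: set_lebesgue_integral_def LIMSEQ_const_iff)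
    moreover have "integrable lborel (\<lambda>x. indicator (cell L) x *\<^sub>R (b x * u x))"
      by (rule integrable_dominated_convergence[OF _ _ iu lim\<psi> dom]) measurable
    moreover have bu: "b x * u x = (u x)\<^sup>2 / (1 + \<bar>u x\<bar>)" for x
      by (simp add: b_def power2_eq_square)
    ultimately have "AE x in lborel. indicator (cell L) x *\<^sub>R (b x * u x) = 0"
      by (subst (asm) integral_nonneg_eq_0_iff_AE) (auto simp: bu)
    then show ?thesis
    proof eventually_elim
      case (elim x)
      have "1 + \<bar>u x\<bar> \<noteq> 0" using abs_ge_zero[of "u x"] by linarith
      with elim show ?case by (auto simp: b_def indicator_def u_def)
    qed
  qed
  then have "AE x in lborel. \<forall>c. x \<in> cell L \<longrightarrow> h x $ c = 0" unfolding AE_all_countable by blast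
  then show ?thesis by eventually_elim (auto simp: vec_eq_iff)
qed

text \<open>Riesz-Fischer produces a function with the coefficients of f and with the right norm;
  completeness says that it equals f almost everywhere on the cell.\<close>

lemma parseval:
  assumes L: "0 < L" and f: "f \<in> L2 L"
  shows "((\<lambda>i. (fcoeff L f i)\<^sup>2) has_sum L2_inner L f f) UNIV"
proof -
  have "(\<lambda>i. (fcoeff L f i)\<^sup>2) summable_on UNIV"
    by (rule nonneg_bdd_above_summable_on)
      (auto intro!: bdd_aboveI[of _ "L2_inner L f f"] bessel[OF L f])
  then obtain g where g: "g \<in> L2 L" "\<And>i. fcoeff L g i = fcoeff L f i"
    "L2_inner L g g = infsum (\<lambda>i. (fcoeff L f i)\<^sup>2) UNIV"
    using riesz_fischer[OF L] by metis
  note [measurable] = L2_D(1)[OF f] L2_D(1)[OF g(1)]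
  have "AE x in lborel. x \<in> cell L \<longrightarrow> f x - g x = 0"
    by (rule fcoeff_eq_0_imp_AE[OF L L2_diff[OF f g(1)]]) (simp add: fcoeff_diff L f g)
  then have "L2_inner L f f = L2_inner L g g"
    unfolding L2_inner_def by (intro set_lebesgue_integral_cong_AE) auto
  then show ?thesis using g(3) \<open>_ summable_on UNIV\<close> by (simp add: has_sum_infsum)
qed

text \<open>Polarisation: half of |f + g|^2 - |f|^2 - |g|^2.\<close>

lemma parseval_inner:
  assumes L: "0 < L" and f: "f \<in> L2 L" and g: "g \<in> L2 L"
  shows "((\<lambda>i. fcoeff L f i * fcoeff L g i) has_sum L2_inner L f g) UNIV"
proof -
  have "((\<lambda>i. (fcoeff L (\<lambda>x. f x + g x) i)\<^sup>2 - (fcoeff L f i)\<^sup>2 - (fcoeff L g i)\<^sup>2) has_sum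
      (L2_inner L (\<lambda>x. f x + g x) (\<lambda>x. f x + g x) - L2_inner L f f - L2_inner L g g)) UNIV"
    unfolding diff_conv_add_uminus
    by (intro has_sum_add has_sum_uminusI parseval L f g L2_add)
  from has_sum_cmult_right[OF this, of "1/2"]
  have "((\<lambda>i. 1/2 * ((fcoeff L (\<lambda>x. f x + g x) i)\<^sup>2 - (fcoeff L f i)\<^sup>2 - (fcoeff L g i)\<^sup>2)) has_sum L2_inner L f g) UNIV"
    by (simp add: L2_inner_add_self[OF f g])
  then show ?thesis by (simp add: fcoeff_add[OF L f g] power2_sum)
qed

section \<open>Sobolev spaces in terms of Fourier coefficients\<close>

text \<open>The closed form is (-1)^(n(n-1)/2). Each differentiation reflects the frequency, so the
  next factor comes out with the opposite sign, giving the pattern +, +, -, -.\<close>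

primrec deriv_sign :: "nat \<Rightarrow> real" where
  "deriv_sign 0 = 1"
| "deriv_sign (Suc n) = (-1) ^ n * deriv_sign n"

definition flip :: "nat \<Rightarrow> int \<times> int \<Rightarrow> int \<times> int" where
  "flip n k = (if even n then k else - k)"

definition deriv_factor :: "real \<Rightarrow> multi_index \<Rightarrow> int \<times> int \<Rightarrow> real" where
  "deriv_factor L \<alpha> k = deriv_sign (order_of \<alpha>) * (freq L k 1 ^ \<alpha> 1 * freq L k 2 ^ \<alpha> 2)"

text \<open>The cross sign (-1)^(a b) is the triangular number identity. It accounts for the second
  partial derivative starting from a frequency already reflected by the first, so that the total
  sign depends on the order of the multi-index alone.\<close>

lemma deriv_sign_add: "deriv_sign (a + b) = (-1) ^ (a * b) * deriv_sign a * deriv_sign b"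
  by (induction a) (auto simp: power_add algebra_simps)

lemma deriv_sign_square [simp]: "(deriv_sign n)\<^sup>2 = 1"
  by (induction n) (auto simp: power_mult_distrib simp flip: power_mult)

lemma order_of_eq: "order_of \<alpha> = \<alpha> 1 + \<alpha> 2"
  by (simp add: order_of_def sum_2)

lemma freq_flip: "freq L (flip n k) j = (-1) ^ n * freq L k j"
  by (auto simp: flip_def)

lemma flip_flip: "flip a (flip b k) = flip (a + b) k"
  by (auto simp: flip_def)

lemma flip_self [simp]: "flip n (flip n k) = k"
  by (auto simp: flip_def)

lemma minus_flip: "- flip n k = flip (Suc n) k"
  by (auto simp: flip_def)

lemma iterated_pderivative_mode:
  "(pderivative j ^^ n) (\<lambda>x. c * mode L k x) =
    (\<lambda>x. (c * (deriv_sign n * freq L k j ^ n)) * mode L (flip n k) x)"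
proof (induction n)
  case (Suc n)
  show ?case
    unfolding funpow.simps o_apply Suc pderivative_mode
    by (simp add: minus_flip freq_flip mult_ac)
qed (simp add: flip_def)

lemma iter_pderivative_mode:
  "iter_pderivative \<alpha> (mode L k) = (\<lambda>x. deriv_factor L \<alpha> k * mode L (flip (order_of \<alpha>) k) x)"
proof -
  have "iter_pderivative \<alpha> (\<lambda>x. 1 * mode L k x) = (\<lambda>x. deriv_factor L \<alpha> k * mode L (flip (order_of \<alpha>) k) x)"
    unfolding iter_pderivative_def iterated_pderivative_mode
    by (simp add: deriv_factor_def order_of_eq flip_flip freq_flip deriv_sign_add power_mult_distrib
        mult_ac flip: power_mult)
  then show ?thesis by simp
qed

lemma integral_iterated_pderivative:
  assumes L: "0 < L" and \<phi>: "\<phi> \<in> torus_test L"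
  shows "integral (cell L) (\<lambda>x. (pderivative j ^^ n) \<phi> x * mode L k x)
    = (-1) ^ n * (deriv_sign n * freq L k j ^ n) * integral (cell L) (\<lambda>x. \<phi> x * mode L (flip n k) x)"
proof (induction n arbitrary: k)
  case (Suc n)
  have "integral (cell L) (\<lambda>x. (pderivative j ^^ Suc n) \<phi> x * mode L k x)
      = - integral (cell L) (\<lambda>x. (pderivative j ^^ n) \<phi> x * pderivative j (mode L k) x)"
    using integral_by_parts_torus[OF L iterated_pderivative_torus_test[OF \<phi>] mode_torus_test[OF L]] by simp
  also have "pderivative j (mode L k) = (\<lambda>x. freq L k j * mode L (- k) x)"
    using pderivative_mode[of j 1 L k] by simp
  also have "integral (cell L) (\<lambda>x. (pderivative j ^^ n) \<phi> x * (freq L k j * mode L (- k) x))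
      = freq L k j * integral (cell L) (\<lambda>x. (pderivative j ^^ n) \<phi> x * mode L (- k) x)"
    by (subst integral_mult_right[symmetric]) (simp add: mult_ac)
  also have "flip n (- k) = flip (Suc n) k" by (auto simp: flip_def)
  ultimately show ?case unfolding Suc by (simp add: power_minus' mult_ac)
qed (simp add: flip_def)

lemma integral_iter_pderivative:
  assumes L: "0 < L" and \<phi>: "\<phi> \<in> torus_test L"
  shows "integral (cell L) (\<lambda>x. iter_pderivative \<alpha> \<phi> x * mode L k x)
    = (-1) ^ order_of \<alpha> * deriv_factor L \<alpha> k * integral (cell L) (\<lambda>x. \<phi> x * mode L (flip (order_of \<alpha>) k) x)"
  unfolding iter_pderivative_def integral_iterated_pderivative[OF L iterated_pderivative_torus_test[OF \<phi>]]
    integral_iterated_pderivative[OF L \<phi>]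
  by (simp add: deriv_factor_def order_of_eq flip_flip freq_flip deriv_sign_add
      power_mult_distrib power_add mult_ac add.commute flip: power_mult)

lemma test_axis_L2:
  assumes "\<phi> \<in> torus_test L"
  shows "(\<lambda>x. \<phi> x *\<^sub>R axis c 1) \<in> L2 L"
  using assms torus_test_continuous[OF assms]
  by (intro continuous_L2 continuous_intros) (auto simp: torus_test_def torus_periodic_def)

lemma test_integral_component:
  assumes \<phi>: "\<phi> \<in> torus_test L" and f: "f \<in> L2 L"
  shows "(LINT x:cell L|lborel. \<phi> x *\<^sub>R f x) $ c = L2_inner L f (\<lambda>x. \<phi> x *\<^sub>R axis c 1)"
proof -
  have [measurable]: "\<phi> \<in> borel_measurable borel" "f \<in> borel_measurable borel"
    using torus_test_continuous[OF \<phi>] L2_D(1)[OF f] by (auto intro: borel_measurable_continuous_onI)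
  have "set_integrable lborel (cell L) (\<lambda>x. \<phi> x *\<^sub>R f x)"
  proof (rule L2_bound_integrable[OF test_axis_L2[OF \<phi>, of 1] f])
    fix x
    show "norm (\<phi> x *\<^sub>R f x) \<le> 1 * ((norm (\<phi> x *\<^sub>R axis 1 1 :: real^2))\<^sup>2 + (norm (f x))\<^sup>2)"
      using sum_squares_bound[of "\<bar>\<phi> x\<bar>" "norm (f x)", unfolded mult.assoc]
        mult_nonneg_nonneg[OF abs_ge_zero[of "\<phi> x"] norm_ge_zero[of "f x"]]
      unfolding mult_1_left norm_scaleR norm_axis_1 mult_1_right by linarith
  qed measurable
  then show ?thesis
    unfolding set_integrable_def set_lebesgue_integral_def L2_inner_def cart_eq_inner_axis[of _ c]
    by (subst integral_inner_left[symmetric]) (auto simp: inner_axis mult_ac)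
qed

text \<open>The vector identity is read by components as pairings with scalar test functions times a
  unit vector, which puts it within reach of \<open>parseval_inner\<close>.\<close>

lemma is_weak_deriv_iff:
  assumes "f \<in> L2 L" "g \<in> L2 L"
  shows "is_weak_deriv L \<alpha> f g \<longleftrightarrow> (\<forall>\<phi>\<in>torus_test L. \<forall>c.
    L2_inner L f (\<lambda>x. iter_pderivative \<alpha> \<phi> x *\<^sub>R axis c 1) = (-1) ^ order_of \<alpha> * L2_inner L g (\<lambda>x. \<phi> x *\<^sub>R axis c 1))"
  unfolding is_weak_deriv_def vec_eq_iff
  by (simp add: test_integral_component assms iter_pderivative_torus_test)

lemma fcoeff_test_axis:
  assumes L: "0 < L" and \<phi>: "\<phi> \<in> torus_test L"
  shows "fcoeff L (\<lambda>x. \<phi> x *\<^sub>R axis c 1) i =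
    (if snd i = c then 1 else 0) * integral (cell L) (\<lambda>x. \<phi> x * mode L (fst i) x)"
proof -
  have "fcoeff L (\<lambda>x. \<phi> x *\<^sub>R axis c 1) i
     = (LINT x:cell L|lborel. (if snd i = c then 1 else 0) * (\<phi> x * mode L (fst i) x))"
    unfolding fcoeff_def L2_inner_def trig_basis_def by (auto simp add: inner_axis_axis mult_ac)
  also have "\<dots> = (if snd i = c then 1 else 0) * integral (cell L) (\<lambda>x. \<phi> x * mode L (fst i) x)"
    using torus_test_continuous[OF \<phi>]
    by (subst set_integral_mult_right, subst set_integral_cell_continuous(2)) (auto intro!: continuous_intros)
  finally show ?thesis .
qed

text \<open>The modes are themselves test functions. Testing with them determines every coefficient
  of every weak derivative, so the representative chosen in \<open>weak_deriv\<close> does not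
  matter.\<close>

lemma weak_deriv_fcoeff:
  assumes L: "0 < L" and f: "f \<in> L2 L" and g: "g \<in> L2 L" and w: "is_weak_deriv L \<alpha> f g"
  shows "fcoeff L g i = (-1) ^ order_of \<alpha> * deriv_factor L \<alpha> (fst i) * fcoeff L f (flip (order_of \<alpha>) (fst i), snd i)"
proof -
  have "L2_inner L f (\<lambda>x. iter_pderivative \<alpha> (mode L (fst i)) x *\<^sub>R axis (snd i) 1)
     = (-1) ^ order_of \<alpha> * L2_inner L g (\<lambda>x. mode L (fst i) x *\<^sub>R axis (snd i) 1)"
    using w mode_torus_test[OF L] unfolding is_weak_deriv_iff[OF f g] by blast
  moreover have "L2_inner L f (\<lambda>x. iter_pderivative \<alpha> (mode L (fst i)) x *\<^sub>R axis (snd i) 1)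
      = deriv_factor L \<alpha> (fst i) * fcoeff L f (flip (order_of \<alpha>) (fst i), snd i)"
    unfolding iter_pderivative_mode fcoeff_def trig_basis_def
    by (simp flip: scaleR_scaleR add: L2_inner_scale_right)
  moreover have "L2_inner L g (\<lambda>x. mode L (fst i) x *\<^sub>R axis (snd i) 1) = fcoeff L g i"
    by (simp add: fcoeff_def trig_basis_def[abs_def])
  ultimately have "(-1) ^ order_of \<alpha> * ((-1) ^ order_of \<alpha> * fcoeff L g i) =
      (-1) ^ order_of \<alpha> * (deriv_factor L \<alpha> (fst i) * fcoeff L f (flip (order_of \<alpha>) (fst i), snd i))" by simp
  then show ?thesis by (simp add: mult.assoc flip: power_add mult_2)
qed

definition dweight :: "real \<Rightarrow> multi_index \<Rightarrow> int \<times> int \<Rightarrow> real" where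
  "dweight L \<alpha> k = ((freq L k 1)\<^sup>2) ^ \<alpha> 1 * ((freq L k 2)\<^sup>2) ^ \<alpha> 2"

lemma dweight_nonneg [simp]: "0 \<le> dweight L \<alpha> k"
  by (simp add: dweight_def)

lemma deriv_factor_square: "(deriv_factor L \<alpha> k)\<^sup>2 = dweight L \<alpha> k"
  by (simp add: deriv_factor_def dweight_def power_mult_distrib mult.commute flip: power_mult)

lemma deriv_factor_flip: "deriv_factor L \<alpha> (flip (order_of \<alpha>) k) = (-1) ^ order_of \<alpha> * deriv_factor L \<alpha> k"
proof -
  let ?s = "(-1 :: real) ^ order_of \<alpha>"
  have s: "?s ^ \<alpha> 1 * ?s ^ \<alpha> 2 = ?s"
    by (cases "even (order_of \<alpha>)") (simp_all add: order_of_eq flip: power_add)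
  have "deriv_factor L \<alpha> (flip (order_of \<alpha>) k) =
      deriv_sign (order_of \<alpha>) * ((?s ^ \<alpha> 1 * ?s ^ \<alpha> 2) * (freq L k 1 ^ \<alpha> 1 * freq L k 2 ^ \<alpha> 2))"
    unfolding deriv_factor_def freq_flip power_mult_distrib by (simp only: mult_ac)
  then show ?thesis unfolding s deriv_factor_def by (simp only: mult_ac)
qed

lemma dweight_flip [simp]: "dweight L \<alpha> (flip n k) = dweight L \<alpha> k"
  by (simp add: dweight_def freq_flip power_mult_distrib flip: power_mult)

lemma bij_flip_index: "bij (\<lambda>i. (flip n (fst i), snd i))"
  by (rule bij_betw_byWitness[where f' = "\<lambda>i. (flip n (fst i), snd i)"]) auto

lemma has_sum_flip:
  "((\<lambda>i. h (flip n (fst i), snd i)) has_sum S) UNIV \<longleftrightarrow> (h has_sum S) UNIV"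
  using has_sum_reindex_bij_betw[OF bij_flip_index[of n], of h S] .

text \<open>Parseval for g gives the sum over reflected frequencies; reflection is an involution of
  the index set and leaves the weight unchanged.\<close>

lemma weak_deriv_has_sum:
  assumes L: "0 < L" and f: "f \<in> L2 L" and g: "g \<in> L2 L" and w: "is_weak_deriv L \<alpha> f g"
  shows "((\<lambda>i. dweight L \<alpha> (fst i) * (fcoeff L f i)\<^sup>2) has_sum (L2_norm L g)\<^sup>2) UNIV"
proof -
  have "((\<lambda>i. (fcoeff L g i)\<^sup>2) has_sum (L2_norm L g)\<^sup>2) UNIV"
    unfolding L2_norm_power2 by (rule parseval[OF L g])
  moreover have "(fcoeff L g i)\<^sup>2 =
      dweight L \<alpha> (flip (order_of \<alpha>) (fst i)) * (fcoeff L f (flip (order_of \<alpha>) (fst i), snd i))\<^sup>2" for i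
    unfolding weak_deriv_fcoeff[OF assms]
    by (simp add: power_mult_distrib deriv_factor_square flip: power_mult)
  ultimately show ?thesis
    using has_sum_flip[of "\<lambda>i. dweight L \<alpha> (fst i) * (fcoeff L f i)\<^sup>2" "order_of \<alpha>"] by simp
qed

text \<open>The coefficients of a weak derivative are known in advance, so Riesz-Fischer builds the
  candidate. Parseval turns both sides of the defining identity into sums, which agree after
  reflecting the frequencies in one of them.\<close>

lemma weak_deriv_exists:
  assumes L: "0 < L" and f: "f \<in> L2 L"
    and summ: "(\<lambda>i. dweight L \<alpha> (fst i) * (fcoeff L f i)\<^sup>2) summable_on UNIV"
  shows "\<exists>g\<in>L2 L. is_weak_deriv L \<alpha> f g"
proof -
  let ?n = "order_of \<alpha>"
  define c where "c i = (-1) ^ ?n * deriv_factor L \<alpha> (fst i) * fcoeff L f (flip ?n (fst i), snd i)" for i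
  have "(c i)\<^sup>2 = dweight L \<alpha> (flip ?n (fst i)) * (fcoeff L f (flip ?n (fst i), snd i))\<^sup>2" for i
    by (simp add: c_def power_mult_distrib deriv_factor_square flip: power_mult)
  then have "(\<lambda>i. (c i)\<^sup>2) summable_on UNIV"
    using has_sum_flip[of "\<lambda>i. dweight L \<alpha> (fst i) * (fcoeff L f i)\<^sup>2" ?n] summ
    by (simp add: summable_on_def)
  then obtain g where g: "g \<in> L2 L" "\<And>i. fcoeff L g i = c i"
    using riesz_fischer[OF L] by metis
  have "L2_inner L f (\<lambda>x. iter_pderivative \<alpha> \<phi> x *\<^sub>R axis d 1) = (-1) ^ ?n * L2_inner L g (\<lambda>x. \<phi> x *\<^sub>R axis d 1)"
    if \<phi>: "\<phi> \<in> torus_test L" for \<phi> d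
  proof -
    let ?a = "fcoeff L (\<lambda>x. \<phi> x *\<^sub>R axis d 1)"
    note \<phi>' = iter_pderivative_torus_test[OF \<phi>, of \<alpha>]
    have "fcoeff L (\<lambda>x. iter_pderivative \<alpha> \<phi> x *\<^sub>R axis d 1) i
        = (-1) ^ ?n * deriv_factor L \<alpha> (fst i) * ?a (flip ?n (fst i), snd i)" for i
      by (simp add: fcoeff_test_axis[OF L \<phi>'] fcoeff_test_axis[OF L \<phi>] integral_iter_pderivative[OF L \<phi>])
    then have 1: "((\<lambda>i. fcoeff L f i * ((-1) ^ ?n * deriv_factor L \<alpha> (fst i) * ?a (flip ?n (fst i), snd i)))
        has_sum L2_inner L f (\<lambda>x. iter_pderivative \<alpha> \<phi> x *\<^sub>R axis d 1)) UNIV"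
      using parseval_inner[OF L f test_axis_L2[OF \<phi>', of d]] by simp
    have "((\<lambda>i. c i * ?a i) has_sum L2_inner L g (\<lambda>x. \<phi> x *\<^sub>R axis d 1)) UNIV"
      using parseval_inner[OF L g(1) test_axis_L2[OF \<phi>, of d]] g(2) by simp
    then have "((\<lambda>i. c (flip ?n (fst i), snd i) * ?a (flip ?n (fst i), snd i)) has_sum L2_inner L g (\<lambda>x. \<phi> x *\<^sub>R axis d 1)) UNIV"
      using has_sum_flip[of "\<lambda>i. c i * ?a i" ?n] by simp
    from has_sum_cmult_right[OF this, of "(-1) ^ ?n"]
    have 2: "((\<lambda>i. (-1) ^ ?n * (c (flip ?n (fst i), snd i) * ?a (flip ?n (fst i), snd i)))
        has_sum (-1) ^ ?n * L2_inner L g (\<lambda>x. \<phi> x *\<^sub>R axis d 1)) UNIV" .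
    \<comment> \<open>Three signs (-1)^n meet: from the weak derivative, from c, and from reflecting
      the frequency in \<open>deriv_factor\<close>. Two of them cancel.\<close>
    have "(-1) ^ ?n * (c (flip ?n (fst i), snd i) * ?a (flip ?n (fst i), snd i))
        = fcoeff L f i * ((-1) ^ ?n * deriv_factor L \<alpha> (fst i) * ?a (flip ?n (fst i), snd i))" for i
      by (cases "even ?n") (simp_all add: c_def deriv_factor_flip mult_ac)
    with 1 2 show ?thesis using has_sum_unique by simp
  qed
  then show ?thesis using g(1) is_weak_deriv_iff[OF f g(1)] by blast
qed

section \<open>Sobolev norms as weighted sums of squared coefficients\<close>

definition sweight :: "real \<Rightarrow> nat \<Rightarrow> int \<times> int \<Rightarrow> real" where
  "sweight L s k = (\<Sum>\<alpha> | order_of \<alpha> \<le> s. dweight L \<alpha> k)"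

lemma finite_order_le: "finite {\<alpha>. order_of \<alpha> \<le> s}"
proof (rule finite_subset)
  show "{\<alpha>. order_of \<alpha> \<le> s} \<subseteq> (UNIV :: 2 set) \<rightarrow>\<^sub>E {..s}"
  proof
    fix \<alpha> :: multi_index assume "\<alpha> \<in> {\<alpha>. order_of \<alpha> \<le> s}"
    then have "\<alpha> 1 \<le> s" "\<alpha> 2 \<le> s" by (auto simp: order_of_eq)
    then have "\<alpha> j \<le> s" for j using exhaust_2[of j] by auto
    then show "\<alpha> \<in> (UNIV :: 2 set) \<rightarrow>\<^sub>E {..s}" by auto
  qed
  show "finite ((UNIV :: 2 set) \<rightarrow>\<^sub>E {..s})" by (intro finite_PiE) auto
qed

lemma sweight_nonneg [simp]: "0 \<le> sweight L s k"
  by (simp add: sweight_def sum_nonneg)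

lemma dweight_le_sweight: "order_of \<alpha> \<le> s \<Longrightarrow> dweight L \<alpha> k \<le> sweight L s k"
  unfolding sweight_def by (intro member_le_sum finite_order_le) auto

lemma weak_deriv_some:
  assumes "f \<in> sobolev L s" "order_of \<alpha> \<le> s"
  shows "weak_deriv L \<alpha> f \<in> L2 L" "is_weak_deriv L \<alpha> f (weak_deriv L \<alpha> f)"
proof -
  have "\<exists>g. g \<in> L2 L \<and> is_weak_deriv L \<alpha> f g" using assms by (auto simp: sobolev_def)
  from someI_ex[OF this] show "weak_deriv L \<alpha> f \<in> L2 L" "is_weak_deriv L \<alpha> f (weak_deriv L \<alpha> f)"
    by (simp_all add: weak_deriv_def)
qed

lemma sobolev_L2: "f \<in> sobolev L s \<Longrightarrow> f \<in> L2 L"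
  by (simp add: sobolev_def)

lemma has_sum_finite_sum:
  fixes f :: "'a \<Rightarrow> 'b \<Rightarrow> real"
  assumes "finite A" "\<And>a. a \<in> A \<Longrightarrow> (f a has_sum S a) X"
  shows "((\<lambda>x. \<Sum>a\<in>A. f a x) has_sum (\<Sum>a\<in>A. S a)) X"
  using assms by (induction A rule: finite_induct) (auto intro!: has_sum_add)

lemma sobolev_norm_has_sum:
  assumes "0 < L" "f \<in> sobolev L s"
  shows "((\<lambda>i. sweight L s (fst i) * (fcoeff L f i)\<^sup>2) has_sum (sobolev_norm L s f)\<^sup>2) UNIV"
proof -
  have "((\<lambda>i. \<Sum>\<alpha> | order_of \<alpha> \<le> s. dweight L \<alpha> (fst i) * (fcoeff L f i)\<^sup>2)
      has_sum (\<Sum>\<alpha> | order_of \<alpha> \<le> s. (L2_norm L (weak_deriv L \<alpha> f))\<^sup>2)) UNIV"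
    using assms weak_deriv_some[OF assms(2)] sobolev_L2[OF assms(2)]
    by (intro has_sum_finite_sum finite_order_le weak_deriv_has_sum) auto
  moreover have "(sobolev_norm L s f)\<^sup>2 = (\<Sum>\<alpha> | order_of \<alpha> \<le> s. (L2_norm L (weak_deriv L \<alpha> f))\<^sup>2)"
    unfolding sobolev_norm_def by (simp add: sum_nonneg)
  ultimately show ?thesis unfolding sweight_def by (simp only: sum_distrib_right)
qed

text \<open>From here on regularity is a question about coefficients only: no weak derivative has to
  be produced by hand, and the choice operator has disappeared.\<close>

lemma sobolev_iff:
  assumes L: "0 < L"
  shows "f \<in> sobolev L s \<longleftrightarrow> f \<in> L2 L \<and> (\<lambda>i. sweight L s (fst i) * (fcoeff L f i)\<^sup>2) summable_on UNIV"
proof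
  assume "f \<in> sobolev L s"
  then show "f \<in> L2 L \<and> (\<lambda>i. sweight L s (fst i) * (fcoeff L f i)\<^sup>2) summable_on UNIV"
    using sobolev_norm_has_sum[OF L] sobolev_L2 by (auto simp: summable_on_def)
next
  assume f: "f \<in> L2 L \<and> (\<lambda>i. sweight L s (fst i) * (fcoeff L f i)\<^sup>2) summable_on UNIV"
  have "\<exists>g\<in>L2 L. is_weak_deriv L \<alpha> f g" if "order_of \<alpha> \<le> s" for \<alpha>
  proof (rule weak_deriv_exists[OF L])
    show "(\<lambda>i. dweight L \<alpha> (fst i) * (fcoeff L f i)\<^sup>2) summable_on UNIV"
      by (rule summable_on_comparison_test[OF conjunct2[OF f]])
        (auto intro!: mult_right_mono dweight_le_sweight that)
  qed (use f in blast)
  with f show "f \<in> sobolev L s" by (simp add: sobolev_def)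
qed

lemma sobolev_norm_nonneg [simp]: "0 \<le> sobolev_norm L s f"
  by (simp add: sobolev_norm_def sum_nonneg)

lemma sobolev_diff:
  assumes L: "0 < L" and f: "f \<in> sobolev L s" and g: "g \<in> sobolev L s"
  shows "(\<lambda>x. f x - g x) \<in> sobolev L s"
proof -
  let ?h = "\<lambda>i. 2 * (sweight L s (fst i) * (fcoeff L f i)\<^sup>2) + 2 * (sweight L s (fst i) * (fcoeff L g i)\<^sup>2)"
  have "?h summable_on UNIV"
    using f g by (intro summable_on_add summable_on_cmult_right) (auto simp: sobolev_iff[OF L])
  then have "(\<lambda>i. sweight L s (fst i) * (fcoeff L (\<lambda>x. f x - g x) i)\<^sup>2) summable_on UNIV"
  proof (rule summable_on_comparison_test)
    fix i
    have "(fcoeff L f i - fcoeff L g i)\<^sup>2 \<le> 2 * (fcoeff L f i)\<^sup>2 + 2 * (fcoeff L g i)\<^sup>2"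
      using zero_le_power2[of "fcoeff L f i + fcoeff L g i"] unfolding power2_sum power2_diff by linarith
    then have "sweight L s (fst i) * (fcoeff L f i - fcoeff L g i)\<^sup>2 \<le> sweight L s (fst i) * (2 * (fcoeff L f i)\<^sup>2 + 2 * (fcoeff L g i)\<^sup>2)"
      by (rule mult_left_mono) simp
    then show "sweight L s (fst i) * (fcoeff L (\<lambda>x. f x - g x) i)\<^sup>2 \<le> ?h i"
      using f g by (simp add: fcoeff_diff[OF L] sobolev_L2 algebra_simps)
  qed simp
  then show ?thesis using f g by (simp add: sobolev_iff[OF L] L2_diff)
qed

lemma sobolev_scale:
  assumes L: "0 < L" and f: "f \<in> sobolev L s"
  shows "(\<lambda>x. c *\<^sub>R f x) \<in> sobolev L s" "sobolev_norm L s (\<lambda>x. c *\<^sub>R f x) = \<bar>c\<bar> * sobolev_norm L s f"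
proof -
  have h: "((\<lambda>i. sweight L s (fst i) * (fcoeff L (\<lambda>x. c *\<^sub>R f x) i)\<^sup>2) has_sum c\<^sup>2 * (sobolev_norm L s f)\<^sup>2) UNIV"
    using has_sum_cmult_right[OF sobolev_norm_has_sum[OF L f], of "c\<^sup>2"]
    by (simp add: fcoeff_scale power_mult_distrib mult_ac)
  then show cf: "(\<lambda>x. c *\<^sub>R f x) \<in> sobolev L s"
    using f by (auto simp: sobolev_iff[OF L] L2_scale summable_on_def)
  have "(sobolev_norm L s (\<lambda>x. c *\<^sub>R f x))\<^sup>2 = (\<bar>c\<bar> * sobolev_norm L s f)\<^sup>2"
    using has_sum_unique[OF sobolev_norm_has_sum[OF L cf] h] by (simp add: power_mult_distrib)
  then show "sobolev_norm L s (\<lambda>x. c *\<^sub>R f x) = \<bar>c\<bar> * sobolev_norm L s f"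
    by (rule power2_eq_imp_eq) auto
qed

lemma trig_sum_sobolev:
  assumes L: "0 < L" and F: "finite F"
  shows "trig_sum L F c \<in> sobolev L s"
  unfolding sobolev_iff[OF L]
proof
  show "trig_sum L F c \<in> L2 L" by (rule trig_sum_L2[OF L])
  have "(\<lambda>i. sweight L s (fst i) * (fcoeff L (trig_sum L F c) i)\<^sup>2) summable_on F" using F by simp
  then show "(\<lambda>i. sweight L s (fst i) * (fcoeff L (trig_sum L F c) i)\<^sup>2) summable_on UNIV"
    by (rule summable_on_cong_neutral[THEN iffD1, rotated -1]) (auto simp: fcoeff_trig_sum[OF L F])
qed

lemma trig_basis_sobolev: "0 < L \<Longrightarrow> trig_basis L i \<in> sobolev L s"
  using trig_sum_sobolev[of L "{i}" "\<lambda>_. 1" s] by (simp add: trig_sum_def[abs_def])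

section \<open>Comparison of Sobolev weights with powers of the eigenvalue\<close>

definition eigenvalue :: "real \<Rightarrow> int \<times> int \<Rightarrow> real" where
  "eigenvalue L k = (freq L k 1)\<^sup>2 + (freq L k 2)\<^sup>2"

lemma eigenvalue_nonneg [simp]: "0 \<le> eigenvalue L k"
  by (simp add: eigenvalue_def)

text \<open>Each summand is at most the eigenvalue to the power |\<alpha>|, and a power at most s is
  bounded by 1 (small eigenvalue) or by the top power (large eigenvalue).\<close>

lemma sweight_le: "sweight L s k \<le> card {\<alpha>. order_of \<alpha> \<le> s} * (1 + eigenvalue L k ^ s)"
proof -
  have "dweight L \<alpha> k \<le> 1 + eigenvalue L k ^ s" if "order_of \<alpha> \<le> s" for \<alpha>
  proof -
    have "dweight L \<alpha> k \<le> eigenvalue L k ^ \<alpha> 1 * eigenvalue L k ^ \<alpha> 2"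
      unfolding dweight_def by (intro mult_mono power_mono) (auto simp: eigenvalue_def)
    also have "\<dots> = eigenvalue L k ^ order_of \<alpha>" by (simp add: order_of_eq power_add)
    also have "\<dots> \<le> 1 + eigenvalue L k ^ s"
    proof (cases "eigenvalue L k \<le> 1")
      case True
      then have "eigenvalue L k ^ order_of \<alpha> \<le> 1" by (intro power_le_one) auto
      then show ?thesis by (simp add: add_increasing2)
    next
      case False
      then have "eigenvalue L k ^ order_of \<alpha> \<le> eigenvalue L k ^ s" using that by (intro power_increasing) auto
      then show ?thesis by simp
    qed
    finally show ?thesis .
  qed
  then show ?thesis
    unfolding sweight_def using sum_bounded_above[of "{\<alpha>. order_of \<alpha> \<le> s}" "\<lambda>\<alpha>. dweight L \<alpha> k"] by auto
qed

text \<open>Only the two pure derivatives of order m are used, together with (x + y)^m <= 2 (x^m +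
  y^m) for m = 1, 2. They are distinct multi-indices because m is nonzero.\<close>

lemma eigenvalue_le_sweight:
  assumes "m \<in> {1, 2}"
  shows "eigenvalue L k ^ m \<le> 2 * sweight L m k"
proof -
  let ?a = "\<lambda>j. (\<lambda>_. 0)(j := m) :: multi_index"
  have ne: "?a 1 \<noteq> ?a 2"
  proof
    assume "?a 1 = ?a 2"
    then have "?a 1 1 = ?a 2 1" by (rule fun_cong)
    then show False using assms by auto
  qed
  have "((freq L k 1)\<^sup>2) ^ m + ((freq L k 2)\<^sup>2) ^ m = (\<Sum>\<alpha>\<in>{?a 1, ?a 2}. dweight L \<alpha> k)"
    using ne by (simp add: dweight_def)
  also have "\<dots> \<le> sweight L m k"
    unfolding sweight_def by (intro sum_mono2 finite_order_le) (auto simp: order_of_eq)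
  finally have le: "((freq L k 1)\<^sup>2) ^ m + ((freq L k 2)\<^sup>2) ^ m \<le> sweight L m k" .
  have "eigenvalue L k ^ m \<le> 2 * (((freq L k 1)\<^sup>2) ^ m + ((freq L k 2)\<^sup>2) ^ m)"
  proof (cases "m = 1")
    case False
    with assms have "m = 2" by simp
    then show ?thesis
      using sum_squares_bound[of "(freq L k 1)\<^sup>2" "(freq L k 2)\<^sup>2"] by (simp add: eigenvalue_def power2_sum)
  qed (simp add: eigenvalue_def)
  also have "\<dots> \<le> 2 * sweight L m k" using le by (rule mult_left_mono) simp
  finally show ?thesis .
qed

lemma weak_laplacian_L2:
  assumes L: "0 < L" and f: "f \<in> sobolev L 2"
  shows "weak_laplacian L f \<in> L2 L" "fcoeff L (weak_laplacian L f) i = - eigenvalue L (fst i) * fcoeff L f i"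
proof -
  let ?a = "\<lambda>j. (\<lambda>_. 0)(j := 2) :: multi_index"
  have o: "order_of (?a j) = 2" for j using exhaust_2[of j] by (auto simp: order_of_eq)
  have w: "weak_deriv L (?a j) f \<in> L2 L" "is_weak_deriv L (?a j) f (weak_deriv L (?a j) f)" for j
    using weak_deriv_some[OF f, of "?a j"] o by auto
  have fc: "fcoeff L (weak_deriv L (?a j) f) i = - (freq L (fst i) j)\<^sup>2 * fcoeff L f i" for j
  proof -
    have "deriv_sign 2 = - 1" by (simp add: numeral_2_eq_2)
    then show ?thesis
      unfolding weak_deriv_fcoeff[OF L sobolev_L2[OF f] w] deriv_factor_def o
      using exhaust_2[of j] by (auto simp: flip_def)
  qed
  have eq: "weak_laplacian L f = (\<lambda>x. weak_deriv L (?a 1) f x + weak_deriv L (?a 2) f x)"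
    by (simp add: weak_laplacian_def sum_2)
  show "weak_laplacian L f \<in> L2 L" unfolding eq by (intro L2_add w)
  show "fcoeff L (weak_laplacian L f) i = - eigenvalue L (fst i) * fcoeff L f i"
    unfolding eq fcoeff_add[OF L w(1) w(1)] fc by (simp add: eigenvalue_def algebra_simps)
qed

lemma weak_partial_L2:
  assumes f: "f \<in> sobolev L 2"
  shows "weak_partial L j f \<in> L2 L" "L2_inner L (weak_partial L j f) (weak_partial L j f) \<le> (sobolev_norm L 2 f)\<^sup>2"
proof -
  let ?a = "(\<lambda>_. 0)(j := 1) :: multi_index"
  have o: "order_of ?a \<le> 2" using exhaust_2[of j] by (auto simp: order_of_eq)
  show "weak_partial L j f \<in> L2 L" unfolding weak_partial_def by (rule weak_deriv_some(1)[OF f o])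
  have "(L2_norm L (weak_deriv L ?a f))\<^sup>2 \<le> (\<Sum>\<alpha> | order_of \<alpha> \<le> 2. (L2_norm L (weak_deriv L \<alpha> f))\<^sup>2)"
  proof (rule member_le_sum)
    show "?a \<in> {\<alpha>. order_of \<alpha> \<le> 2}" using o by (simp only: mem_Collect_eq)
  qed (simp_all add: finite_order_le)
  then show "L2_inner L (weak_partial L j f) (weak_partial L j f) \<le> (sobolev_norm L 2 f)\<^sup>2"
    unfolding weak_partial_def sobolev_norm_def L2_norm_power2[symmetric] by (simp add: sum_nonneg del: fun_upd_apply)
qed

section \<open>Energy identity for a single mode and evaluation of functionals\<close>

text \<open>With g = a' the combination squared on the right is the forcing coefficient F. The
  weights 1 and \<mu>^m are treated separately; after eliminating g, each gap between the two sides
  is an explicit sum of nonnegative terms.\<close>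

lemma energy_integrand_bound:
  fixes a g \<mu> :: real
  assumes \<mu>: "0 \<le> \<mu>" and m: "m \<in> {1, 2::nat}"
  shows "2 * (1 + \<mu> ^ m) * (a * g) + (1 + \<mu> ^ (m + 2)) / 2 * a\<^sup>2
    \<le> 3 * (1 + \<mu>\<^sup>2) * a\<^sup>2 + 2 * (\<mu> * a - \<mu>\<^sup>2 * a - g)\<^sup>2"
proof -
  define F where "F = \<mu> * a - \<mu>\<^sup>2 * a - g"
  have g: "g = \<mu> * a - \<mu>\<^sup>2 * a - F" by (simp add: F_def)
  have low: "2 * (a * g) \<le> 3 / 2 * a\<^sup>2 + F\<^sup>2"
  proof -
    have "3 / 2 * a\<^sup>2 + F\<^sup>2 - 2 * (a * g) = (a + F)\<^sup>2 + 2 * a\<^sup>2 * (\<mu> - 1 / 2)\<^sup>2"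
      unfolding g by (simp add: power2_eq_square algebra_simps)
    moreover have "0 \<le> (a + F)\<^sup>2 + 2 * a\<^sup>2 * (\<mu> - 1 / 2)\<^sup>2" by simp
    ultimately show ?thesis by linarith
  qed
  have high: "2 * \<mu> ^ m * (a * g) + \<mu> ^ (m + 2) / 2 * a\<^sup>2 \<le> 3 * \<mu>\<^sup>2 * a\<^sup>2 + F\<^sup>2"
  proof (cases "m = 1")
    case True
    have "3 * \<mu>\<^sup>2 * a\<^sup>2 + F\<^sup>2 - (2 * \<mu> * (a * g) + \<mu> ^ 3 / 2 * a\<^sup>2) = (\<mu> * a + F)\<^sup>2 + 3 / 2 * \<mu> ^ 3 * a\<^sup>2"
      unfolding g by (simp add: power2_eq_square power3_eq_cube algebra_simps)
    moreover have "0 \<le> (\<mu> * a + F)\<^sup>2 + 3 / 2 * \<mu> ^ 3 * a\<^sup>2" using \<mu> by simp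
    ultimately have "2 * \<mu> * (a * g) + \<mu> ^ 3 / 2 * a\<^sup>2 \<le> 3 * \<mu>\<^sup>2 * a\<^sup>2 + F\<^sup>2" by linarith
    then show ?thesis using True by (simp add: numeral_3_eq_3)
  next
    case False
    then have m: "m = 2" using m by simp
    \<comment> \<open>Of the \<mu>^4 a^2 left to the dissipation, a full copy completes the square
      with F. The remaining half absorbs the destabilising 2 \<mu>^3 a^2 at the cost of 2 \<mu>^2
      a^2, leaving one \<mu>^2 a^2 to spare.\<close>
    have "3 * \<mu>\<^sup>2 * a\<^sup>2 + F\<^sup>2 - (2 * \<mu>\<^sup>2 * (a * g) + \<mu> ^ 4 / 2 * a\<^sup>2) = (\<mu>\<^sup>2 * a + F)\<^sup>2 + 1 / 2 * (\<mu> * a * (\<mu> - 2))\<^sup>2 + (\<mu> * a)\<^sup>2"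
      unfolding g by (simp add: power2_eq_square power4_eq_xxxx algebra_simps)
    moreover have "0 \<le> (\<mu>\<^sup>2 * a + F)\<^sup>2 + 1 / 2 * (\<mu> * a * (\<mu> - 2))\<^sup>2 + (\<mu> * a)\<^sup>2" by simp
    ultimately have "2 * \<mu>\<^sup>2 * (a * g) + \<mu> ^ 4 / 2 * a\<^sup>2 \<le> 3 * \<mu>\<^sup>2 * a\<^sup>2 + F\<^sup>2" by linarith
    then show ?thesis using m by simp
  qed
  have "2 * (1 + \<mu> ^ m) * (a * g) + (1 + \<mu> ^ (m + 2)) / 2 * a\<^sup>2
      = 2 * (a * g) + (2 * \<mu> ^ m * (a * g) + \<mu> ^ (m + 2) / 2 * a\<^sup>2) + a\<^sup>2 / 2"
    by (simp add: algebra_simps add_divide_distrib)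
  also have "\<dots> \<le> (3 / 2 * a\<^sup>2 + F\<^sup>2) + (3 * \<mu>\<^sup>2 * a\<^sup>2 + F\<^sup>2) + a\<^sup>2 / 2"
    using low high by linarith
  also have "\<dots> \<le> 3 * (1 + \<mu>\<^sup>2) * a\<^sup>2 + 2 * F\<^sup>2"
    using zero_le_power2[of a] by (simp add: algebra_simps)
  finally show ?thesis by (simp only: F_def)
qed

text \<open>The square rule, multiplied by the weight 1 + \<mu>^m, turns the increment of the energy
  into an integral of a g, to which the pointwise bound applies. No Gronwall argument is needed,
  since the right-hand side carries only the weight 1 + \<mu>^2.\<close>

lemma mode_energy:
  fixes a g :: "real \<Rightarrow> real"
  assumes a: "continuous_on {0..T} a" and g: "g absolutely_integrable_on {0..T}"
    and ag: "\<And>t. t \<in> {0..T} \<Longrightarrow> a t = a 0 + integral {0..t} g"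
    and \<mu>: "0 \<le> \<mu>" and m: "m \<in> {1, 2::nat}" and t: "t \<in> {0..T}"
    and F: "(\<lambda>r. (\<mu> * a r - \<mu>\<^sup>2 * a r - g r)\<^sup>2) integrable_on {0..T}"
  shows "(1 + \<mu> ^ m) * (a t)\<^sup>2 + integral {0..t} (\<lambda>r. (1 + \<mu> ^ (m + 2)) / 2 * (a r)\<^sup>2)
    \<le> (1 + \<mu> ^ m) * (a 0)\<^sup>2
      + integral {0..t} (\<lambda>r. 3 * (1 + \<mu>\<^sup>2) * (a r)\<^sup>2 + 2 * (\<mu> * a r - \<mu>\<^sup>2 * a r - g r)\<^sup>2)"
proof -
  have sub: "{0..t} \<subseteq> {0..T}" using t by auto
  have ai: "(\<lambda>r. c * (a r)\<^sup>2) integrable_on {0..t}" for c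
    by (intro integrable_continuous_real continuous_intros continuous_on_subset[OF a sub])
  have agi: "(\<lambda>r. a r * g r) integrable_on {0..t}"
    using square_of_indefinite_integral(1)[OF a g ag t] sub
    by (rule set_lebesgue_integral_eq_integral(1)[OF absolutely_integrable_on_subinterval])
  have Fi: "(\<lambda>r. 2 * (\<mu> * a r - \<mu>\<^sup>2 * a r - g r)\<^sup>2) integrable_on {0..t}"
    by (intro integrable_on_mult_right integrable_subinterval_real[OF F sub])
  have "(1 + \<mu> ^ m) * (a t)\<^sup>2 - (1 + \<mu> ^ m) * (a 0)\<^sup>2 = (1 + \<mu> ^ m) * (2 * integral {0..t} (\<lambda>r. a r * g r))"
    using square_of_indefinite_integral(2)[OF a g ag t] by (simp add: algebra_simps)
  also have "\<dots> = integral {0..t} (\<lambda>r. 2 * (1 + \<mu> ^ m) * (a r * g r))"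
    by (simp only: integral_mult_right)
  finally have "(1 + \<mu> ^ m) * (a t)\<^sup>2 - (1 + \<mu> ^ m) * (a 0)\<^sup>2
      + integral {0..t} (\<lambda>r. (1 + \<mu> ^ (m + 2)) / 2 * (a r)\<^sup>2)
    = integral {0..t} (\<lambda>r. 2 * (1 + \<mu> ^ m) * (a r * g r) + (1 + \<mu> ^ (m + 2)) / 2 * (a r)\<^sup>2)"
    by (simp only: Henstock_Kurzweil_Integration.integral_add[OF integrable_on_mult_right[OF agi] ai])
  also have "\<dots> \<le> integral {0..t} (\<lambda>r. 3 * (1 + \<mu>\<^sup>2) * (a r)\<^sup>2 + 2 * (\<mu> * a r - \<mu>\<^sup>2 * a r - g r)\<^sup>2)"
    by (rule integral_le[OF integrable_add[OF integrable_on_mult_right[OF agi] ai] integrable_add[OF ai Fi]])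
      (rule energy_integrand_bound[OF \<mu> m])
  finally show ?thesis by linarith
qed

section \<open>Functionals on H^2, the advection term, and measurability in time\<close>

lemma simple_in_measurable:
  fixes \<phi> :: "'v \<Rightarrow> real"
  assumes "simple_in T V s"
  shows "(\<lambda>t. indicator {0..T} t * \<phi> (s t)) \<in> borel_measurable lebesgue"
proof -
  have fin: "finite (s ` {0..T})" and ms: "\<And>y. {t\<in>{0..T}. s t = y} \<in> sets lebesgue"
    using assms by (auto simp: simple_in_def)
  have "(\<lambda>t. indicator {0..T} t * \<phi> (s t)) =
      (\<lambda>t. \<Sum>y\<in>s ` {0..T}. \<phi> y * indicator {t\<in>{0..T}. s t = y} t)"
  proof
    fix t
    show "indicator {0..T} t * \<phi> (s t) = (\<Sum>y\<in>s ` {0..T}. \<phi> y * indicator {t\<in>{0..T}. s t = y} t)"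
    proof (cases "t \<in> {0..T}")
      case True
      then have "(\<Sum>y\<in>s ` {0..T}. \<phi> y * indicator {t\<in>{0..T}. s t = y} t) = (\<Sum>y\<in>s ` {0..T}. if y = s t then \<phi> y else 0)"
        by (intro sum.cong) (auto simp: indicator_def)
      then show ?thesis using True fin by simp
    qed (auto simp: indicator_def)
  qed
  also have "\<dots> \<in> borel_measurable lebesgue"
    by (intro borel_measurable_sum borel_measurable_times borel_measurable_const borel_measurable_indicator ms)
  finally show ?thesis .
qed

text \<open>The norm is a real supremum, meaningful only once the set of values is known to be
  bounded; the constant from the definition of \<open>H_minus2\<close> ensures this.\<close>

lemma H_minus2_bound:
  assumes L: "0 < L" and l: "l \<in> H_minus2 L" and w: "w \<in> sobolev L 2"
  shows "\<bar>l w\<bar> \<le> H_minus2_norm L l * sobolev_norm L 2 w"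
proof -
  obtain C where C: "\<And>w. w \<in> sobolev L 2 \<Longrightarrow> \<bar>l w\<bar> \<le> C * sobolev_norm L 2 w"
    using l unfolding H_minus2_def by blast
  show ?thesis
  proof (cases "sobolev_norm L 2 w = 0")
    case True
    \<comment> \<open>A field of norm zero cannot be rescaled to the unit ball, but boundedness of l
      forces its value to be 0.\<close>
    then show ?thesis using C[OF w] by simp
  next
    case False
    then have pos: "0 < sobolev_norm L 2 w" using sobolev_norm_nonneg[of L 2 w] by linarith
    let ?v = "\<lambda>x. inverse (sobolev_norm L 2 w) *\<^sub>R w x"
    have v: "?v \<in> sobolev L 2" "sobolev_norm L 2 ?v \<le> 1"
      using sobolev_scale[OF L w, of "inverse (sobolev_norm L 2 w)"] pos by auto
    have "bdd_above ((\<lambda>w. \<bar>l w\<bar>) ` {w \<in> sobolev L 2. sobolev_norm L 2 w \<le> 1})"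
    proof (rule bdd_aboveI2)
      fix w assume "w \<in> {w \<in> sobolev L 2. sobolev_norm L 2 w \<le> 1}"
      then have w: "w \<in> sobolev L 2" "sobolev_norm L 2 w \<le> 1" by auto
      have "C * sobolev_norm L 2 w \<le> \<bar>C\<bar> * 1" by (intro mult_mono w) auto
      then show "\<bar>l w\<bar> \<le> \<bar>C\<bar>" using C[OF w(1)] by simp
    qed
    then have "\<bar>l ?v\<bar> \<le> H_minus2_norm L l"
      unfolding H_minus2_norm_def using v by (intro cSUP_upper) auto
    moreover have "l ?v = inverse (sobolev_norm L 2 w) * l w"
      using l w unfolding H_minus2_def by blast
    ultimately have "\<bar>l w\<bar> / sobolev_norm L 2 w \<le> H_minus2_norm L l"
      using pos by (simp add: abs_mult divide_inverse mult.commute)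
    then show ?thesis using pos by (simp only: pos_divide_le_eq)
  qed
qed

lemma H_minus2_diff:
  assumes "l1 \<in> H_minus2 L" "l2 \<in> H_minus2 L"
  shows "(\<lambda>w. l1 w - l2 w) \<in> H_minus2 L"
proof -
  obtain C1 C2 where C: "\<And>w. w \<in> sobolev L 2 \<Longrightarrow> \<bar>l1 w\<bar> \<le> C1 * sobolev_norm L 2 w"
    "\<And>w. w \<in> sobolev L 2 \<Longrightarrow> \<bar>l2 w\<bar> \<le> C2 * sobolev_norm L 2 w"
    using assms unfolding H_minus2_def by blast
  have "\<bar>l1 w - l2 w\<bar> \<le> (C1 + C2) * sobolev_norm L 2 w" if "w \<in> sobolev L 2" for w
    using C[OF that] abs_triangle_ineq4[of "l1 w" "l2 w"] by (simp add: distrib_right)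
  then have "\<exists>C. \<forall>w\<in>sobolev L 2. \<bar>l1 w - l2 w\<bar> \<le> C * sobolev_norm L 2 w" by blast
  then show ?thesis using assms unfolding H_minus2_def by (simp add: right_diff_distrib)
qed

text \<open>The bi-Laplacian is defined by moving one Laplacian onto the test field. For a basis
  field only one term of the Parseval sum survives.\<close>

lemma L2_inner_weak_laplacian_basis:
  assumes L: "0 < L" and f: "f \<in> L2 L"
  shows "L2_inner L f (weak_laplacian L (trig_basis L i)) = - eigenvalue L (fst i) * fcoeff L f i"
proof -
  note w = weak_laplacian_L2[OF L trig_basis_sobolev[OF L]]
  have fc: "fcoeff L (weak_laplacian L (trig_basis L i)) j = (if j = i then - eigenvalue L (fst i) else 0)" for j
    unfolding w(2) by (auto simp: fcoeff_def trig_basis_orthonormal[OF L])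
  have "((\<lambda>j. fcoeff L f j * fcoeff L (weak_laplacian L (trig_basis L i)) j) has_sum
      L2_inner L f (weak_laplacian L (trig_basis L i))) UNIV"
    by (rule parseval_inner[OF L f w(1)])
  moreover have "((\<lambda>j. fcoeff L f j * fcoeff L (weak_laplacian L (trig_basis L i)) j) has_sum
      (\<Sum>j\<in>{i}. fcoeff L f j * fcoeff L (weak_laplacian L (trig_basis L i)) j)) UNIV"
    by (rule has_sum_finite_neutralI[where B = "{i}"]) (auto simp: fc)
  ultimately have "L2_inner L f (weak_laplacian L (trig_basis L i)) = (\<Sum>j\<in>{i}. fcoeff L f j * fcoeff L (weak_laplacian L (trig_basis L i)) j)"
    by (rule has_sum_unique)
  then show ?thesis by (simp add: fc)
qed

text \<open>Boundedness of \<eta> makes the term linear in the gradient: squaring M|D_1 v| + M|D_2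
  v| costs a factor 2, and each first derivative is one summand of the H^2 norm, whence 4
  M^2.\<close>

lemma calmed_advection_L2:
  assumes \<eta>: "continuous_on UNIV \<eta>" and M: "\<And>y. norm (\<eta> y) \<le> M" and v: "v \<in> sobolev L 2"
  shows "calmed_advection L \<eta> v \<in> L2 L"
    "L2_inner L (calmed_advection L \<eta> v) (calmed_advection L \<eta> v) \<le> 4 * M\<^sup>2 * (sobolev_norm L 2 v)\<^sup>2"
proof -
  let ?N = "calmed_advection L \<eta> v"
  let ?D = "\<lambda>j. weak_partial L j v"
  note D = weak_partial_L2[OF v]
  note [measurable] = L2_D(1)[OF D(1)] L2_D(1)[OF sobolev_L2[OF v]] borel_measurable_continuous_onI[OF \<eta>]
  have Neq: "?N x = \<eta> (v x) $ 1 *\<^sub>R ?D 1 x + \<eta> (v x) $ 2 *\<^sub>R ?D 2 x" for x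
    by (simp add: calmed_advection_def sum_2)
  have [measurable]: "?N \<in> borel_measurable borel"
    unfolding Neq[abs_def] cart_eq_inner_axis[of "\<eta> _"] by measurable
  have bound: "(norm (?N x))\<^sup>2 \<le> 2 * M\<^sup>2 * ((norm (?D 1 x))\<^sup>2 + (norm (?D 2 x))\<^sup>2)" for x
  proof -
    have \<eta>M: "\<bar>\<eta> y $ j\<bar> \<le> M" for y j using component_le_norm_cart[of "\<eta> y" j] M[of y] by linarith
    have "norm (?N x) \<le> M * norm (?D 1 x) + M * norm (?D 2 x)"
      unfolding Neq using norm_triangle_ineq[of "\<eta> (v x) $ 1 *\<^sub>R ?D 1 x" "\<eta> (v x) $ 2 *\<^sub>R ?D 2 x"]
        mult_right_mono[OF \<eta>M[of "v x" 1] norm_ge_zero[of "?D 1 x"]]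
        mult_right_mono[OF \<eta>M[of "v x" 2] norm_ge_zero[of "?D 2 x"]] by simp
    then have "(norm (?N x))\<^sup>2 \<le> (M * norm (?D 1 x) + M * norm (?D 2 x))\<^sup>2"
      by (intro power_mono) auto
    also have "\<dots> \<le> 2 * M\<^sup>2 * ((norm (?D 1 x))\<^sup>2 + (norm (?D 2 x))\<^sup>2)"
      using zero_le_power2[of "M * norm (?D 1 x) - M * norm (?D 2 x)"]
      by (simp add: power2_diff power2_sum power_mult_distrib algebra_simps)
    finally show ?thesis .
  qed
  have int: "set_integrable lborel (cell L) (\<lambda>x. (norm (?N x))\<^sup>2)"
    by (rule L2_bound_integrable[OF D(1)[of 1] D(1)[of 2]]) (use bound in auto)
  have "torus_periodic L ?N"
    using L2_D(2)[OF D(1)] L2_D(2)[OF sobolev_L2[OF v]] by (simp add: torus_periodic_def Neq)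
  with int show "?N \<in> L2 L" by (simp add: L2_def)
  have "L2_inner L ?N ?N \<le> (LINT x:cell L|lborel. 2 * M\<^sup>2 * ((norm (?D 1 x))\<^sup>2 + (norm (?D 2 x))\<^sup>2))"
    unfolding L2_inner_self
    by (rule set_integral_mono[OF int])
      (auto intro!: bound set_integrable_mult_right set_integral_add(1) L2_D(3)[OF D(1)])
  also have "\<dots> = 2 * M\<^sup>2 * (L2_inner L (?D 1) (?D 1) + L2_inner L (?D 2) (?D 2))"
    unfolding L2_inner_self
    by (subst set_integral_mult_right, subst set_integral_add(2)) (auto intro: L2_D(3)[OF D(1)])
  also have "\<dots> \<le> 2 * M\<^sup>2 * ((sobolev_norm L 2 v)\<^sup>2 + (sobolev_norm L 2 v)\<^sup>2)"
    by (intro mult_left_mono add_mono D(2)) auto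
  finally show "L2_inner L ?N ?N \<le> 4 * M\<^sup>2 * (sobolev_norm L 2 v)\<^sup>2" by simp
qed

lemma AE_lim_measurable:
  fixes f :: "nat \<Rightarrow> real \<Rightarrow> real"
  assumes f[measurable]: "\<And>n. f n \<in> borel_measurable lebesgue"
    and lim: "AE t in lebesgue. (\<lambda>n. f n t) \<longlonglongrightarrow> h t"
  shows "h \<in> borel_measurable lebesgue"
proof (rule borel_measurable_AE)
  show "(\<lambda>t. lim (\<lambda>n. f n t)) \<in> borel_measurable lebesgue" by measurable
  show "AE t in lebesgue. lim (\<lambda>n. f n t) = h t" using lim by eventually_elim (rule limI)
qed

text \<open>Evaluation at a fixed w is continuous in the dual norm, so Bochner measurability
  descends to the scalar function; square integrability gives integrability because the interval has
  finite length.\<close>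

lemma H_minus2_evaluation_integrable:
  assumes L: "0 < L" and g: "g \<in> L2_time T (H_minus2 L) (H_minus2_norm L)" and w: "w \<in> sobolev L 2"
  shows "(\<lambda>t. g t w) absolutely_integrable_on {0..T}"
proof -
  from g obtain s where s: "\<And>n. simple_in T (H_minus2 L) (s n)"
    and lim: "AE t in lebesgue. t \<in> {0..T} \<longrightarrow> g t \<in> H_minus2 L \<and> (\<lambda>n. H_minus2_norm L (\<lambda>x. s n t x - g t x)) \<longlonglongrightarrow> 0"
    and int: "set_integrable lebesgue {0..T} (\<lambda>t. (H_minus2_norm L (g t))\<^sup>2)"
    unfolding L2_time_def strongly_measurable_def by blast
  have "AE t in lebesgue. (\<lambda>n. indicator {0..T} t * s n t w) \<longlonglongrightarrow> indicator {0..T} t * g t w"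
    using lim
  proof eventually_elim
    case (elim t)
    show ?case
    proof (cases "t \<in> {0..T}")
      case True
      with elim have gt: "g t \<in> H_minus2 L" and l: "(\<lambda>n. H_minus2_norm L (\<lambda>x. s n t x - g t x)) \<longlonglongrightarrow> 0" by auto
      have "s n t \<in> H_minus2 L" for n using s[of n] True by (auto simp: simple_in_def)
      then have "\<bar>s n t w - g t w\<bar> \<le> H_minus2_norm L (\<lambda>x. s n t x - g t x) * sobolev_norm L 2 w" for n
        by (intro H_minus2_bound[OF L _ w] H_minus2_diff gt)
      then have "(\<lambda>n. s n t w - g t w) \<longlonglongrightarrow> 0"
        by (intro Lim_null_comparison[OF _ tendsto_mult_left_zero[OF l]] always_eventually) auto
      then have "(\<lambda>n. s n t w) \<longlonglongrightarrow> g t w" by (simp add: LIM_zero_iff)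
      then show ?thesis by (intro tendsto_mult tendsto_const)
    qed simp
  qed
  then have meas: "(\<lambda>t. indicator {0..T} t * g t w) \<in> borel_measurable lebesgue"
    by (rule AE_lim_measurable[rotated]) (rule simple_in_measurable[OF s, of "\<lambda>l. l w"])
  show ?thesis
  proof (rule set_integrable_bound)
    have "set_integrable lebesgue {0..T} (\<lambda>t. 1::real)"
      by (intro absolutely_integrable_continuous_real continuous_intros)
    with int show "set_integrable lebesgue {0..T} (\<lambda>t. ((H_minus2_norm L (g t))\<^sup>2 + 1) * sobolev_norm L 2 w)"
      by (intro set_integrable_mult_left set_integral_add)
    show "set_borel_measurable lebesgue {0..T} (\<lambda>t. g t w)"
      using meas by (simp add: set_borel_measurable_def)
    show "AE t in lebesgue. t \<in> {0..T} \<longrightarrow> norm (g t w) \<le> norm (((H_minus2_norm L (g t))\<^sup>2 + 1) * sobolev_norm L 2 w)"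
      using lim
    proof eventually_elim
      case (elim t)
      show ?case
      proof
        assume "t \<in> {0..T}"
        with elim have "\<bar>g t w\<bar> \<le> H_minus2_norm L (g t) * sobolev_norm L 2 w"
          by (intro H_minus2_bound[OF L _ w]) auto
        also have "\<dots> \<le> ((H_minus2_norm L (g t))\<^sup>2 + 1) * sobolev_norm L 2 w"
        proof (rule mult_right_mono)
          have "0 \<le> (H_minus2_norm L (g t) - 1 / 2)\<^sup>2" by simp
          then show "H_minus2_norm L (g t) \<le> (H_minus2_norm L (g t))\<^sup>2 + 1"
            unfolding power2_diff by (simp add: power2_eq_square)
        qed simp
        finally show "norm (g t w) \<le> norm (((H_minus2_norm L (g t))\<^sup>2 + 1) * sobolev_norm L 2 w)"
          by simp
      qed
    qed
  qed
qed

text \<open>Simple functions with values in trigonometric polynomials: truncate to finitely many modes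
  and freeze the coefficients on a fine time grid.\<close>

lemma strongly_measurable_of_fcoeff:
  fixes X :: "nat \<Rightarrow> ((int \<times> int) \<times> 2) set"
  assumes L: "0 < L" and T: "0 < T"
    and cont: "\<And>i. continuous_on {0..T} (\<lambda>t. fcoeff L (u t) i)"
    and u: "AE t in lebesgue. t \<in> {0..T} \<longrightarrow> u t \<in> sobolev L s"
    and X: "\<And>n. finite (X n)" "\<And>Y. finite Y \<Longrightarrow> \<forall>\<^sub>F n in sequentially. Y \<subseteq> X n"
  shows "strongly_measurable T (sobolev L s) (sobolev_norm L s) u"
proof -
  \<comment> \<open>The nearest point of the grid T k / N at or to the left of t.\<close>
  define d where "d N t = T * of_int \<lfloor>of_nat N * t / T\<rfloor> / of_nat N" for N :: nat and t
  have d: "d N t \<in> {0..T}" "\<bar>d N t - t\<bar> \<le> T / N" if "0 < N" "t \<in> {0..T}" for N t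
  proof -
    let ?z = "of_nat N * t / T" and ?f = "real_of_int \<lfloor>of_nat N * t / T\<rfloor>"
    have fl: "?f \<le> ?z" "?z < ?f + 1" by linarith+
    have "0 \<le> ?z" using that T by simp
    then have "0 \<le> ?f" by simp
    moreover have "?z \<le> N" using that T by (simp add: field_simps)
    ultimately have "0 \<le> ?f" "?f \<le> N" using fl by linarith+
    then show "d N t \<in> {0..T}" using that T by (auto simp: d_def field_simps mult_right_mono)
    have "T * ?z / N = t" using that T by simp
    then have "d N t - t = T * ?f / N - T * ?z / N" by (simp only: d_def)
    also have "T * p / N - T * q / N = (p - q) * (T / N)" for p q :: real
      by (simp add: algebra_simps diff_divide_distrib)
    finally have "d N t - t = (?f - ?z) * (T / N)" .
    moreover have "\<bar>?f - ?z\<bar> \<le> 1" using fl by linarith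
    then have "\<bar>?f - ?z\<bar> * (T / N) \<le> 1 * (T / N)" using T by (intro mult_right_mono) auto
    ultimately show "\<bar>d N t - t\<bar> \<le> T / N" using T by (simp add: abs_mult)
  qed
  \<comment> \<open>One grid serves all modes in the finite set \<open>X n\<close>. The tolerance is
    divided by their number, so that the weighted errors add up to at most 1 / (n + 1).\<close>
  have "\<exists>N>0. \<forall>i\<in>X n. \<forall>t\<in>{0..T}.
      sweight L s (fst i) * (fcoeff L (u (d N t)) i - fcoeff L (u t) i)\<^sup>2 \<le> 1 / ((real (card (X n)) + 1) * (real n + 1))" for n :: nat
  proof -
    let ?e = "1 / ((real (card (X n)) + 1) * (real n + 1)) :: real"
    have "\<exists>\<delta>>0. \<forall>r\<in>{0..T}. \<forall>t\<in>{0..T}. \<bar>r - t\<bar> < \<delta> \<longrightarrow>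
        sweight L s (fst i) * (fcoeff L (u r) i - fcoeff L (u t) i)\<^sup>2 \<le> ?e" for i
    proof -
      define e where "e = sqrt (?e / (sweight L s (fst i) + 1))"
      have e: "0 < e" unfolding e_def by (intro real_sqrt_gt_zero divide_pos_pos) (auto simp: add_nonneg_pos)
      obtain \<delta> where \<delta>: "\<delta> > 0" "\<And>r t. r \<in> {0..T} \<Longrightarrow> t \<in> {0..T} \<Longrightarrow> dist r t < \<delta> \<Longrightarrow> dist (fcoeff L (u r) i) (fcoeff L (u t) i) < e"
        using compact_uniformly_continuous[OF cont[of i] compact_Icc] e
        unfolding uniformly_continuous_on_def by metis
      have "sweight L s (fst i) * (fcoeff L (u r) i - fcoeff L (u t) i)\<^sup>2 \<le> ?e"
        if "r \<in> {0..T}" "t \<in> {0..T}" "\<bar>r - t\<bar> < \<delta>" for r t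
      proof -
        have "\<bar>fcoeff L (u r) i - fcoeff L (u t) i\<bar> \<le> e" using \<delta>(2)[of r t] that by (simp add: dist_real_def)
        then have "\<bar>fcoeff L (u r) i - fcoeff L (u t) i\<bar>\<^sup>2 \<le> e\<^sup>2" by (intro power_mono) auto
        then have "(fcoeff L (u r) i - fcoeff L (u t) i)\<^sup>2 \<le> e\<^sup>2" by simp
        then have "sweight L s (fst i) * (fcoeff L (u r) i - fcoeff L (u t) i)\<^sup>2 \<le> (sweight L s (fst i) + 1) * e\<^sup>2"
          by (intro mult_mono) auto
        also have "\<dots> = ?e"
          unfolding e_def using sweight_nonneg[of L s "fst i"] by (simp add: add_nonneg_eq_0_iff)
        finally show ?thesis .
      qed
      with \<delta>(1) show ?thesis by blast
    qed
    then obtain \<delta> where \<delta>: "\<And>i. \<delta> i > 0" "\<And>i r t. r \<in> {0..T} \<Longrightarrow> t \<in> {0..T} \<Longrightarrow> \<bar>r - t\<bar> < \<delta> i \<Longrightarrow>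
        sweight L s (fst i) * (fcoeff L (u r) i - fcoeff L (u t) i)\<^sup>2 \<le> ?e"
      by metis
    define D where "D = Min (insert 1 (\<delta> ` X n))"
    have D: "D > 0" "\<And>i. i \<in> X n \<Longrightarrow> D \<le> \<delta> i" using \<delta>(1) X(1) by (auto simp: D_def)
    obtain N :: nat where N: "T / D < N" using reals_Archimedean2 by blast
    have "0 < real N" using N T D(1) by (smt (verit) divide_pos_pos)
    then have N0: "0 < N" and ND: "T / N < D" using N D(1) by (auto simp: field_simps)
    have "sweight L s (fst i) * (fcoeff L (u (d N t)) i - fcoeff L (u t) i)\<^sup>2 \<le> ?e" if "i \<in> X n" "t \<in> {0..T}" for i t
      using d[OF N0 that(2)] ND D(2)[OF that(1)] by (intro \<delta>(2) that(2)) auto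
    with N0 show ?thesis by blast
  qed
  then obtain N where N: "\<And>n. 0 < N n" "\<And>n i t. i \<in> X n \<Longrightarrow> t \<in> {0..T} \<Longrightarrow>
      sweight L s (fst i) * (fcoeff L (u (d (N n) t)) i - fcoeff L (u t) i)\<^sup>2 \<le> 1 / ((real (card (X n)) + 1) * (real n + 1))"
    by metis
  define S where "S n t = trig_sum L (X n) (\<lambda>i. fcoeff L (u (d (N n) t)) i)" for n t
  have S: "S n t \<in> sobolev L s" for n t unfolding S_def by (rule trig_sum_sobolev[OF L X(1)])
  have "simple_in T (sobolev L s) (S n)" for n
    unfolding simple_in_def
  proof (intro conjI allI)
    \<comment> \<open>The approximant depends on t only through the integer part of N t / T, so its
      range is finite and its level sets are finite unions of preimages under the floor
      function.\<close>
    define h where "h k = trig_sum L (X n) (\<lambda>i. fcoeff L (u (T * of_int k / of_nat (N n))) i)" for k :: int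
    have Sh: "S n t = h \<lfloor>of_nat (N n) * t / T\<rfloor>" for t by (simp add: S_def h_def d_def)
    have k: "\<lfloor>of_nat (N n) * t / T\<rfloor> \<in> {0..int (N n)}" if "t \<in> {0..T}" for t
    proof -
      have "0 \<le> of_nat (N n) * t / T" "of_nat (N n) * t / T \<le> N n" using that T by (auto simp: field_simps intro!: mult_right_mono)
      then show ?thesis by (auto simp: floor_le_iff le_floor_iff)
    qed
    have "S n ` {0..T} \<subseteq> h ` {0..int (N n)}" using k by (force simp: Sh)
    then show "finite (S n ` {0..T})" by (rule finite_subset) simp
    show "S n ` {0..T} \<subseteq> sobolev L s" using S by auto
    fix y
    have "{t \<in> {0..T}. S n t = y} =
        {0..T} \<inter> (\<Union>k\<in>{0..int (N n)} \<inter> {k. h k = y}. {t. \<lfloor>of_nat (N n) * t / T\<rfloor> = k})"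
      unfolding Sh using k by blast
    also have "\<dots> \<in> sets borel"
      unfolding floor_eq_iff by (intro sets.Int sets.finite_UN) auto
    finally show "{t \<in> {0..T}. S n t = y} \<in> sets lebesgue" by (simp add: sets_completionI_sets)
  qed
  moreover have "AE t in lebesgue. t \<in> {0..T} \<longrightarrow> u t \<in> sobolev L s \<and> (\<lambda>n. sobolev_norm L s (\<lambda>x. S n t x - u t x)) \<longlonglongrightarrow> 0"
    using u
  proof eventually_elim
    case (elim t)
    show ?case
    proof
      assume t: "t \<in> {0..T}"
      with elim have ut: "u t \<in> sobolev L s" by blast
      define w where "w i = sweight L s (fst i) * (fcoeff L (u t) i)\<^sup>2" for i
      define W where "W = (sobolev_norm L s (u t))\<^sup>2"
      have hs: "(w has_sum W) UNIV" unfolding w_def W_def by (rule sobolev_norm_has_sum[OF L ut])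
      have "(\<lambda>n. \<Sum>i\<in>X n. w i) \<longlonglongrightarrow> W"
        using hs unfolding has_sum_def
      proof (rule filterlim_compose)
        show "filterlim X (finite_subsets_at_top UNIV) sequentially"
          unfolding filterlim_finite_subsets_at_top using X by (auto elim: eventually_mono)
      qed
      then have lim: "(\<lambda>n. W - (\<Sum>i\<in>X n. w i) + 1 / Suc n) \<longlonglongrightarrow> W - W + 0"
        by (intro tendsto_intros LIMSEQ_Suc[OF lim_1_over_n])
      \<comment> \<open>The squared distance has two parts: the remainder of the norm outside
        \<open>X n\<close>, and the freezing error inside it.\<close>
      have le: "(sobolev_norm L s (\<lambda>x. S n t x - u t x))\<^sup>2 \<le> W - (\<Sum>i\<in>X n. w i) + 1 / Suc n" for n
      proof -
        define c where "c i = sweight L s (fst i) * (fcoeff L (u (d (N n) t)) i - fcoeff L (u t) i)\<^sup>2" for i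
        have "((\<lambda>i. if i \<in> X n then c i - w i else 0) has_sum (\<Sum>i\<in>X n. if i \<in> X n then c i - w i else 0)) UNIV"
          by (rule has_sum_finite_neutralI[OF X(1)]) auto
        from has_sum_add[OF hs this]
        have h: "((\<lambda>i. if i \<in> X n then c i else w i) has_sum (W + (\<Sum>i\<in>X n. c i - w i))) UNIV"
          by (simp add: if_distrib cong: if_cong)
        have eq: "(\<lambda>i. if i \<in> X n then c i else w i) =
            (\<lambda>i. sweight L s (fst i) * (fcoeff L (\<lambda>x. S n t x - u t x) i)\<^sup>2)"
          unfolding fcoeff_diff[OF L sobolev_L2[OF S] sobolev_L2[OF ut]] c_def w_def
          by (auto simp: fun_eq_iff S_def fcoeff_trig_sum[OF L X(1)])
        have "(sobolev_norm L s (\<lambda>x. S n t x - u t x))\<^sup>2 = W + (\<Sum>i\<in>X n. c i - w i)"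
          by (rule has_sum_unique[OF sobolev_norm_has_sum[OF L sobolev_diff[OF L S ut]] h[unfolded eq]])
        moreover have "(\<Sum>i\<in>X n. c i) \<le> card (X n) * (1 / ((real (card (X n)) + 1) * (real n + 1)))"
          unfolding c_def by (rule sum_bounded_above[OF N(2)[OF _ t]])
        moreover have "card (X n) * (1 / ((real (card (X n)) + 1) * (real n + 1))) \<le> 1 / Suc n"
        proof -
          have "real (card (X n)) / (real (card (X n)) + 1) * (1 / Suc n) \<le> 1 * (1 / Suc n)"
            by (rule mult_right_mono) simp_all
          then show ?thesis by (simp add: add.commute)
        qed
        ultimately show ?thesis by (simp add: sum_subtractf)
      qed
      have "(\<lambda>n. (sobolev_norm L s (\<lambda>x. S n t x - u t x))\<^sup>2) \<longlonglongrightarrow> 0"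
        by (rule tendsto_sandwich[OF _ _ tendsto_const lim[simplified]]) (use le in \<open>auto intro!: always_eventually\<close>)
      then have "(\<lambda>n. sqrt ((sobolev_norm L s (\<lambda>x. S n t x - u t x))\<^sup>2)) \<longlonglongrightarrow> sqrt 0" by (rule tendsto_real_sqrt)
      with ut show "u t \<in> sobolev L s \<and> (\<lambda>n. sobolev_norm L s (\<lambda>x. S n t x - u t x)) \<longlonglongrightarrow> 0" by simp
    qed
  qed
  ultimately show ?thesis unfolding strongly_measurable_def by blast
qed

section \<open>Regularity of weak solutions\<close>

text \<open>Monotone convergence: the supremum has finite integral, hence is finite almost
  everywhere, and a bounded increasing sequence converges.\<close>

lemma AE_sum_limit_integrable:
  fixes f :: "nat \<Rightarrow> real \<Rightarrow> real"
  assumes f: "\<And>n. continuous_on {0..T} (f n)" and nonneg: "\<And>n t. 0 \<le> f n t"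
    and mono: "\<And>n t. f n t \<le> f (Suc n) t" and bound: "\<And>n. integral {0..T} (f n) \<le> K"
  shows "AE t in lebesgue. t \<in> {0..T} \<longrightarrow> convergent (\<lambda>n. f n t)"
    "set_integrable lebesgue {0..T} (\<lambda>t. lim (\<lambda>n. f n t))"
proof -
  have fi: "f n absolutely_integrable_on {0..T}" for n
    by (rule absolutely_integrable_continuous_real[OF f])
  define h where "h n t = indicator {0..T} t * f n t" for n t
  have hi: "integrable lebesgue (h n)" for n
    using fi[of n] by (simp add: set_integrable_def h_def[abs_def])
  then have hm[measurable]: "h n \<in> borel_measurable lebesgue" for n by (rule borel_measurable_integrable)
  have h0: "0 \<le> h n t" for n t by (simp add: h_def nonneg)
  have hnn: "(\<integral>\<^sup>+t. ennreal (h n t) \<partial>lebesgue) \<le> ennreal K" for n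
  proof -
    have "(\<integral>\<^sup>+t. ennreal (h n t) \<partial>lebesgue) = ennreal (\<integral>t. h n t \<partial>lebesgue)"
      by (rule nn_integral_eq_integral[OF hi]) (simp add: h0)
    also have "(\<integral>t. h n t \<partial>lebesgue) = integral {0..T} (f n)"
      using set_lebesgue_integral_eq_integral(2)[OF fi[of n]] by (simp add: set_lebesgue_integral_def h_def)
    finally show ?thesis using bound[of n] by (simp add: ennreal_leI)
  qed
  have inc: "incseq (\<lambda>n t. ennreal (h n t))"
    by (rule incseq_SucI) (auto simp: le_fun_def h_def indicator_def intro!: ennreal_leI mono)
  have "(\<integral>\<^sup>+t. (SUP n. ennreal (h n t)) \<partial>lebesgue) = (SUP n. \<integral>\<^sup>+t. ennreal (h n t) \<partial>lebesgue)"
    by (rule nn_integral_monotone_convergence_SUP[OF inc]) measurable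
  also have "\<dots> \<le> ennreal K" by (rule SUP_least) (rule hnn)
  finally have supK: "(\<integral>\<^sup>+t. (SUP n. ennreal (h n t)) \<partial>lebesgue) \<le> ennreal K" .
  then have "AE t in lebesgue. (SUP n. ennreal (h n t)) \<noteq> \<infinity>"
    by (intro nn_integral_PInf_AE) (auto simp: top_unique)
  then have conv: "AE t in lebesgue. convergent (\<lambda>n. h n t)"
  proof eventually_elim
    case (elim t)
    then obtain B where B: "0 \<le> B" "(SUP n. ennreal (h n t)) = ennreal B"
      by (cases "SUP n. ennreal (h n t)" rule: ennreal_cases) auto
    have "h n t \<le> B" for n
      using SUP_upper[of n UNIV "\<lambda>n. ennreal (h n t)"] B by (simp add: ennreal_le_iff)
    then have "Bseq (\<lambda>n. h n t)" using h0 by (intro BseqI'[of _ B]) auto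
    moreover have "incseq (\<lambda>n. h n t)" by (rule incseq_SucI) (auto simp: h_def indicator_def mono)
    ultimately show ?case by (intro Bseq_monoseq_convergent) (auto simp: monoseq_iff)
  qed
  then show "AE t in lebesgue. t \<in> {0..T} \<longrightarrow> convergent (\<lambda>n. f n t)"
    by eventually_elim (auto simp: h_def)
  have lim: "indicator {0..T} t *\<^sub>R lim (\<lambda>n. f n t) = lim (\<lambda>n. h n t)" for t
    by (cases "t \<in> {0..T}") (simp_all add: h_def)
  have "integrable lebesgue (\<lambda>t. lim (\<lambda>n. h n t))"
  proof (rule integrableI_nonneg)
    have conv': "AE t in lebesgue. (\<lambda>n. h n t) \<longlonglongrightarrow> lim (\<lambda>n. h n t)"
      using conv by eventually_elim (simp add: convergent_LIMSEQ_iff)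
    then show "AE t in lebesgue. 0 \<le> lim (\<lambda>n. h n t)"
      by eventually_elim (rule LIMSEQ_le_const, assumption, use h0 in blast)
    have "(\<integral>\<^sup>+t. ennreal (lim (\<lambda>n. h n t)) \<partial>lebesgue) \<le> (\<integral>\<^sup>+t. (SUP n. ennreal (h n t)) \<partial>lebesgue)"
    proof (rule nn_integral_mono_AE)
      show "AE t in lebesgue. ennreal (lim (\<lambda>n. h n t)) \<le> (SUP n. ennreal (h n t))"
        using conv'
      proof eventually_elim
        case (elim t)
        show ?case
            by (rule LIMSEQ_le_const2[OF tendsto_ennrealI[OF elim]]) (intro exI[of _ 0] allI impI SUP_upper UNIV_I)
      qed
    qed
    also note supK
    finally show "(\<integral>\<^sup>+t. ennreal (lim (\<lambda>n. h n t)) \<partial>lebesgue) < \<infinity>" by (simp add: le_less_trans)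
  qed measurable
  then show "set_integrable lebesgue {0..T} (\<lambda>t. lim (\<lambda>n. f n t))"
    unfolding set_integrable_def lim .
qed

text \<open>An increasing exhaustion of the index set by finite sets. It replaces unordered sums by
  sequential limits, as monotone convergence and simple approximation require.\<close>

definition mode_box :: "nat \<Rightarrow> ((int \<times> int) \<times> 2) set" where
  "mode_box n = ({- int n..int n} \<times> {- int n..int n}) \<times> UNIV"

lemma finite_mode_box: "finite (mode_box n)"
  by (simp add: mode_box_def)

lemma mode_box_mono: "m \<le> n \<Longrightarrow> mode_box m \<subseteq> mode_box n"
  by (auto simp: mode_box_def)

lemma mode_box_exhausts:
  assumes "finite Y"
  shows "\<forall>\<^sub>F n in sequentially. Y \<subseteq> mode_box n"
proof -
  have "\<forall>\<^sub>F n in sequentially. y \<in> mode_box n" for y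
    unfolding eventually_at_top_linorder mode_box_def
    by (rule exI[of _ "nat (max \<bar>fst (fst y)\<bar> \<bar>snd (fst y)\<bar>)"], cases y) (auto simp: abs_le_iff)
  then have "\<forall>\<^sub>F n in sequentially. \<forall>y\<in>Y. y \<in> mode_box n" using assms by (simp add: eventually_ball_finite)
  then show ?thesis by eventually_elim auto
qed

lemma has_sum_mode_box: "(f has_sum S) UNIV \<Longrightarrow> (\<lambda>n. \<Sum>i\<in>mode_box n. f i) \<longlonglongrightarrow> S"
  unfolding has_sum_def
  by (erule filterlim_compose)
    (auto simp: filterlim_finite_subsets_at_top finite_mode_box intro: eventually_mono[OF mode_box_exhausts])

section \<open>Fourier coefficients and energy estimates of a weak solution\<close>

locale calmed_KS =
  fixes L T :: real and \<eta> :: "real^2 \<Rightarrow> real^2" and M :: real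
    and u0 :: "real^2 \<Rightarrow> real^2" and u :: "real \<Rightarrow> real^2 \<Rightarrow> real^2"
  assumes L: "0 < L" and T: "0 < T" and \<eta>_cont: "continuous_on UNIV \<eta>" and \<eta>_bound: "\<And>y. norm (\<eta> y) \<le> M"
    and sol: "calmed_KS_weak_solution L \<eta> T u0 u"
begin

definition amplitude :: "(int \<times> int) \<times> 2 \<Rightarrow> real \<Rightarrow> real" where
  "amplitude i t = fcoeff L (u t) i"

lemma u_L2: "t \<in> {0..T} \<Longrightarrow> u t \<in> L2 L"
  using sol by (auto simp: calmed_KS_weak_solution_def C_time_def)

lemma u_H2: "AE t in lebesgue. t \<in> {0..T} \<longrightarrow> u t \<in> sobolev L 2"
proof -
  have "strongly_measurable T (sobolev L 2) (sobolev_norm L 2) u"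
    using sol by (simp add: calmed_KS_weak_solution_def L2_time_def)
  then obtain s where "AE t in lebesgue. t \<in> {0..T} \<longrightarrow>
      u t \<in> sobolev L 2 \<and> (\<lambda>n. sobolev_norm L 2 (\<lambda>x. s n t x - u t x)) \<longlonglongrightarrow> 0"
    unfolding strongly_measurable_def by blast
  then show ?thesis by eventually_elim blast
qed

lemma H2_integrable: "set_integrable lebesgue {0..T} (\<lambda>t. (sobolev_norm L 2 (u t))\<^sup>2)"
  using sol by (simp add: calmed_KS_weak_solution_def L2_time_def)

lemma amplitude_continuous: "continuous_on {0..T} (amplitude i)"
  unfolding continuous_on_def
proof
  fix t assume t: "t \<in> {0..T}"
  have lim: "((\<lambda>s. L2_norm L (\<lambda>x. u s x - u t x)) \<longlongrightarrow> 0) (at t within {0..T})"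
    using sol t by (auto simp: calmed_KS_weak_solution_def C_time_def)
  have "((\<lambda>s. amplitude i s - amplitude i t) \<longlongrightarrow> 0) (at t within {0..T})"
  proof (rule Lim_null_comparison[OF _ lim])
    have "\<bar>amplitude i s - amplitude i t\<bar> \<le> L2_norm L (\<lambda>x. u s x - u t x)" if "s \<in> {0..T}" for s
      using fcoeff_le[OF L L2_diff[OF u_L2[OF that] u_L2[OF t]], of i]
      unfolding L2_norm_def amplitude_def fcoeff_diff[OF L u_L2[OF that] u_L2[OF t]] by (rule real_le_rsqrt[of "\<bar>_\<bar>", simplified])
    then show "\<forall>\<^sub>F s in at t within {0..T}. norm (amplitude i s - amplitude i t) \<le> L2_norm L (\<lambda>x. u s x - u t x)"
      by (auto simp: eventually_at_filter)
  qed
  then show "(amplitude i \<longlongrightarrow> amplitude i t) (at t within {0..T})" by (simp add: LIM_zero_iff)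
qed

lemma amplitude_0: "amplitude i 0 = fcoeff L u0 i"
  unfolding amplitude_def
proof (rule fcoeff_cong_AE[OF L])
  show "u 0 \<in> L2 L" using T by (intro u_L2) simp
  show "u0 \<in> L2 L" using sol by (simp add: calmed_KS_weak_solution_def)
  have "AE x in lborel. u 0 x = u0 x"
    using sol unfolding calmed_KS_weak_solution_def by (elim conjE)
  then show "AE x in lborel. x \<in> cell L \<longrightarrow> u 0 x = u0 x" by eventually_elim simp
qed

text \<open>Evaluating the equation at one basis field gives a scalar ODE. The derivative g stays
  existentially quantified because the time derivative is given only up to null sets, and the
  equation for it holds almost everywhere.\<close>

lemma mode_equation:
  "\<exists>g. g absolutely_integrable_on {0..T} \<and> (\<forall>t\<in>{0..T}. amplitude i t = amplitude i 0 + integral {0..t} g) \<and>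
    (AE t in lebesgue. t \<in> {0..T} \<longrightarrow> eigenvalue L (fst i) * amplitude i t - (eigenvalue L (fst i))\<^sup>2 * amplitude i t - g t
       = fcoeff L (calmed_advection L \<eta> (u t)) i)"
proof -
  let ?e = "trig_basis L i"
  obtain g where g: "g \<in> L2_time T (H_minus2 L) (H_minus2_norm L)" "is_time_deriv L T u g"
    and eq: "AE t in lebesgue. t \<in> {0..T} \<longrightarrow> (\<forall>w\<in>sobolev L 2.
           g t w + embed_dual L (calmed_advection L \<eta> (u t)) w
             + embed_dual L (weak_laplacian L (u t)) w + bilaplacian_dual L (u t) w = 0)"
    using sol unfolding calmed_KS_weak_solution_def by (elim conjE bexE) (rule that)
  have e: "?e \<in> sobolev L 2" by (rule trig_basis_sobolev[OF L])
  have gi: "(\<lambda>t. g t ?e) absolutely_integrable_on {0..T}"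
    by (rule H_minus2_evaluation_integrable[OF L g(1) e])
  have ag: "amplitude i t = amplitude i 0 + integral {0..t} (\<lambda>t. g t ?e)" if "t \<in> {0..T}" for t
  proof (rule weak_time_derivative_integral[OF amplitude_continuous gi _ T that])
    show "(LINT t:{0..T}|lebesgue. deriv \<theta> t * amplitude i t) = - (LINT t:{0..T}|lebesgue. \<theta> t * g t ?e)"
      if "\<theta> \<in> time_test T" for \<theta>
      using g(2)[unfolded is_time_deriv_def, rule_format, OF that e] unfolding amplitude_def fcoeff_def embed_dual_def .
  qed
  have ae: "AE t in lebesgue. t \<in> {0..T} \<longrightarrow> eigenvalue L (fst i) * amplitude i t - (eigenvalue L (fst i))\<^sup>2 * amplitude i t - g t ?e
       = fcoeff L (calmed_advection L \<eta> (u t)) i"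
    using eq u_H2
  proof eventually_elim
    case (elim t)
    show ?case
    proof
      assume t: "t \<in> {0..T}"
      have ut: "u t \<in> sobolev L 2" using elim(2) t by blast
      have z: "g t ?e + embed_dual L (calmed_advection L \<eta> (u t)) ?e
             + embed_dual L (weak_laplacian L (u t)) ?e + bilaplacian_dual L (u t) ?e = 0"
        using elim(1) t e by blast
      note w = weak_laplacian_L2[OF L ut]
      have "embed_dual L (weak_laplacian L (u t)) ?e = - eigenvalue L (fst i) * amplitude i t"
        using w(2)[of i] by (simp add: embed_dual_def fcoeff_def amplitude_def)
      \<comment> \<open>One factor is the coefficient of the Laplacian of u, the other comes from
        moving the second Laplacian onto the basis field; their signs cancel.\<close>
      moreover have "bilaplacian_dual L (u t) ?e = (eigenvalue L (fst i))\<^sup>2 * amplitude i t"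
        unfolding bilaplacian_dual_def laplacian_dual_def L2_inner_weak_laplacian_basis[OF L w(1)] w(2) amplitude_def
        by (simp add: power2_eq_square)
      moreover have "embed_dual L (calmed_advection L \<eta> (u t)) ?e = fcoeff L (calmed_advection L \<eta> (u t)) i"
        by (simp add: embed_dual_def fcoeff_def)
      ultimately show "eigenvalue L (fst i) * amplitude i t - (eigenvalue L (fst i))\<^sup>2 * amplitude i t - g t ?e
          = fcoeff L (calmed_advection L \<eta> (u t)) i" using z by linarith
    qed
  qed
  show ?thesis by (rule exI[of _ "\<lambda>t. g t ?e"]) (intro conjI ballI gi ag ae)
qed

text \<open>The 3 is the constant of \<open>one_eigenvalue_le_sweight\<close>, applied to the
  initial data. In the forcing, 9 = 3 * 3 comes from the weight 3 (1 + l^2), and 8 M^2 = 2 * 4 M^2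
  from twice the advection bound.\<close>

definition energy_bound :: "nat \<Rightarrow> real" where
  "energy_bound m = 3 * (sobolev_norm L m u0)\<^sup>2 + (9 + 8 * M\<^sup>2) * integral {0..T} (\<lambda>t. (sobolev_norm L 2 (u t))\<^sup>2)"

lemma one_eigenvalue_le_sweight:
  assumes "m \<in> {1, 2}"
  shows "1 + eigenvalue L k ^ m \<le> 3 * sweight L m k"
proof -
  have "1 \<le> sweight L m k"
    using dweight_le_sweight[of "\<lambda>_. 0" m L k] by (simp add: dweight_def order_of_eq)
  then show ?thesis using eigenvalue_le_sweight[OF assms, of L k] by linarith
qed

text \<open>Summing the mode energies over a finite set commutes with integration, and Bessel bounds
  the summed forcing independently of the set.\<close>

lemma energy_estimate:
  assumes m: "m \<in> {1, 2}" and u0: "u0 \<in> sobolev L m" and X: "finite X" and t: "t \<in> {0..T}"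
  shows "(\<Sum>i\<in>X. (1 + eigenvalue L (fst i) ^ m) * (amplitude i t)\<^sup>2)
    + integral {0..t} (\<lambda>r. \<Sum>i\<in>X. (1 + eigenvalue L (fst i) ^ (m + 2)) / 2 * (amplitude i r)\<^sup>2) \<le> energy_bound m"
proof -
  let ?\<mu> = "\<lambda>i. eigenvalue L (fst i)"
  have "\<exists>g. (\<forall>i. g i absolutely_integrable_on {0..T} \<and> (\<forall>t\<in>{0..T}. amplitude i t = amplitude i 0 + integral {0..t} (g i)) \<and>
    (AE t in lebesgue. t \<in> {0..T} \<longrightarrow> ?\<mu> i * amplitude i t - (?\<mu> i)\<^sup>2 * amplitude i t - g i t
       = fcoeff L (calmed_advection L \<eta> (u t)) i))"
    by (intro choice allI mode_equation)
  then obtain g where G: "\<forall>i. g i absolutely_integrable_on {0..T} \<and> (\<forall>t\<in>{0..T}. amplitude i t = amplitude i 0 + integral {0..t} (g i)) \<and>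
    (AE t in lebesgue. t \<in> {0..T} \<longrightarrow> ?\<mu> i * amplitude i t - (?\<mu> i)\<^sup>2 * amplitude i t - g i t
       = fcoeff L (calmed_advection L \<eta> (u t)) i)" ..
  have g: "g i absolutely_integrable_on {0..T}" for i
    by (rule conjunct1[OF spec[OF G]])
  have ag: "amplitude i t = amplitude i 0 + integral {0..t} (g i)" if "t \<in> {0..T}" for i t
    by (rule bspec[OF conjunct1[OF conjunct2[OF spec[OF G]]] that])
  have gf: "AE t in lebesgue. t \<in> {0..T} \<longrightarrow> ?\<mu> i * amplitude i t - (?\<mu> i)\<^sup>2 * amplitude i t - g i t
       = fcoeff L (calmed_advection L \<eta> (u t)) i" for i
    by (rule conjunct2[OF conjunct2[OF spec[OF G]]])
  define F where "F i t = ?\<mu> i * amplitude i t - (?\<mu> i)\<^sup>2 * amplitude i t - g i t" for i t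
  have sub: "{0..t} \<subseteq> {0..T}" using t by auto
  \<comment> \<open>The exceptional null set varies with the mode; a finite set of modes keeps their
    union null.\<close>
  have advection: "AE t in lebesgue. t \<in> {0..T} \<longrightarrow> (\<Sum>i\<in>Y. (F i t)\<^sup>2) \<le> 4 * M\<^sup>2 * (sobolev_norm L 2 (u t))\<^sup>2"
    if Y: "finite Y" for Y
  proof -
    have "AE t in lebesgue. \<forall>i\<in>Y. t \<in> {0..T} \<longrightarrow> F i t = fcoeff L (calmed_advection L \<eta> (u t)) i"
      unfolding F_def using gf by (intro AE_finite_allI Y)
    with u_H2 show ?thesis
    proof eventually_elim
      case (elim t)
      show ?case
      proof
        assume "t \<in> {0..T}"
        with elim have ut: "u t \<in> sobolev L 2" and eq: "\<forall>i\<in>Y. F i t = fcoeff L (calmed_advection L \<eta> (u t)) i" by auto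
        note N = calmed_advection_L2[OF \<eta>_cont \<eta>_bound ut]
        have "(\<Sum>i\<in>Y. (F i t)\<^sup>2) = (\<Sum>i\<in>Y. (fcoeff L (calmed_advection L \<eta> (u t)) i)\<^sup>2)" using eq by simp
        also have "\<dots> \<le> L2_inner L (calmed_advection L \<eta> (u t)) (calmed_advection L \<eta> (u t))" by (rule bessel[OF L N(1) Y])
        also note N(2)
        finally show "(\<Sum>i\<in>Y. (F i t)\<^sup>2) \<le> 4 * M\<^sup>2 * (sobolev_norm L 2 (u t))\<^sup>2" .
      qed
    qed
  qed
  \<comment> \<open>Integrability of g does not give that of its square. The squared forcing is
    dominated almost everywhere by the advection bound, which is integrable because u is in
    L^2(0,T;H^2).\<close>
  have Fabs: "(\<lambda>t. (F i t)\<^sup>2) absolutely_integrable_on {0..T}" for i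
  proof (rule set_integrable_bound)
    show "set_integrable lebesgue {0..T} (\<lambda>t. 4 * M\<^sup>2 * (sobolev_norm L 2 (u t))\<^sup>2)"
      by (intro set_integrable_mult_right H2_integrable)
    have "F i absolutely_integrable_on {0..T}"
      unfolding F_def
      by (intro set_integral_diff(1) g absolutely_integrable_continuous_real continuous_intros amplitude_continuous)
    then have "(\<lambda>t. (indicator {0..T} t *\<^sub>R F i t)\<^sup>2) \<in> borel_measurable lebesgue"
      unfolding set_integrable_def by (intro borel_measurable_power borel_measurable_integrable)
    moreover have "(\<lambda>t. (indicator {0..T} t *\<^sub>R F i t)\<^sup>2) = (\<lambda>t. indicator {0..T} t *\<^sub>R (F i t)\<^sup>2)"
      by (auto simp: indicator_def)
    ultimately show "set_borel_measurable lebesgue {0..T} (\<lambda>t. (F i t)\<^sup>2)" by (simp add: set_borel_measurable_def)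
    show "AE t in lebesgue. t \<in> {0..T} \<longrightarrow> norm ((F i t)\<^sup>2) \<le> norm (4 * M\<^sup>2 * (sobolev_norm L 2 (u t))\<^sup>2)"
      using advection[of "{i}"] by simp
  qed
  define Z where "Z r = (\<Sum>i\<in>X. 3 * (1 + (?\<mu> i)\<^sup>2) * (amplitude i r)\<^sup>2 + 2 * (F i r)\<^sup>2)" for r
  have Z0: "0 \<le> Z r" for r unfolding Z_def by (intro sum_nonneg add_nonneg_nonneg mult_nonneg_nonneg) auto
  have abs_a: "(\<lambda>r. c * (amplitude i r)\<^sup>2) absolutely_integrable_on {0..T}" for c i
    by (intro absolutely_integrable_continuous_real continuous_intros amplitude_continuous)
  have summand: "(\<lambda>r. 3 * (1 + (?\<mu> i)\<^sup>2) * (amplitude i r)\<^sup>2 + 2 * (F i r)\<^sup>2) absolutely_integrable_on {0..T}" for i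
    by (intro set_integral_add(1) abs_a set_integrable_mult_right Fabs)
  have Zabs: "Z absolutely_integrable_on {0..T}"
    unfolding Z_def by (intro absolutely_integrable_sum X summand)
  have Zle: "AE r in lebesgue. r \<in> {0..T} \<longrightarrow> Z r \<le> (9 + 8 * M\<^sup>2) * (sobolev_norm L 2 (u r))\<^sup>2"
    using advection[OF X] u_H2
  proof eventually_elim
    case (elim r)
    show ?case
    proof
      assume "r \<in> {0..T}"
      with elim have ur: "u r \<in> sobolev L 2" and F: "(\<Sum>i\<in>X. (F i r)\<^sup>2) \<le> 4 * M\<^sup>2 * (sobolev_norm L 2 (u r))\<^sup>2" by auto
      have "(\<Sum>i\<in>X. (1 + (?\<mu> i)\<^sup>2) * (amplitude i r)\<^sup>2) \<le> (\<Sum>i\<in>X. 3 * (sweight L 2 (fst i) * (amplitude i r)\<^sup>2))"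
      proof (rule sum_mono)
        fix i
        have "(1 + (?\<mu> i)\<^sup>2) * (amplitude i r)\<^sup>2 \<le> (3 * sweight L 2 (fst i)) * (amplitude i r)\<^sup>2"
          by (intro mult_right_mono one_eigenvalue_le_sweight) auto
        then show "(1 + (?\<mu> i)\<^sup>2) * (amplitude i r)\<^sup>2 \<le> 3 * (sweight L 2 (fst i) * (amplitude i r)\<^sup>2)" by (simp only: mult.assoc)
      qed
      also have "\<dots> = 3 * (\<Sum>i\<in>X. sweight L 2 (fst i) * (amplitude i r)\<^sup>2)" by (simp only: sum_distrib_left)
      also have "(\<Sum>i\<in>X. sweight L 2 (fst i) * (amplitude i r)\<^sup>2) \<le> (sobolev_norm L 2 (u r))\<^sup>2"
        unfolding amplitude_def by (rule finite_sum_le_has_sum[OF sobolev_norm_has_sum[OF L ur] X]) auto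
      finally have A: "(\<Sum>i\<in>X. (1 + (?\<mu> i)\<^sup>2) * (amplitude i r)\<^sup>2) \<le> 3 * (sobolev_norm L 2 (u r))\<^sup>2" by simp
      have "Z r = 3 * (\<Sum>i\<in>X. (1 + (?\<mu> i)\<^sup>2) * (amplitude i r)\<^sup>2) + 2 * (\<Sum>i\<in>X. (F i r)\<^sup>2)"
        by (simp only: Z_def sum.distrib sum_distrib_left mult.assoc)
      with A F show "Z r \<le> (9 + 8 * M\<^sup>2) * (sobolev_norm L 2 (u r))\<^sup>2" by (simp add: algebra_simps)
    qed
  qed
  have int: "(\<lambda>r. c * (amplitude i r)\<^sup>2) integrable_on {0..t}" for c i
    by (rule set_lebesgue_integral_eq_integral(1)[OF absolutely_integrable_on_subinterval[OF abs_a sub]])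
  have sint: "(\<lambda>r. 3 * (1 + (?\<mu> i)\<^sup>2) * (amplitude i r)\<^sup>2 + 2 * (F i r)\<^sup>2) integrable_on {0..t}" for i
    by (rule set_lebesgue_integral_eq_integral(1)[OF absolutely_integrable_on_subinterval[OF summand sub]])
  have "(\<Sum>i\<in>X. (1 + ?\<mu> i ^ m) * (amplitude i t)\<^sup>2) + integral {0..t} (\<lambda>r. \<Sum>i\<in>X. (1 + ?\<mu> i ^ (m + 2)) / 2 * (amplitude i r)\<^sup>2)
      = (\<Sum>i\<in>X. (1 + ?\<mu> i ^ m) * (amplitude i t)\<^sup>2 + integral {0..t} (\<lambda>r. (1 + ?\<mu> i ^ (m + 2)) / 2 * (amplitude i r)\<^sup>2))"
    by (simp only: integral_sum[OF X int] sum.distrib)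
  also have "\<dots> \<le> (\<Sum>i\<in>X. (1 + ?\<mu> i ^ m) * (amplitude i 0)\<^sup>2 + integral {0..t} (\<lambda>r. 3 * (1 + (?\<mu> i)\<^sup>2) * (amplitude i r)\<^sup>2 + 2 * (F i r)\<^sup>2))"
    unfolding F_def
    by (intro sum_mono mode_energy[OF amplitude_continuous g ag _ m t])
      (use set_lebesgue_integral_eq_integral(1)[OF Fabs] in \<open>auto simp: F_def\<close>)
  also have "\<dots> = (\<Sum>i\<in>X. (1 + ?\<mu> i ^ m) * (amplitude i 0)\<^sup>2) + integral {0..t} Z"
    unfolding Z_def integral_sum[OF X sint] by (rule sum.distrib)
  finally have energy: "(\<Sum>i\<in>X. (1 + ?\<mu> i ^ m) * (amplitude i t)\<^sup>2)
      + integral {0..t} (\<lambda>r. \<Sum>i\<in>X. (1 + ?\<mu> i ^ (m + 2)) / 2 * (amplitude i r)\<^sup>2)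
    \<le> (\<Sum>i\<in>X. (1 + ?\<mu> i ^ m) * (amplitude i 0)\<^sup>2) + integral {0..t} Z" .
  \<comment> \<open>Enlarging the interval is allowed because Z is nonnegative, and it makes the
    bound uniform in t.\<close>
  have "integral {0..t} Z \<le> integral {0..T} Z"
    by (rule integral_subset_le[OF sub
          set_lebesgue_integral_eq_integral(1)[OF absolutely_integrable_on_subinterval[OF Zabs sub]]
          set_lebesgue_integral_eq_integral(1)[OF Zabs]]) (simp add: Z0)
  also have "integral {0..T} Z = (LINT r:{0..T}|lebesgue. Z r)"
    by (rule set_lebesgue_integral_eq_integral(2)[OF Zabs, symmetric])
  also have "\<dots> \<le> (LINT r:{0..T}|lebesgue. (9 + 8 * M\<^sup>2) * (sobolev_norm L 2 (u r))\<^sup>2)"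
    by (rule set_integral_mono_AE[OF Zabs set_integrable_mult_right[OF H2_integrable]]) (use Zle in auto)
  also have "\<dots> = (9 + 8 * M\<^sup>2) * integral {0..T} (\<lambda>r. (sobolev_norm L 2 (u r))\<^sup>2)"
    by (simp only: set_integral_mult_right set_lebesgue_integral_eq_integral(2)[OF H2_integrable])
  finally have forcing: "integral {0..t} Z \<le> (9 + 8 * M\<^sup>2) * integral {0..T} (\<lambda>r. (sobolev_norm L 2 (u r))\<^sup>2)" .
  have "(\<Sum>i\<in>X. (1 + ?\<mu> i ^ m) * (amplitude i 0)\<^sup>2) \<le> (\<Sum>i\<in>X. 3 * (sweight L m (fst i) * (fcoeff L u0 i)\<^sup>2))"
  proof (rule sum_mono)
    fix i
    have "(1 + ?\<mu> i ^ m) * (amplitude i 0)\<^sup>2 \<le> (3 * sweight L m (fst i)) * (amplitude i 0)\<^sup>2"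
      by (intro mult_right_mono one_eigenvalue_le_sweight m) auto
    then show "(1 + ?\<mu> i ^ m) * (amplitude i 0)\<^sup>2 \<le> 3 * (sweight L m (fst i) * (fcoeff L u0 i)\<^sup>2)"
      by (simp only: mult.assoc amplitude_0)
  qed
  also have "\<dots> = 3 * (\<Sum>i\<in>X. sweight L m (fst i) * (fcoeff L u0 i)\<^sup>2)" by (simp only: sum_distrib_left)
  also have "(\<Sum>i\<in>X. sweight L m (fst i) * (fcoeff L u0 i)\<^sup>2) \<le> (sobolev_norm L m u0)\<^sup>2"
    by (rule finite_sum_le_has_sum[OF sobolev_norm_has_sum[OF L u0] X]) auto
  finally have "(\<Sum>i\<in>X. (1 + ?\<mu> i ^ m) * (amplitude i 0)\<^sup>2) \<le> 3 * (sobolev_norm L m u0)\<^sup>2" by simp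
  with energy forcing show ?thesis unfolding energy_bound_def by linarith
qed

text \<open>Dropping the dissipation from the energy estimate bounds every finite partial sum of the
  norm. The result holds at every time, as the coefficients are continuous and u(t) is in L^2 for
  all t.\<close>

lemma sup_bound:
  assumes m: "m \<in> {1, 2}" and u0: "u0 \<in> sobolev L m" and t: "t \<in> {0..T}"
  shows "u t \<in> sobolev L m" "(sobolev_norm L m (u t))\<^sup>2 \<le> card {\<alpha>. order_of \<alpha> \<le> m} * energy_bound m"
proof -
  have le: "(\<Sum>i\<in>X. sweight L m (fst i) * (fcoeff L (u t) i)\<^sup>2) \<le> card {\<alpha>. order_of \<alpha> \<le> m} * energy_bound m"
    if X: "finite X" for X
  proof -
    have "(\<Sum>i\<in>X. sweight L m (fst i) * (fcoeff L (u t) i)\<^sup>2)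
        \<le> (\<Sum>i\<in>X. card {\<alpha>. order_of \<alpha> \<le> m} * ((1 + eigenvalue L (fst i) ^ m) * (amplitude i t)\<^sup>2))"
      unfolding amplitude_def mult.assoc[symmetric] by (intro sum_mono mult_right_mono sweight_le) auto
    also have "\<dots> = card {\<alpha>. order_of \<alpha> \<le> m} * (\<Sum>i\<in>X. (1 + eigenvalue L (fst i) ^ m) * (amplitude i t)\<^sup>2)"
      by (simp only: sum_distrib_left)
    also have "\<dots> \<le> card {\<alpha>. order_of \<alpha> \<le> m} * energy_bound m"
    proof (rule mult_left_mono)
      \<comment> \<open>The case split relies on the default value 0 of the integral of a
        non-integrable function.\<close>
      have "0 \<le> integral {0..t} (\<lambda>r. \<Sum>i\<in>X. (1 + eigenvalue L (fst i) ^ (m + 2)) / 2 * (amplitude i r)\<^sup>2)"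
        by (cases "(\<lambda>r. \<Sum>i\<in>X. (1 + eigenvalue L (fst i) ^ (m + 2)) / 2 * (amplitude i r)\<^sup>2) integrable_on {0..t}")
          (auto intro!: integral_nonneg sum_nonneg simp: not_integrable_integral)
      then show "(\<Sum>i\<in>X. (1 + eigenvalue L (fst i) ^ m) * (amplitude i t)\<^sup>2) \<le> energy_bound m"
        using energy_estimate[OF m u0 X t] by linarith
    qed simp
    finally show ?thesis .
  qed
  have "(\<lambda>i. sweight L m (fst i) * (fcoeff L (u t) i)\<^sup>2) summable_on UNIV"
    by (rule nonneg_bdd_above_summable_on) (auto intro!: bdd_aboveI2 le)
  then show ut: "u t \<in> sobolev L m" by (simp add: sobolev_iff[OF L] u_L2[OF t])
  show "(sobolev_norm L m (u t))\<^sup>2 \<le> card {\<alpha>. order_of \<alpha> \<le> m} * energy_bound m"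
    by (rule has_sum_le_finite_sums[OF sobolev_norm_has_sum[OF L ut] le])
qed

text \<open>At t = T the dissipation alone bounds the time integrals of the partial sums over
  \<open>mode_box n\<close>; their monotone limit is the squared H^(m+2) norm for almost every
  t.\<close>

lemma L2_bound:
  assumes m: "m \<in> {1, 2}" and u0: "u0 \<in> sobolev L m"
  shows "AE t in lebesgue. t \<in> {0..T} \<longrightarrow> u t \<in> sobolev L (m + 2)"
    "set_integrable lebesgue {0..T} (\<lambda>t. (sobolev_norm L (m + 2) (u t))\<^sup>2)"
proof -
  let ?C = "real (card {\<alpha>. order_of \<alpha> \<le> m + 2})"
  define f where "f n t = (\<Sum>i\<in>mode_box n. sweight L (m + 2) (fst i) * (amplitude i t)\<^sup>2)" for n t
  have cont: "continuous_on {0..T} (f n)" for n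
    unfolding f_def by (intro continuous_intros amplitude_continuous)
  have f0: "0 \<le> f n t" for n t unfolding f_def by (intro sum_nonneg) auto
  have mono: "f n t \<le> f (Suc n) t" for n t
    unfolding f_def by (intro sum_mono2 finite_mode_box mode_box_mono) auto
  have bd: "integral {0..T} (f n) \<le> 2 * ?C * energy_bound m" for n
  proof -
    let ?h = "\<lambda>r. \<Sum>i\<in>mode_box n. (1 + eigenvalue L (fst i) ^ (m + 2)) / 2 * (amplitude i r)\<^sup>2"
    have "integral {0..T} (f n) \<le> integral {0..T} (\<lambda>r. 2 * ?C * ?h r)"
    proof (rule integral_le)
      show "f n integrable_on {0..T}" by (rule integrable_continuous_real[OF cont])
      show "(\<lambda>r. 2 * ?C * ?h r) integrable_on {0..T}"
        by (intro integrable_continuous_real continuous_intros amplitude_continuous) auto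
      fix r
      have "f n r \<le> (\<Sum>i\<in>mode_box n. ?C * (1 + eigenvalue L (fst i) ^ (m + 2)) * (amplitude i r)\<^sup>2)"
        unfolding f_def by (intro sum_mono mult_right_mono sweight_le) auto
      also have "\<dots> = 2 * ?C * ?h r" by (simp add: sum_distrib_left mult.assoc)
      finally show "f n r \<le> 2 * ?C * ?h r" .
    qed
    also have "\<dots> = 2 * ?C * integral {0..T} ?h" by (simp only: integral_mult_right)
    also have "\<dots> \<le> 2 * ?C * energy_bound m"
    proof (rule mult_left_mono)
      have "0 \<le> (\<Sum>i\<in>mode_box n. (1 + eigenvalue L (fst i) ^ m) * (amplitude i T)\<^sup>2)" by (intro sum_nonneg) auto
      moreover have "T \<in> {0..T}" using T by simp
      ultimately show "integral {0..T} ?h \<le> energy_bound m"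
        using energy_estimate[OF m u0 finite_mode_box, of T n] by linarith
    qed simp
    finally show ?thesis .
  qed
  note bl = AE_sum_limit_integrable[where f = f and T = T, OF cont f0 mono bd]
  have *: "AE t in lebesgue. t \<in> {0..T} \<longrightarrow> u t \<in> sobolev L (m + 2) \<and> (sobolev_norm L (m + 2) (u t))\<^sup>2 = lim (\<lambda>n. f n t)"
    using bl(1)
  proof eventually_elim
    case (elim t)
    show ?case
    proof
      assume t: "t \<in> {0..T}"
      with elim have conv: "convergent (\<lambda>n. f n t)" by blast
      then obtain B where B: "\<And>n. f n t \<le> B"
        by (metis Bseq_def convergent_imp_Bseq norm_ge_zero real_norm_def abs_ge_self order_trans)
      have "(\<Sum>i\<in>X. sweight L (m + 2) (fst i) * (fcoeff L (u t) i)\<^sup>2) \<le> B" if X: "finite X" for X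
      proof -
        obtain n where "X \<subseteq> mode_box n"
          using mode_box_exhausts[OF X] by (auto simp: eventually_at_top_linorder)
        then have "(\<Sum>i\<in>X. sweight L (m + 2) (fst i) * (fcoeff L (u t) i)\<^sup>2) \<le> f n t"
          unfolding f_def amplitude_def by (intro sum_mono2 finite_mode_box) auto
        then show ?thesis using B[of n] by linarith
      qed
      then have "(\<lambda>i. sweight L (m + 2) (fst i) * (fcoeff L (u t) i)\<^sup>2) summable_on UNIV"
        by (intro nonneg_bdd_above_summable_on) (auto intro!: bdd_aboveI2)
      then have ut: "u t \<in> sobolev L (m + 2)" by (simp add: sobolev_iff[OF L] u_L2[OF t])
      have "(\<lambda>n. f n t) \<longlonglongrightarrow> (sobolev_norm L (m + 2) (u t))\<^sup>2"
        unfolding f_def amplitude_def by (rule has_sum_mode_box[OF sobolev_norm_has_sum[OF L ut]])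
      with ut show "u t \<in> sobolev L (m + 2) \<and> (sobolev_norm L (m + 2) (u t))\<^sup>2 = lim (\<lambda>n. f n t)"
        by (simp add: limI)
    qed
  qed
  then show "AE t in lebesgue. t \<in> {0..T} \<longrightarrow> u t \<in> sobolev L (m + 2)" by eventually_elim blast
  \<comment> \<open>Measurability of the squared norm is inherited from the limit of continuous
    partial sums, with which it agrees almost everywhere; this uses completeness of Lebesgue
    measure.\<close>
  have ae: "AE t in lebesgue. indicator {0..T} t *\<^sub>R lim (\<lambda>n. f n t) = indicator {0..T} t *\<^sub>R (sobolev_norm L (m + 2) (u t))\<^sup>2"
    using * by eventually_elim (auto simp: indicator_def)
  note int = bl(2)[unfolded set_integrable_def]
  show "set_integrable lebesgue {0..T} (\<lambda>t. (sobolev_norm L (m + 2) (u t))\<^sup>2)"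
    unfolding set_integrable_def
    using integrable_cong_AE[OF borel_measurable_integrable[OF int] borel_measurable_AE[OF borel_measurable_integrable[OF int] ae] ae] int
    by blast
qed

text \<open>Besides the bounds, strong measurability must be established anew in each target norm;
  continuity of the individual coefficients and membership almost everywhere suffice.\<close>

lemma regularity:
  assumes m: "m \<in> {1, 2}" and u0: "u0 \<in> sobolev L m"
  shows "u \<in> Linf_time T (sobolev L m) (sobolev_norm L m)
           \<inter> L2_time T (sobolev L (m + 2)) (sobolev_norm L (m + 2))"
proof
  have meas: "strongly_measurable T (sobolev L s) (sobolev_norm L s) u"
    if "AE t in lebesgue. t \<in> {0..T} \<longrightarrow> u t \<in> sobolev L s" for s
    by (rule strongly_measurable_of_fcoeff[OF L T amplitude_continuous[unfolded amplitude_def] that finite_mode_box mode_box_exhausts])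
  have "sobolev_norm L m (u t) \<le> sqrt (card {\<alpha>. order_of \<alpha> \<le> m} * energy_bound m)" if "t \<in> {0..T}" for t
    using sup_bound(2)[OF m u0 that] by (rule real_le_rsqrt)
  then show "u \<in> Linf_time T (sobolev L m) (sobolev_norm L m)"
    unfolding Linf_time_def using sup_bound(1)[OF m u0] by (auto intro!: meas always_eventually)
  show "u \<in> L2_time T (sobolev L (m + 2)) (sobolev_norm L (m + 2))"
    unfolding L2_time_def using L2_bound[OF m u0] meas by blast
qed

end

theorem theorem1p7:
  fixes L T \<epsilon> :: real and m :: nat
    and \<eta> :: "real \<Rightarrow> real^2 \<Rightarrow> real^2"
    and u0 :: "real^2 \<Rightarrow> real^2" and u :: "real \<Rightarrow> real^2 \<Rightarrow> real^2"
  assumes "0 < L" and "0 < \<epsilon>"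
    and "bounded (range (\<eta> \<epsilon>))" and "1-lipschitz_on UNIV (\<eta> \<epsilon>)"
    and "m \<in> {1, 2}" and "0 < T"
    and "calmed_KS_weak_solution L (\<eta> \<epsilon>) T u0 u"
    and "u0 \<in> sobolev L m"
  shows "u \<in> Linf_time T (sobolev L m) (sobolev_norm L m)
           \<inter> L2_time T (sobolev L (m + 2)) (sobolev_norm L (m + 2))"
proof -
  obtain M where "\<And>y. norm (\<eta> \<epsilon> y) \<le> M"
    using assms(3) unfolding bounded_iff by blast
  \<comment> \<open>The Lipschitz condition supplies the continuity of \<eta>, which makes its
    composition with u measurable.\<close>
  then interpret calmed_KS L T "\<eta> \<epsilon>" M u0 u
    using assms lipschitz_on_continuous_on[OF assms(4)] by unfold_locales
  show ?thesis by (rule regularity) fact+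
qed

end
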